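(* In each of the following cases one has, at every point $x$ of the underlying space, $$\lim_{\sigma\to1^-}L^\sigma f(x)=Lf(x),\qquad \lim_{\sigma\to0^+}L^\sigma f(x)=f(x):$$ (1) $L=-\Delta$ on $\mathbb{R}^n$ and $f\in\mathcal S(\mathbb{R}^n)$; (2) $L=-\Delta+|x|^2$ on $\mathbb{R}^n$ and $f\in\mathcal S(\mathbb{R}^n)$; (3) $L=\partial_t-\Delta_x$ on $\mathbb{R}^{n+1}$ (variables $(t,x)\in\mathbb{R}\times\mathbb{R}^n$) and $f\in\mathcal S(\mathbb{R}^{n+1})$.
   Context: $\mathcal S$ denotes the Schwartz class. For $0<\sigma<1$ the fractional power is defined pointwise by $$L^\sigma f(x)=\frac{1}{\Gamma(-\sigma)}\int_0^\infty\left(e^{-\tau L}f(x)-f(x)\right)\frac{d\tau}{\tau^{1+\sigma}},$$ where $\{e^{-\tau L}\}_{\tau>0}$ is the semigroup generated by $-L$: in case (1), the Gaussian heat semigroup $e^{\tau\Delta}f(x)=(4\pi\tau)^{-n/2}\int_{\mathbb{R}^n}e^{-|x-y|^2/(4\tau)}f(y)\,dy$; in case (2), the semigroup of the self-adjoint harmonic oscillator $-\Delta+|x|^2$ on $L^2(\mathbb{R}^n)$ (with its smooth representative); in case (3), $e^{-\tau L}f(t,x)=(4\pi\tau)^{-n/2}\int_{\mathbb{R}^n}e^{-|x-y|^2/(4\tau)}f(t-\tau,y)\,dy$. *)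

theory Defs
  imports "HOL-Analysis.Analysis"
begin

text \<open>Throughout, \<^typ>\<open>'a::euclidean_space\<close> plays the role of \<open>R^n\<close>, with \<open>n = DIM('a)\<close>.\<close>

section \<open>Partial derivatives and the Schwartz class\<close>

definition partial_deriv ::
    "'p::euclidean_space \<Rightarrow> ('p \<Rightarrow> complex) \<Rightarrow> 'p \<Rightarrow> complex" where
  "partial_deriv b f p = vector_derivative (\<lambda>s::real. f (p + s *\<^sub>R b)) (at 0)"

text \<open>A list of basis vectors plays the role of a multi-index.\<close>

definition iterated_partial ::
    "'p::euclidean_space list \<Rightarrow> ('p \<Rightarrow> complex) \<Rightarrow> 'p \<Rightarrow> complex" where
  "iterated_partial bs f = foldr partial_deriv bs f"

definition smooth :: "('p::euclidean_space \<Rightarrow> complex) \<Rightarrow> bool" where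
  "smooth f \<longleftrightarrow> (\<forall>bs \<in> lists Basis. iterated_partial bs f differentiable_on UNIV)"

definition schwartz :: "('p::euclidean_space \<Rightarrow> complex) set" where
  "schwartz = {f. smooth f \<and>
     (\<forall>k::nat. \<forall>bs \<in> lists Basis. bounded (range (\<lambda>p. norm p ^ k *\<^sub>R iterated_partial bs f p)))}"

section \<open>The differential operators\<close>

definition laplacian :: "('a::euclidean_space \<Rightarrow> complex) \<Rightarrow> 'a \<Rightarrow> complex" where
  "laplacian f x = (\<Sum>b\<in>Basis. partial_deriv b (partial_deriv b f) x)"

definition harmonic_op :: "('a::euclidean_space \<Rightarrow> complex) \<Rightarrow> 'a \<Rightarrow> complex" where
  "harmonic_op f x = - laplacian f x + (norm x)\<^sup>2 *\<^sub>R f x"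

definition heat_op :: "(real \<times> 'a::euclidean_space \<Rightarrow> complex) \<Rightarrow> real \<times> 'a \<Rightarrow> complex" where
  "heat_op f p = partial_deriv (1, 0) f p
     - (\<Sum>b\<in>Basis. partial_deriv (0, b) (partial_deriv (0, b) f) p)"

section \<open>Fractional powers by means of a semigroup\<close>

text \<open>Here \<open>S \<tau> f p\<close> stands for the value at \<open>p\<close> of \<open>e\<^sup>-\<^sup>\<tau>\<^sup>L f\<close>.\<close>

definition frac_power ::
    "(real \<Rightarrow> ('p \<Rightarrow> complex) \<Rightarrow> 'p \<Rightarrow> complex) \<Rightarrow> real \<Rightarrow> ('p \<Rightarrow> complex) \<Rightarrow> 'p \<Rightarrow> complex" where
  "frac_power S \<sigma> f p =
     (1 / Gamma (- \<sigma>)) *\<^sub>R (LINT \<tau>:{0<..}|lborel. (1 / \<tau> powr (1 + \<sigma>)) *\<^sub>R (S \<tau> f p - f p))"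

definition gauss_kernel :: "real \<Rightarrow> 'a::euclidean_space \<Rightarrow> real" where
  "gauss_kernel \<tau> z = (4 * pi * \<tau>) powr (- (real DIM('a) / 2)) * exp (- (norm z)\<^sup>2 / (4 * \<tau>))"

definition laplace_semigroup ::
    "real \<Rightarrow> ('a::euclidean_space \<Rightarrow> complex) \<Rightarrow> 'a \<Rightarrow> complex" where
  "laplace_semigroup \<tau> f x = (LINT y|lborel. gauss_kernel \<tau> (x - y) *\<^sub>R f y)"

definition heat_semigroup ::
    "real \<Rightarrow> (real \<times> 'a::euclidean_space \<Rightarrow> complex) \<Rightarrow> real \<times> 'a \<Rightarrow> complex" where
  "heat_semigroup \<tau> f = (\<lambda>(t, x). LINT y|lborel. gauss_kernel \<tau> (x - y) *\<^sub>R f (t - \<tau>, y))"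

section \<open>The semigroup of the self-adjoint harmonic oscillator on \<open>L\<^sup>2\<close>\<close>

text \<open>Elements of \<open>L\<^sup>2\<close> are represented by Borel functions; equality in \<open>L\<^sup>2\<close> is equality
  almost everywhere. An unbounded operator is represented by its graph, a set of pairs of such
  functions. The adjoint and generator graphs below are closed under changing either component
  of a pair on a null set.\<close>

definition L2 :: "('a::euclidean_space \<Rightarrow> complex) set" where
  "L2 = {u \<in> borel_measurable lborel. integrable lborel (\<lambda>x. (norm (u x))\<^sup>2)}"

definition L2_inner ::
    "('a::euclidean_space \<Rightarrow> complex) \<Rightarrow> ('a \<Rightarrow> complex) \<Rightarrow> complex" where
  "L2_inner u v = (LINT x|lborel. u x * cnj (v x))"

definition L2_norm :: "('a::euclidean_space \<Rightarrow> complex) \<Rightarrow> real" where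
  "L2_norm u = sqrt (LINT x|lborel. (norm (u x))\<^sup>2)"

definition densely_defined :: "('a::euclidean_space \<Rightarrow> complex) rel \<Rightarrow> bool" where
  "densely_defined G \<longleftrightarrow>
     (\<forall>u\<in>L2. \<forall>e>0. \<exists>(p, q)\<in>G. L2_norm (\<lambda>x. u x - p x) < e)"

definition adjoint_graph ::
    "('a::euclidean_space \<Rightarrow> complex) rel \<Rightarrow> ('a \<Rightarrow> complex) rel" where
  "adjoint_graph G =
     {(u, v). u \<in> L2 \<and> v \<in> L2 \<and> (\<forall>(p, q)\<in>G. L2_inner q u = L2_inner p v)}"

definition self_adjoint :: "('a::euclidean_space \<Rightarrow> complex) rel \<Rightarrow> bool" where
  "self_adjoint G \<longleftrightarrow> densely_defined G \<and> G = adjoint_graph G"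

text \<open>Since \<open>-\<Delta> + |x|\<^sup>2\<close> is essentially self-adjoint on the Schwartz class, the following
  determines its graph \<open>H\<close> uniquely.\<close>

definition harmonic_oscillator :: "('a::euclidean_space \<Rightarrow> complex) rel \<Rightarrow> bool" where
  "harmonic_oscillator H \<longleftrightarrow> self_adjoint H \<and> (\<forall>u\<in>schwartz. (u, harmonic_op u) \<in> H)"

text \<open>Strongly continuous semigroups of bounded linear operators on \<open>L\<^sup>2\<close>; \<open>T \<tau> u\<close> is only
  relevant for \<open>\<tau> \<ge> 0\<close> and \<open>u \<in> L\<^sup>2\<close>.\<close>

definition C0_semigroup ::
    "(real \<Rightarrow> ('a::euclidean_space \<Rightarrow> complex) \<Rightarrow> 'a \<Rightarrow> complex) \<Rightarrow> bool" where
  "C0_semigroup T \<longleftrightarrow>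
     (\<forall>\<tau>\<ge>0. \<forall>u\<in>L2. T \<tau> u \<in> L2) \<and>
     (\<forall>\<tau>\<ge>0. \<forall>u\<in>L2. \<forall>v\<in>L2. \<forall>c d.
        AE x in lborel. T \<tau> (\<lambda>y. c * u y + d * v y) x = c * T \<tau> u x + d * T \<tau> v x) \<and>
     (\<forall>\<tau>\<ge>0. \<exists>C. \<forall>u\<in>L2. L2_norm (T \<tau> u) \<le> C * L2_norm u) \<and>
     (\<forall>u\<in>L2. AE x in lborel. T 0 u x = u x) \<and>
     (\<forall>\<tau>\<ge>0. \<forall>\<rho>\<ge>0. \<forall>u\<in>L2. AE x in lborel. T (\<tau> + \<rho>) u x = T \<tau> (T \<rho> u) x) \<and>
     (\<forall>u\<in>L2. ((\<lambda>\<tau>. L2_norm (\<lambda>x. T \<tau> u x - u x)) \<longlongrightarrow> 0) (at_right 0))"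

definition generator ::
    "(real \<Rightarrow> ('a::euclidean_space \<Rightarrow> complex) \<Rightarrow> 'a \<Rightarrow> complex) \<Rightarrow> ('a \<Rightarrow> complex) rel" where
  "generator T = {(u, v). u \<in> L2 \<and> v \<in> L2 \<and>
     ((\<lambda>\<tau>. L2_norm (\<lambda>x. (1 / \<tau>) *\<^sub>R (T \<tau> u x - u x) - v x)) \<longlongrightarrow> 0) (at_right 0)}"

definition generated_by_minus ::
    "(real \<Rightarrow> ('a::euclidean_space \<Rightarrow> complex) \<Rightarrow> 'a \<Rightarrow> complex) \<Rightarrow> ('a \<Rightarrow> complex) rel \<Rightarrow> bool" where
  "generated_by_minus T H \<longleftrightarrow>
     C0_semigroup T \<and> generator T = {(u, \<lambda>x. - v x) |u v. (u, v) \<in> H}"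

text \<open>A function agrees almost everywhere with at most one smooth function.\<close>

definition smooth_rep :: "('a::euclidean_space \<Rightarrow> complex) \<Rightarrow> 'a \<Rightarrow> complex" where
  "smooth_rep u = (THE w. smooth w \<and> (AE x in lborel. w x = u x))"

end

theory Submission
  imports Defs "HOL-Probability.Probability"
begin

text \<open>If \<open>g \<tau> = S \<tau> f p - f p\<close> is bounded, satisfies \<open>g \<tau> = - \<tau> A + o(\<tau>)\<close> at \<open>0\<close> and tends to
  \<open>- f p\<close> at infinity, then the factor \<open>1 / Gamma (- \<sigma>) = - \<sigma> (1 - \<sigma>) / Gamma (2 - \<sigma>)\<close> picks out
  \<open>A\<close> as \<open>\<sigma> \<rightarrow> 1\<close> and \<open>f p\<close> as \<open>\<sigma> \<rightarrow> 0\<close>. In all three cases the semigroup is, up to elementary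
  factors, a Gaussian average of \<open>f\<close>, and a third-order Taylor expansion gives the behaviour at \<open>0\<close>.

  For the harmonic oscillator this rests on Mehler's formula. Writing \<open>k\<close> for the Mehler kernel, the
  function \<open>s \<mapsto> <k (\<tau> + \<epsilon> - s) x, T s f>\<close> is continuous with vanishing right derivative, because the
  kernels are Schwartz functions solving the evolution equation and the generator is self-adjoint.
  Comparing \<open>s = \<tau>\<close> with \<open>s = 0\<close>, integrating over boxes and letting \<open>\<epsilon> \<rightarrow> 0\<close> identifies \<open>T \<tau> f\<close>.\<close>

section \<open>The limits of fractional powers\<close>

text \<open>Cut the integral at a fixed \<open>\<delta>\<close>. Up to sign, the Gamma factor gives
  the part below the mass \<open>\<sigma> * \<delta> powr (1 - \<sigma>) / Gamma (2 -
  \<sigma>)\<close> and the part above the mass \<open>(1 - \<sigma>) * \<delta> powr (- \<sigma>) /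
  Gamma (2 - \<sigma>)\<close>. For every \<open>\<delta>\<close> one of them tends to 1 and the
  other to 0 at each end of the range of \<open>\<sigma>\<close>, so \<open>\<delta>\<close> may be
  small for one limit and large for the other. The obstacle in the harmonic case is that
  \<open>T\<close> is abstract: its values are functions modulo null sets, its operator bounds may
  depend on time in an uncontrolled way, and its generator is known only as a graph. Duality
  therefore pairs the orbit with functions that surely belong to the graph. The shift
  \<open>\<epsilon>\<close> keeps the kernel time positive up to \<open>s = \<tau>\<close>, where
  the unshifted kernel would degenerate to a point mass. Integrals over boxes survive the limit
  \<open>\<epsilon> \<rightarrow> 0\<close> and determine a function almost everywhere; smoothness
  of the Mehler average then turns this into a pointwise identity for
  \<open>smooth_rep\<close>.\<close>

lemma has_bochner_integral_powr_from_0: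
  fixes a c :: real
  assumes "a > -1" "c > 0"
  shows "has_bochner_integral lborel (\<lambda>x. indicator {0<..c} x * x powr a) (c powr (a + 1) / (a + 1))"
proof (rule has_bochner_integral_nn_integral)
  have "((\<lambda>x. x powr a) has_integral c powr (a + 1) / (a + 1)) {0..c}"
    using assms by (intro has_integral_powr_from_0) auto
  then have "((\<lambda>x. x powr a) has_integral c powr (a + 1) / (a + 1)) {0<..c}"
    by (subst (asm) has_integral_spike_set_eq[where T = "{0<..c}"])
      (auto intro!: negligible_subset[OF negligible_sing[of 0]])
  from nn_integral_has_integral_lebesgue[OF _ this]
  show "(\<integral>\<^sup>+x. ennreal (indicator {0<..c} x * x powr a) \<partial>lborel) = ennreal (c powr (a + 1) / (a + 1))"
    by simp
qed (use assms in auto)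

lemma has_bochner_integral_powr_to_inf:
  fixes a c :: real
  assumes "a < -1" "c > 0"
  shows "has_bochner_integral lborel (\<lambda>x. indicator {c<..} x * x powr a) (- (c powr (a + 1)) / (a + 1))"
proof (rule has_bochner_integral_nn_integral)
  have "((\<lambda>x. x powr a) has_integral - (c powr (a + 1)) / (a + 1)) {c..}"
    using assms by (intro has_integral_powr_to_inf) auto
  then have "((\<lambda>x. x powr a) has_integral - (c powr (a + 1)) / (a + 1)) {c<..}"
    by (subst (asm) has_integral_spike_set_eq[where T = "{c<..}"])
      (auto intro!: negligible_subset[OF negligible_sing[of c]])
  from nn_integral_has_integral_lebesgue[OF _ this]
  show "(\<integral>\<^sup>+x. ennreal (indicator {c<..} x * x powr a) \<partial>lborel) = ennreal (- (c powr (a + 1)) / (a + 1))"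
    by simp
qed (use assms in \<open>auto simp: divide_nonneg_neg divide_nonpos_neg\<close>)

text \<open>The integrand is compared with the model that is \<open>- \<tau> *\<^sub>R a\<close> up
  to \<open>\<delta>\<close> and \<open>- b\<close> beyond, whose weighted integrals are explicit.
  Keeping both \<open>a\<close> and \<open>b\<close> free lets one estimate serve both limits:
  \<open>b = 0\<close> for \<open>\<sigma> \<rightarrow> 1\<close> and \<open>a = 0\<close> for
  \<open>\<sigma> \<rightarrow> 0\<close>.\<close>

lemma frac_integral_estimate:
  fixes g :: "real \<Rightarrow> complex"
  assumes meas: "(\<lambda>\<tau>. indicator {0<..} \<tau> *\<^sub>R g \<tau>) \<in> borel_measurable borel"
    and \<sigma>: "0 < \<sigma>" "\<sigma> < 1" and \<delta>: "\<delta> > 0"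
    and near: "\<And>\<tau>. 0 < \<tau> \<Longrightarrow> \<tau> \<le> \<delta> \<Longrightarrow> norm (g \<tau> + \<tau> *\<^sub>R a) \<le> e1 * \<tau>"
    and far: "\<And>\<tau>. \<delta> < \<tau> \<Longrightarrow> norm (g \<tau> + b) \<le> e2"
  shows "norm ((LINT \<tau>:{0<..}|lborel. (1 / \<tau> powr (1 + \<sigma>)) *\<^sub>R g \<tau>)
       + (\<delta> powr (1 - \<sigma>) / (1 - \<sigma>)) *\<^sub>R a + (\<delta> powr (- \<sigma>) / \<sigma>) *\<^sub>R b)
     \<le> e1 * (\<delta> powr (1 - \<sigma>) / (1 - \<sigma>)) + e2 * (\<delta> powr (- \<sigma>) / \<sigma>)"
proof -
  define p q where "p = (\<lambda>x::real. indicator {0<..\<delta>} x * x powr (- \<sigma>))"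
    and "q = (\<lambda>x::real. indicator {\<delta><..} x * x powr (-1 - \<sigma>))"
  have p: "has_bochner_integral lborel p (\<delta> powr (1 - \<sigma>) / (1 - \<sigma>))"
    using has_bochner_integral_powr_from_0[of "- \<sigma>" \<delta>] \<sigma> \<delta> by (simp add: p_def)
  have q: "has_bochner_integral lborel q (\<delta> powr (- \<sigma>) / \<sigma>)"
    using has_bochner_integral_powr_to_inf[of "- 1 - \<sigma>" \<delta>] \<sigma> \<delta> by (simp add: q_def)
  \<comment> \<open>The remainder \<open>h\<close> between the weighted integrand \<open>G\<close>
    and its model is dominated by an integrable function. Hence \<open>G\<close> is integrable too,
    and its integral may be split.\<close>
  define G where "G = (\<lambda>x. (indicator {0<..} x * (1 / x powr (1 + \<sigma>))) *\<^sub>R g x)"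
  define h where "h = (\<lambda>x. G x + p x *\<^sub>R a + q x *\<^sub>R b)"
  have [measurable]: "p \<in> borel_measurable lborel" "q \<in> borel_measurable lborel"
    unfolding p_def q_def by measurable
  have Gm[measurable]: "G \<in> borel_measurable lborel"
  proof -
    have "(\<lambda>x. (1 / x powr (1 + \<sigma>)) *\<^sub>R (indicator {0<..} x *\<^sub>R g x)) \<in> borel_measurable lborel"
      using meas by measurable
    also have "(\<lambda>x. (1 / x powr (1 + \<sigma>)) *\<^sub>R (indicator {0<..} x *\<^sub>R g x)) = G"
      by (auto simp: G_def fun_eq_iff)
    finally show ?thesis .
  qed
  have hb: "norm (h x) \<le> e1 * p x + e2 * q x" for x
  proof -
    consider "x \<le> 0" | "0 < x" "x \<le> \<delta>" | "\<delta> < x" by linarith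
    then show ?thesis
    proof cases
      case 1 with \<delta> show ?thesis by (simp add: h_def G_def p_def q_def)
    next
      case 2
      have "1 / x powr (1 + \<sigma>) = x powr (-1 - \<sigma>)" "x powr (-\<sigma>) = x powr (-1 - \<sigma>) * x"
        using 2 by (auto simp: powr_minus_divide powr_diff powr_add field_simps)
      with 2 have "h x = (x powr (-1 - \<sigma>)) *\<^sub>R (g x + x *\<^sub>R a)"
        and "e1 * p x + e2 * q x = (x powr (-1 - \<sigma>)) * (e1 * x)"
        by (auto simp: h_def G_def p_def q_def algebra_simps)
      then show ?thesis using near[OF 2] by (simp add: mult_left_mono)
    next
      case 3
      have "1 / x powr (1 + \<sigma>) = x powr (-1 - \<sigma>)"
        using 3 \<delta> by (auto simp: powr_minus_divide powr_diff powr_add field_simps)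
      with 3 \<delta> have "h x = (x powr (-1 - \<sigma>)) *\<^sub>R (g x + b)"
        and "e1 * p x + e2 * q x = (x powr (-1 - \<sigma>)) * e2"
        by (auto simp: h_def G_def p_def q_def algebra_simps)
      then show ?thesis using far[OF 3] by (simp add: mult_left_mono)
    qed
  qed
  have pi: "integrable lborel p" "integral\<^sup>L lborel p = \<delta> powr (1 - \<sigma>) / (1 - \<sigma>)"
    and qi: "integrable lborel q" "integral\<^sup>L lborel q = \<delta> powr (- \<sigma>) / \<sigma>"
    using p q by (auto simp: has_bochner_integral_iff)
  have bi: "integrable lborel (\<lambda>x. e1 * p x + e2 * q x)"
    using pi qi by (intro Bochner_Integration.integrable_add integrable_mult_right)
  have hi: "integrable lborel h"
  proof (rule Bochner_Integration.integrable_bound[OF bi])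
    show "h \<in> borel_measurable lborel" unfolding h_def by measurable
    show "AE x in lborel. norm (h x) \<le> norm (e1 * p x + e2 * q x)"
      by (intro always_eventually allI order_trans[OF hb]) simp
  qed
  have "G = (\<lambda>x. h x - p x *\<^sub>R a - q x *\<^sub>R b)" by (auto simp: h_def)
  then have "integral\<^sup>L lborel G = integral\<^sup>L lborel h - (\<integral>x. p x *\<^sub>R a \<partial>lborel) - (\<integral>x. q x *\<^sub>R b \<partial>lborel)"
    using hi pi qi by simp
  also have "\<dots> = integral\<^sup>L lborel h - (\<delta> powr (1 - \<sigma>) / (1 - \<sigma>)) *\<^sub>R a - (\<delta> powr (- \<sigma>) / \<sigma>) *\<^sub>R b"
    using pi qi by simp
  finally have "integral\<^sup>L lborel G + (\<delta> powr (1 - \<sigma>) / (1 - \<sigma>)) *\<^sub>R a + (\<delta> powr (- \<sigma>) / \<sigma>) *\<^sub>R b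
      = integral\<^sup>L lborel h" by simp
  moreover have "norm (integral\<^sup>L lborel h) \<le> (\<integral>x. e1 * p x + e2 * q x \<partial>lborel)"
    by (rule Bochner_Integration.integral_norm_bound_integral[OF hi bi hb])
  moreover have "(LINT \<tau>:{0<..}|lborel. (1 / \<tau> powr (1 + \<sigma>)) *\<^sub>R g \<tau>) = integral\<^sup>L lborel G"
    by (simp add: set_lebesgue_integral_def G_def)
  ultimately show ?thesis using pi qi by simp
qed

text \<open>Using the recurrence twice replaces \<open>- \<sigma>\<close> by
  \<open>2 - \<sigma>\<close>, an argument at which \<open>Gamma\<close> is positive and continuous
  even for \<open>\<sigma> = 0\<close> and \<open>\<sigma> = 1\<close>; the zeros at these ends
  become an explicit factor.\<close>

lemma inverse_Gamma_minus:
  fixes \<sigma> :: real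
  assumes "0 < \<sigma>" "\<sigma> < 1"
  shows "1 / Gamma (- \<sigma>) = - (\<sigma> * (1 - \<sigma>)) / Gamma (2 - \<sigma>)"
proof -
  have n: "- \<sigma> \<notin> \<int>\<^sub>\<le>\<^sub>0" "1 - \<sigma> \<notin> \<int>\<^sub>\<le>\<^sub>0"
  proof -
    have "- \<sigma> \<noteq> - real k" for k :: nat using assms by (cases k) auto
    then show "- \<sigma> \<notin> \<int>\<^sub>\<le>\<^sub>0" by (auto elim!: nonpos_Ints_cases')
    show "1 - \<sigma> \<notin> \<int>\<^sub>\<le>\<^sub>0" using assms by (auto dest: nonpos_Ints_nonpos)
  qed
  have "Gamma (1 - \<sigma>) = - \<sigma> * Gamma (- \<sigma>)"
    using Gamma_plus1[OF n(1)] by (simp add: add.commute)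
  moreover have "Gamma (2 - \<sigma>) = (1 - \<sigma>) * Gamma (1 - \<sigma>)"
    using Gamma_plus1[OF n(2)] by simp
  moreover have "Gamma (1 - \<sigma>) > 0" using assms by (intro Gamma_real_pos) auto
  ultimately have "Gamma (2 - \<sigma>) = - (\<sigma> * (1 - \<sigma>)) * Gamma (- \<sigma>)" "Gamma (- \<sigma>) \<noteq> 0" by auto
  then show ?thesis using assms by simp
qed

text \<open>The cutoff, and with it the mass \<open>u\<close>, depends on the tolerance. Here
  \<open>u\<close> and \<open>w\<close> may be chosen after \<open>e\<close>, as long as for each
  choice the mass tends to 1 and the error to \<open>e\<close>.\<close>

lemma tendsto_via_error_bound:
  fixes F :: "'b \<Rightarrow> 'c::real_normed_vector"
  assumes "\<And>e. e > 0 \<Longrightarrow> \<exists>u w. (u \<longlongrightarrow> 1) N \<and> (w \<longlongrightarrow> e) N \<and> eventually (\<lambda>x. norm (F x - u x *\<^sub>R A) \<le> w x) N"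
  shows "(F \<longlongrightarrow> A) N"
proof (rule tendstoI)
  fix e :: real assume "e > 0"
  then obtain u w where uw: "(u \<longlongrightarrow> 1) N" "(w \<longlongrightarrow> e / 2) N"
    "eventually (\<lambda>x. norm (F x - u x *\<^sub>R A) \<le> w x) N"
    using assms[of "e / 2"] by auto
  have "((\<lambda>x. w x + norm (u x *\<^sub>R A - A)) \<longlongrightarrow> e / 2 + norm (1 *\<^sub>R A - A)) N"
    by (intro tendsto_intros uw)
  then have "eventually (\<lambda>x. w x + norm (u x *\<^sub>R A - A) < e) N"
    by (rule order_tendstoD(2)) (use \<open>e > 0\<close> in auto)
  with uw(3) show "eventually (\<lambda>x. dist (F x) A < e) N"
  proof eventually_elim
    case (elim x)
    with norm_triangle_ineq[of "F x - u x *\<^sub>R A" "u x *\<^sub>R A - A"] show ?case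
      by (simp add: dist_norm)
  qed
qed

text \<open>The Gamma factor cancels \<open>1 - \<sigma>\<close> in the mass below the cutoff and
  \<open>\<sigma>\<close> in the mass above it, so exactly one of them survives in each
  limit.\<close>

lemma frac_integral_bound:
  fixes g :: "real \<Rightarrow> complex"
  assumes meas: "(\<lambda>\<tau>. indicator {0<..} \<tau> *\<^sub>R g \<tau>) \<in> borel_measurable borel"
    and \<sigma>: "0 < \<sigma>" "\<sigma> < 1" and \<delta>: "\<delta> > 0"
    and near: "\<And>\<tau>. 0 < \<tau> \<Longrightarrow> \<tau> \<le> \<delta> \<Longrightarrow> norm (g \<tau> + \<tau> *\<^sub>R a) \<le> e1 * \<tau>"
    and far: "\<And>\<tau>. \<delta> < \<tau> \<Longrightarrow> norm (g \<tau> + b) \<le> e2"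
  shows "norm ((1 / Gamma (- \<sigma>)) *\<^sub>R (LINT \<tau>:{0<..}|lborel. (1 / \<tau> powr (1 + \<sigma>)) *\<^sub>R g \<tau>)
       - ((\<sigma> * \<delta> powr (1 - \<sigma>)) / Gamma (2 - \<sigma>)) *\<^sub>R a - (((1 - \<sigma>) * \<delta> powr (- \<sigma>)) / Gamma (2 - \<sigma>)) *\<^sub>R b)
     \<le> e1 * ((\<sigma> * \<delta> powr (1 - \<sigma>)) / Gamma (2 - \<sigma>)) + e2 * (((1 - \<sigma>) * \<delta> powr (- \<sigma>)) / Gamma (2 - \<sigma>))"
proof -
  define c where "c = \<sigma> * (1 - \<sigma>) / Gamma (2 - \<sigma>)"
  have "Gamma (2 - \<sigma>) > 0" using \<sigma> by (intro Gamma_real_pos) auto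
  then have c: "c \<ge> 0" and c1: "c * (\<delta> powr (1 - \<sigma>) / (1 - \<sigma>)) = (\<sigma> * \<delta> powr (1 - \<sigma>)) / Gamma (2 - \<sigma>)"
    and c2: "c * (\<delta> powr (- \<sigma>) / \<sigma>) = ((1 - \<sigma>) * \<delta> powr (- \<sigma>)) / Gamma (2 - \<sigma>)"
    using \<sigma> by (auto simp: c_def)
  let ?I = "LINT \<tau>:{0<..}|lborel. (1 / \<tau> powr (1 + \<sigma>)) *\<^sub>R g \<tau>"
  have lin: "(- c) *\<^sub>R (I + x *\<^sub>R a + y *\<^sub>R b) = (- c) *\<^sub>R I - (c * x) *\<^sub>R a - (c * y) *\<^sub>R b"
    "c * (e1 * x + e2 * y) = e1 * (c * x) + e2 * (c * y)" for x y and I :: complex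
    by (simp_all add: algebra_simps)
  have "norm ((- c) *\<^sub>R (?I + (\<delta> powr (1 - \<sigma>) / (1 - \<sigma>)) *\<^sub>R a + (\<delta> powr (- \<sigma>) / \<sigma>) *\<^sub>R b))
      \<le> c * (e1 * (\<delta> powr (1 - \<sigma>) / (1 - \<sigma>)) + e2 * (\<delta> powr (- \<sigma>) / \<sigma>))"
    using mult_left_mono[OF frac_integral_estimate[OF assms] c] c by simp
  moreover have "1 / Gamma (- \<sigma>) = - c" using inverse_Gamma_minus[OF \<sigma>] by (simp add: c_def)
  ultimately show ?thesis unfolding lin c1 c2 by (simp only:)
qed

text \<open>For \<open>\<sigma> \<rightarrow> 1\<close> the cutoff lies where the expansion at 0 is
  accurate, and the rest is merely bounded. For \<open>\<sigma> \<rightarrow> 0\<close> it lies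
  where \<open>S \<tau> f p\<close> is already small, and the part below is merely bounded by a
  multiple of \<open>\<tau>\<close>.\<close>

lemma frac_power_limits:
  fixes S :: "real \<Rightarrow> ('p \<Rightarrow> complex) \<Rightarrow> 'p \<Rightarrow> complex"
  assumes meas: "(\<lambda>\<tau>. indicator {0<..} \<tau> *\<^sub>R S \<tau> f p) \<in> borel_measurable borel"
    and bdd: "\<And>\<tau>. \<tau> > 0 \<Longrightarrow> norm (S \<tau> f p) \<le> K"
    and lim0: "((\<lambda>\<tau>. (1 / \<tau>) *\<^sub>R (S \<tau> f p - f p)) \<longlongrightarrow> - A) (at_right 0)"
    and liminf: "((\<lambda>\<tau>. S \<tau> f p) \<longlongrightarrow> 0) at_top"
  shows "((\<lambda>\<sigma>. frac_power S \<sigma> f p) \<longlongrightarrow> A) (at_left 1)" (is ?A)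
    and "((\<lambda>\<sigma>. frac_power S \<sigma> f p) \<longlongrightarrow> f p) (at_right 0)" (is ?B)
proof -
  define g where "g \<tau> = S \<tau> f p - f p" for \<tau>
  define K' where "K' = K + norm (f p)"
  have fp: "frac_power S \<sigma> f p = (1 / Gamma (- \<sigma>)) *\<^sub>R (LINT \<tau>:{0<..}|lborel. (1 / \<tau> powr (1 + \<sigma>)) *\<^sub>R g \<tau>)" for \<sigma>
    by (simp add: frac_power_def g_def)
  have gm: "(\<lambda>\<tau>. indicator {0<..} \<tau> *\<^sub>R g \<tau>) \<in> borel_measurable borel"
  proof -
    have "(\<lambda>\<tau>. indicator {0<..} \<tau> *\<^sub>R S \<tau> f p - indicator {0<..} \<tau> *\<^sub>R f p) \<in> borel_measurable borel"
      by (intro borel_measurable_diff meas) measurable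
    then show ?thesis by (simp add: g_def scaleR_diff_right)
  qed
  have gK: "norm (g \<tau>) \<le> K'" if "\<tau> > 0" for \<tau>
    using bdd[OF that] norm_triangle_ineq4[of "S \<tau> f p" "f p"] by (simp add: g_def K'_def)
  have near: "\<exists>\<delta>>0. \<forall>\<tau>. 0 < \<tau> \<longrightarrow> \<tau> \<le> \<delta> \<longrightarrow> norm (g \<tau> + \<tau> *\<^sub>R A) \<le> e * \<tau>" if "e > 0" for e
  proof -
    from tendstoD[OF lim0 that] obtain d where d: "d > 0"
      "\<And>\<tau>. 0 < \<tau> \<Longrightarrow> \<tau> < d \<Longrightarrow> norm ((1 / \<tau>) *\<^sub>R g \<tau> + A) < e"
      by (auto simp: eventually_at_right_field g_def dist_norm)
    have "norm (g \<tau> + \<tau> *\<^sub>R A) \<le> e * \<tau>" if "0 < \<tau>" "\<tau> \<le> d / 2" for \<tau>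
    proof -
      have "norm ((1 / \<tau>) *\<^sub>R g \<tau> + A) \<le> e" using d(2)[of \<tau>] d(1) that by linarith
      moreover have "g \<tau> + \<tau> *\<^sub>R A = \<tau> *\<^sub>R ((1 / \<tau>) *\<^sub>R g \<tau> + A)" using that by (simp add: scaleR_add_right)
      ultimately show ?thesis using that by (simp add: mult.commute mult_right_mono)
    qed
    with d(1) show ?thesis by (intro exI[of _ "d / 2"]) auto
  qed
  have G2: "Gamma (2::real) = 1" using Gamma_fact[of 1, where 'a=real] by simp
  have npi: "(1::real) \<notin> \<int>\<^sub>\<le>\<^sub>0" "(2::real) \<notin> \<int>\<^sub>\<le>\<^sub>0" by (auto dest: nonpos_Ints_nonpos)
  show ?A
  proof (rule tendsto_via_error_bound)
    fix e :: real assume e: "e > 0"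
    from near[OF e] obtain \<delta> where \<delta>: "\<delta> > 0"
      and nr: "\<And>\<tau>. 0 < \<tau> \<Longrightarrow> \<tau> \<le> \<delta> \<Longrightarrow> norm (g \<tau> + \<tau> *\<^sub>R A) \<le> e * \<tau>" by blast
    define u where "u = (\<lambda>\<sigma>. (\<sigma> * \<delta> powr (1 - \<sigma>)) / Gamma (2 - \<sigma>))"
    define w where "w = (\<lambda>\<sigma>. e * u \<sigma> + K' * (((1 - \<sigma>) * \<delta> powr (- \<sigma>)) / Gamma (2 - \<sigma>)))"
    have u: "(u \<longlongrightarrow> (1 * \<delta> powr (1 - 1)) / Gamma (2 - 1)) (at_left 1)"
      unfolding u_def using \<delta> npi by (intro tendsto_intros) auto
    then have u1: "(u \<longlongrightarrow> 1) (at_left 1)" using \<delta> by simp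
    have "(w \<longlongrightarrow> e * 1 + K' * (((1 - 1) * \<delta> powr (- 1)) / Gamma (2 - 1))) (at_left 1)"
      unfolding w_def using \<delta> npi by (intro tendsto_intros u1) auto
    then have w: "(w \<longlongrightarrow> e) (at_left 1)" by simp
    have "eventually (\<lambda>\<sigma>. \<sigma> \<in> {0<..<1::real}) (at_left 1)" by (rule eventually_at_left_real) simp
    then have "eventually (\<lambda>\<sigma>. norm (frac_power S \<sigma> f p - u \<sigma> *\<^sub>R A) \<le> w \<sigma>) (at_left 1)"
    proof eventually_elim
      case (elim \<sigma>)
      have "norm (g \<tau> + 0) \<le> K'" if "\<delta> < \<tau>" for \<tau> using gK[of \<tau>] that \<delta> by simp
      from frac_integral_bound[OF gm _ _ \<delta> nr this, of \<sigma>] elim show ?case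
        by (simp add: fp u_def w_def)
    qed
    with u1 w show "\<exists>u w. (u \<longlongrightarrow> 1) (at_left 1) \<and> (w \<longlongrightarrow> e) (at_left 1) \<and>
       eventually (\<lambda>\<sigma>. norm (frac_power S \<sigma> f p - u \<sigma> *\<^sub>R A) \<le> w \<sigma>) (at_left 1)" by blast
  qed
  \<comment> \<open>The cutoff for the second limit is large, so a linear bound is needed for all
    times: beyond the small \<open>\<delta>\<close> the constant \<open>K'\<close> is at most
    \<open>K' / \<delta> * \<tau>\<close>.\<close>
  obtain L where L: "\<And>\<tau>. 0 < \<tau> \<Longrightarrow> norm (g \<tau>) \<le> L * \<tau>"
  proof -
    from near[of 1] obtain \<delta> where \<delta>: "\<delta> > 0"
      and nr: "\<And>\<tau>. 0 < \<tau> \<Longrightarrow> \<tau> \<le> \<delta> \<Longrightarrow> norm (g \<tau> + \<tau> *\<^sub>R A) \<le> 1 * \<tau>" by auto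
    have K'0: "K' \<ge> 0" using gK[of 1] norm_ge_zero[of "g 1"] by linarith
    have "norm (g \<tau>) \<le> (1 + norm A + K' / \<delta>) * \<tau>" if t: "0 < \<tau>" for \<tau>
    proof (cases "\<tau> \<le> \<delta>")
      case True
      have "norm (g \<tau>) \<le> norm (g \<tau> + \<tau> *\<^sub>R A) + norm (\<tau> *\<^sub>R A)"
        using norm_triangle_ineq4[of "g \<tau> + \<tau> *\<^sub>R A" "\<tau> *\<^sub>R A"] by simp
      also have "\<dots> \<le> 1 * \<tau> + \<tau> * norm A" using nr[OF t True] t by simp
      also have "\<dots> \<le> (1 + norm A + K' / \<delta>) * \<tau>" using t \<delta> K'0 by (simp add: algebra_simps)
      finally show ?thesis .
    next
      case False
      have "K' = K' / \<delta> * \<delta>" using \<delta> by simp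
      also have "\<dots> \<le> K' / \<delta> * \<tau>" using False K'0 \<delta> by (intro mult_left_mono) auto
      also have "\<dots> \<le> (1 + norm A + K' / \<delta>) * \<tau>" using t by (intro mult_right_mono) auto
      finally show ?thesis using gK[OF t] by linarith
    qed
    then show ?thesis by (rule that)
  qed
  show ?B
  proof (rule tendsto_via_error_bound)
    fix e :: real assume e: "e > 0"
    from tendstoD[OF liminf e] obtain N where N: "\<And>\<tau>. \<tau> \<ge> N \<Longrightarrow> norm (S \<tau> f p) < e"
      by (auto simp: eventually_at_top_linorder)
    define \<delta> where "\<delta> = max N 1"
    have \<delta>: "\<delta> > 0" by (simp add: \<delta>_def)
    have fr: "norm (g \<tau> + f p) \<le> e" if "\<delta> < \<tau>" for \<tau>
      using N[of \<tau>] that by (auto simp: g_def \<delta>_def)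
    define u where "u = (\<lambda>\<sigma>. ((1 - \<sigma>) * \<delta> powr (- \<sigma>)) / Gamma (2 - \<sigma>))"
    define w where "w = (\<lambda>\<sigma>. L * ((\<sigma> * \<delta> powr (1 - \<sigma>)) / Gamma (2 - \<sigma>)) + e * u \<sigma>)"
    have u: "(u \<longlongrightarrow> ((1 - 0) * \<delta> powr (- 0)) / Gamma (2 - 0)) (at_right 0)"
      unfolding u_def using \<delta> npi by (intro tendsto_intros) (auto simp: G2)
    then have u1: "(u \<longlongrightarrow> 1) (at_right 0)" using \<delta> by (simp add: G2)
    have "(w \<longlongrightarrow> L * ((0 * \<delta> powr (1 - 0)) / Gamma (2 - 0)) + e * 1) (at_right 0)"
      unfolding w_def using \<delta> npi by (intro tendsto_intros u1) (auto simp: G2)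
    then have w: "(w \<longlongrightarrow> e) (at_right 0)" by simp
    have "eventually (\<lambda>\<sigma>. \<sigma> \<in> {0<..<1::real}) (at_right 0)" by (rule eventually_at_right_real) simp
    then have "eventually (\<lambda>\<sigma>. norm (frac_power S \<sigma> f p - u \<sigma> *\<^sub>R f p) \<le> w \<sigma>) (at_right 0)"
    proof eventually_elim
      case (elim \<sigma>)
      have "norm (g \<tau> + \<tau> *\<^sub>R 0) \<le> L * \<tau>" if "0 < \<tau>" for \<tau> using L[OF that] by simp
      from frac_integral_bound[OF gm _ _ \<delta> this fr, of \<sigma>] elim show ?case
        by (simp add: fp u_def w_def)
    qed
    with u1 w show "\<exists>u w. (u \<longlongrightarrow> 1) (at_right 0) \<and> (w \<longlongrightarrow> e) (at_right 0) \<and>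
       eventually (\<lambda>\<sigma>. norm (frac_power S \<sigma> f p - u \<sigma> *\<^sub>R f p) \<le> w \<sigma>) (at_right 0)" by blast
  qed
qed

section \<open>Partial derivatives and Taylor estimates\<close>

lemma iterated_partial_simps [simp]:
  "iterated_partial [] f = f"
  "iterated_partial (b # bs) f = partial_deriv b (iterated_partial bs f)"
  by (simp_all add: iterated_partial_def)

text \<open>The head of the list is the outermost derivative, so differentiating \<open>f\<close>
  beforehand appends at the end.\<close>

lemma iterated_partial_snoc:
  "iterated_partial bs (partial_deriv b f) = iterated_partial (bs @ [b]) f"
  by (simp add: iterated_partial_def)

lemma smooth_partial_deriv: "smooth f \<Longrightarrow> b \<in> Basis \<Longrightarrow> smooth (partial_deriv b f)"
  by (auto simp: smooth_def iterated_partial_snoc)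

lemma smooth_differentiable: "smooth f \<Longrightarrow> f differentiable (at x)"
  unfolding smooth_def
  by (drule bspec[of _ _ "[]"]) (auto simp: differentiable_on_def)

lemma smooth_continuous_on: "smooth f \<Longrightarrow> continuous_on A f"
  by (meson continuous_at_imp_continuous_on differentiable_imp_continuous_within smooth_differentiable)

text \<open>By induction on the list, every iterated partial derivative stays in \<open>F\<close>.
  Smoothness is thus proved by exhibiting a class of differentiable functions closed under partial
  derivatives.\<close>

lemma smooth_coinduct:
  assumes "f \<in> F" and "\<And>g x. g \<in> F \<Longrightarrow> g differentiable (at x)"
    and "\<And>g b. g \<in> F \<Longrightarrow> b \<in> Basis \<Longrightarrow> partial_deriv b g \<in> F"
  shows "smooth f"
proof -
  have "iterated_partial bs f \<in> F" if "bs \<in> lists Basis" for bs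
    using that by (induction bs) (use assms in auto)
  then show ?thesis using assms(2) by (auto simp: smooth_def differentiable_on_def)
qed

lemma schwartz_smooth: "f \<in> schwartz \<Longrightarrow> smooth f"
  by (simp add: schwartz_def)

lemma schwartz_partial_deriv: "f \<in> schwartz \<Longrightarrow> b \<in> Basis \<Longrightarrow> partial_deriv b f \<in> schwartz"
  by (auto simp: schwartz_def smooth_partial_deriv iterated_partial_snoc)

lemma schwartz_decay:
  assumes "f \<in> schwartz"
  obtains K where "K > 0" "\<And>p. norm p ^ k * norm (f p) \<le> K"
proof -
  have "bounded (range (\<lambda>p. norm p ^ k *\<^sub>R iterated_partial [] f p))"
    using assms unfolding schwartz_def by blast
  then show ?thesis using that by (auto simp: bounded_pos)
qed

lemma schwartz_bounded:
  assumes "f \<in> schwartz"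
  obtains K where "K > 0" "\<And>p. norm (f p) \<le> K"
  using schwartz_decay[OF assms, of 0] by auto

lemma partial_derivI:
  assumes "(f has_derivative D) (at x)"
  shows "partial_deriv b f x = D b"
proof -
  interpret D: bounded_linear D using assms by (rule has_derivative_bounded_linear)
  have "((\<lambda>s::real. x + s *\<^sub>R b) has_derivative (\<lambda>s. s *\<^sub>R b)) (at 0)"
    by (auto intro!: derivative_eq_intros)
  moreover have "(f has_derivative D) (at (x + 0 *\<^sub>R b))" using assms by simp
  ultimately have "((\<lambda>s::real. f (x + s *\<^sub>R b)) has_derivative (\<lambda>s. D (s *\<^sub>R b))) (at 0)"
    by (rule has_derivative_compose)
  then have "((\<lambda>s::real. f (x + s *\<^sub>R b)) has_vector_derivative D b) (at 0)"
    by (simp add: has_vector_derivative_def D.scaleR)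
  then show ?thesis unfolding partial_deriv_def by (rule vector_derivative_at)
qed

lemma has_derivative_partial_deriv:
  assumes "f differentiable (at x)"
  shows "(f has_derivative (\<lambda>h. \<Sum>b\<in>Basis. (h \<bullet> b) *\<^sub>R partial_deriv b f x)) (at x)"
proof -
  from assms obtain D where D: "(f has_derivative D) (at x)" by (auto simp: differentiable_def)
  then interpret D: bounded_linear D by (rule has_derivative_bounded_linear)
  have pd: "partial_deriv b f x = D b" for b
    by (rule partial_derivI[OF D])
  have "D h = (\<Sum>b\<in>Basis. (h \<bullet> b) *\<^sub>R partial_deriv b f x)" for h
  proof -
    have "D h = D (\<Sum>b\<in>Basis. (h \<bullet> b) *\<^sub>R b)" by (simp add: euclidean_representation)
    then show ?thesis by (simp add: D.sum D.scaleR pd)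
  qed
  then have "D = (\<lambda>h. \<Sum>b\<in>Basis. (h \<bullet> b) *\<^sub>R partial_deriv b f x)" by auto
  with D show ?thesis by simp
qed

lemma line_has_vector_derivative:
  assumes "smooth f"
  shows "((\<lambda>s::real. f (p + s *\<^sub>R v)) has_vector_derivative
    (\<Sum>b\<in>Basis. (v \<bullet> b) *\<^sub>R partial_deriv b f (p + s *\<^sub>R v))) (at s within S)"
proof -
  have 1: "((\<lambda>s::real. p + s *\<^sub>R v) has_derivative (\<lambda>s. s *\<^sub>R v)) (at s within S)"
    by (auto intro!: derivative_eq_intros)
  from has_derivative_compose[OF 1 has_derivative_partial_deriv[OF smooth_differentiable[OF assms]]]
  show ?thesis by (simp add: has_vector_derivative_def scaleR_sum_right)
qed

lemma norm_increment_le: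
  fixes \<phi> :: "real \<Rightarrow> 'b::real_normed_vector"
  assumes "\<And>s. s \<in> {0..1} \<Longrightarrow> (\<phi> has_vector_derivative \<phi>' s) (at s within {0..1})"
    and "\<And>s. s \<in> {0..1} \<Longrightarrow> norm (\<phi>' s) \<le> B" and "s \<in> {0..1}"
  shows "norm (\<phi> s - \<phi> 0) \<le> B"
proof -
  have "norm (\<phi> s - \<phi> 0) \<le> B * norm (s - 0)"
  proof (rule differentiable_bound[of "{0..1}"])
    show "(\<phi> has_derivative (\<lambda>h. h *\<^sub>R \<phi>' x)) (at x within {0..1})" if "x \<in> {0..1}" for x
      using assms(1)[OF that] by (simp add: has_vector_derivative_def)
    show "onorm (\<lambda>h. h *\<^sub>R \<phi>' x) \<le> B" if "x \<in> {0..1}" for x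
      by (rule onorm_le) (use assms(2)[OF that] in \<open>simp add: mult.commute[of B] mult_left_mono\<close>)
  qed (use assms in auto)
  moreover have "B * norm (s - 0) \<le> B * 1"
    using order_trans[OF norm_ge_zero assms(2)[of 0]] assms(3) by (intro mult_left_mono) auto
  ultimately show ?thesis by simp
qed

text \<open>After subtraction of the linear term the derivative is an increment of
  \<open>\<phi>'\<close>, so the estimate of one order lower applies; the third-order version
  repeats this. The sharp factors are dropped, because later only the order in the direction vector
  counts.\<close>

lemma norm_taylor2_le:
  fixes \<phi> :: "real \<Rightarrow> 'b::real_normed_vector"
  assumes 1: "\<And>s. s \<in> {0..1} \<Longrightarrow> (\<phi> has_vector_derivative \<phi>' s) (at s within {0..1})"
    and 2: "\<And>s. s \<in> {0..1} \<Longrightarrow> (\<phi>' has_vector_derivative \<phi>'' s) (at s within {0..1})"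
    and B: "\<And>s. s \<in> {0..1} \<Longrightarrow> norm (\<phi>'' s) \<le> B" and s: "s \<in> {0..1}"
  shows "norm (\<phi> s - \<phi> 0 - s *\<^sub>R \<phi>' 0) \<le> B"
proof -
  have "((\<lambda>s. \<phi> s - s *\<^sub>R \<phi>' 0) has_vector_derivative (\<phi>' s - \<phi>' 0)) (at s within {0..1})" if "s \<in> {0..1}" for s
    using 1[OF that] by (auto intro!: derivative_eq_intros)
  from norm_increment_le[OF this norm_increment_le[OF 2 B] s] show ?thesis
    by (simp add: algebra_simps)
qed

lemma norm_taylor3_le:
  fixes \<phi> :: "real \<Rightarrow> 'b::real_normed_vector"
  assumes 1: "\<And>s. s \<in> {0..1} \<Longrightarrow> (\<phi> has_vector_derivative \<phi>' s) (at s within {0..1})"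
    and 2: "\<And>s. s \<in> {0..1} \<Longrightarrow> (\<phi>' has_vector_derivative \<phi>'' s) (at s within {0..1})"
    and 3: "\<And>s. s \<in> {0..1} \<Longrightarrow> (\<phi>'' has_vector_derivative \<phi>''' s) (at s within {0..1})"
    and B: "\<And>s. s \<in> {0..1} \<Longrightarrow> norm (\<phi>''' s) \<le> B" and s: "s \<in> {0..1}"
  shows "norm (\<phi> s - \<phi> 0 - s *\<^sub>R \<phi>' 0 - (s\<^sup>2 / 2) *\<^sub>R \<phi>'' 0) \<le> B"
proof -
  have "((\<lambda>s. \<phi> s - s *\<^sub>R \<phi>' 0 - (s\<^sup>2 / 2) *\<^sub>R \<phi>'' 0) has_vector_derivative (\<phi>' s - \<phi>' 0 - s *\<^sub>R \<phi>'' 0)) (at s within {0..1})"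
    if "s \<in> {0..1}" for s
    using 1[OF that] by (auto intro!: derivative_eq_intros)
  from norm_increment_le[OF this norm_taylor2_le[OF 2 3 B] s] show ?thesis
    by (simp add: algebra_simps)
qed

lemma sum_abs_inner_le: "(\<Sum>b\<in>Basis. \<bar>v \<bullet> b\<bar>) \<le> real DIM('a) * norm (v::'a::euclidean_space)"
  using sum_bounded_above[of Basis "\<lambda>b. \<bar>v \<bullet> b\<bar>" "norm v"] by (simp add: Basis_le_norm)

lemma norm_dir_sum_le:
  fixes v :: "'a::euclidean_space" and g :: "'a \<Rightarrow> 'b::real_normed_vector"
  assumes "\<And>b. b \<in> Basis \<Longrightarrow> norm (g b) \<le> B"
  shows "norm (\<Sum>b\<in>Basis. (v \<bullet> b) *\<^sub>R g b) \<le> real DIM('a) * norm v * B"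
proof -
  have B: "B \<ge> 0" using assms[OF SOME_Basis] norm_ge_zero order_trans by blast
  have "norm (\<Sum>b\<in>Basis. (v \<bullet> b) *\<^sub>R g b) \<le> (\<Sum>b\<in>Basis. \<bar>v \<bullet> b\<bar> * B)"
    by (rule sum_norm_le) (simp add: assms mult_left_mono)
  also have "\<dots> \<le> real DIM('a) * norm v * B"
    unfolding sum_distrib_right[symmetric] using B by (intro mult_right_mono sum_abs_inner_le)
  finally show ?thesis .
qed

lemma smooth_taylor2:
  fixes f :: "'a::euclidean_space \<Rightarrow> complex"
  assumes f: "smooth f"
    and B: "\<And>b b' x. b \<in> Basis \<Longrightarrow> b' \<in> Basis \<Longrightarrow> norm (partial_deriv b' (partial_deriv b f) x) \<le> B"
  shows "norm (f (p + v) - f p - (\<Sum>b\<in>Basis. (v \<bullet> b) *\<^sub>R partial_deriv b f p))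
    \<le> (real DIM('a) * norm v)\<^sup>2 * B"
proof -
  define \<phi>' where "\<phi>' = (\<lambda>s::real. \<Sum>b\<in>Basis. (v \<bullet> b) *\<^sub>R partial_deriv b f (p + s *\<^sub>R v))"
  define \<phi>'' where "\<phi>'' = (\<lambda>s::real. \<Sum>b\<in>Basis. (v \<bullet> b) *\<^sub>R
      (\<Sum>b'\<in>Basis. (v \<bullet> b') *\<^sub>R partial_deriv b' (partial_deriv b f) (p + s *\<^sub>R v)))"
  have 1: "((\<lambda>s. f (p + s *\<^sub>R v)) has_vector_derivative \<phi>' s) (at s within {0..1})" for s
    unfolding \<phi>'_def by (rule line_has_vector_derivative[OF f])
  have 2: "(\<phi>' has_vector_derivative \<phi>'' s) (at s within {0..1})" for s
    unfolding \<phi>'_def \<phi>''_def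
    by (auto intro!: derivative_eq_intros has_vector_derivative_scaleR line_has_vector_derivative smooth_partial_deriv f)
  have "norm (\<phi>'' s) \<le> real DIM('a) * norm v * (real DIM('a) * norm v * B)" for s
    unfolding \<phi>''_def by (intro norm_dir_sum_le B)
  from norm_taylor2_le[OF 1 2 this, of 1]
  show ?thesis by (simp add: \<phi>'_def power2_eq_square algebra_simps)
qed

lemma smooth_taylor3:
  fixes f :: "'a::euclidean_space \<Rightarrow> complex"
  assumes f: "smooth f"
    and B: "\<And>b b' b'' x. b \<in> Basis \<Longrightarrow> b' \<in> Basis \<Longrightarrow> b'' \<in> Basis \<Longrightarrow>
      norm (partial_deriv b'' (partial_deriv b' (partial_deriv b f)) x) \<le> B"
  shows "norm (f (p + v) - f p - (\<Sum>b\<in>Basis. (v \<bullet> b) *\<^sub>R partial_deriv b f p)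
      - (1 / 2) *\<^sub>R (\<Sum>b\<in>Basis. \<Sum>b'\<in>Basis. ((v \<bullet> b) * (v \<bullet> b')) *\<^sub>R partial_deriv b' (partial_deriv b f) p))
    \<le> (real DIM('a) * norm v) ^ 3 * B"
proof -
  define \<phi>' where "\<phi>' = (\<lambda>s::real. \<Sum>b\<in>Basis. (v \<bullet> b) *\<^sub>R partial_deriv b f (p + s *\<^sub>R v))"
  define \<phi>'' where "\<phi>'' = (\<lambda>s::real. \<Sum>b\<in>Basis. (v \<bullet> b) *\<^sub>R
      (\<Sum>b'\<in>Basis. (v \<bullet> b') *\<^sub>R partial_deriv b' (partial_deriv b f) (p + s *\<^sub>R v)))"
  define \<phi>''' where "\<phi>''' = (\<lambda>s::real. \<Sum>b\<in>Basis. (v \<bullet> b) *\<^sub>R (\<Sum>b'\<in>Basis. (v \<bullet> b') *\<^sub>R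
      (\<Sum>b''\<in>Basis. (v \<bullet> b'') *\<^sub>R partial_deriv b'' (partial_deriv b' (partial_deriv b f)) (p + s *\<^sub>R v))))"
  have 1: "((\<lambda>s. f (p + s *\<^sub>R v)) has_vector_derivative \<phi>' s) (at s within {0..1})" for s
    unfolding \<phi>'_def by (rule line_has_vector_derivative[OF f])
  have 2: "(\<phi>' has_vector_derivative \<phi>'' s) (at s within {0..1})" for s
    unfolding \<phi>'_def \<phi>''_def
    by (auto intro!: derivative_eq_intros has_vector_derivative_scaleR line_has_vector_derivative smooth_partial_deriv f)
  have 3: "(\<phi>'' has_vector_derivative \<phi>''' s) (at s within {0..1})" for s
    unfolding \<phi>''_def \<phi>'''_def
    by (auto intro!: derivative_eq_intros has_vector_derivative_scaleR line_has_vector_derivative smooth_partial_deriv f)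
  have "norm (\<phi>''' s) \<le> real DIM('a) * norm v * (real DIM('a) * norm v * (real DIM('a) * norm v * B))" for s
    unfolding \<phi>'''_def by (intro norm_dir_sum_le B)
  from norm_taylor3_le[OF 1 2 3 this, of 1]
  show ?thesis by (simp add: \<phi>'_def \<phi>''_def power3_eq_cube algebra_simps scaleR_sum_right)
qed

section \<open>Gaussian averages\<close>

text \<open>Lebesgue measure is the image of a product of one-dimensional measures under
  \<open>D\<close>, which assembles a vector from its coordinates; along \<open>D\<close> the
  integrand becomes a product of functions of single coordinates.\<close>

lemma
  fixes h :: "'a::euclidean_space \<Rightarrow> real \<Rightarrow> real"
  assumes h: "\<And>b. b \<in> Basis \<Longrightarrow> integrable lborel (h b)"
  shows integrable_lborel_prod: "integrable lborel (\<lambda>z::'a. \<Prod>b\<in>Basis. h b (z \<bullet> b))"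
    and integral_lborel_prod: "(\<integral>z. (\<Prod>b\<in>Basis. h b (z \<bullet> b)) \<partial>lborel) = (\<Prod>b\<in>Basis. integral\<^sup>L lborel (h b))"
proof -
  interpret product_sigma_finite "\<lambda>_::'a. lborel :: real measure" by standard
  define D where "D = (\<lambda>f::'a \<Rightarrow> real. \<Sum>b\<in>Basis. f b *\<^sub>R b)"
  have D: "D \<in> measurable (\<Pi>\<^sub>M b\<in>Basis. lborel) borel" unfolding D_def by measurable
  have [measurable]: "h b \<in> borel_measurable borel" if "b \<in> Basis" for b
    using h[OF that] by auto
  have m: "(\<lambda>z. \<Prod>b\<in>Basis. h b (z \<bullet> b)) \<in> borel_measurable borel"
    by (intro borel_measurable_prod) measurable
  have l: "(lborel :: 'a measure) = distr (\<Pi>\<^sub>M b\<in>Basis. lborel) borel D" unfolding D_def by (rule lborel_eq)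
  have e: "(\<lambda>f. \<Prod>b\<in>Basis. h b (D f \<bullet> b)) = (\<lambda>f. \<Prod>b\<in>Basis. h b (f b))"
    by (intro ext prod.cong) (auto simp: D_def inner_sum_left inner_Basis if_distrib cong: if_cong)
  show "integrable lborel (\<lambda>z::'a. \<Prod>b\<in>Basis. h b (z \<bullet> b))"
    unfolding l integrable_distr_eq[OF D m] e by (rule product_integrable_prod) (auto intro: h)
  show "(\<integral>z. (\<Prod>b\<in>Basis. h b (z \<bullet> b)) \<partial>lborel) = (\<Prod>b\<in>Basis. integral\<^sup>L lborel (h b))"
    unfolding l integral_distr[OF D m] e by (rule product_integral_prod) (auto intro: h)
qed

lemma prod_exp_norm_sq: "(\<Prod>b\<in>Basis. exp (a * ((z::'a::euclidean_space) \<bullet> b)\<^sup>2)) = exp (a * (norm z)\<^sup>2)"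
proof -
  have "(norm z)\<^sup>2 = (\<Sum>b\<in>Basis. (z \<bullet> b)\<^sup>2)"
    unfolding power2_norm_eq_inner by (subst euclidean_inner) (simp add: power2_eq_square)
  then show ?thesis by (simp add: exp_sum[symmetric] sum_distrib_left[symmetric])
qed

lemma integrable_exp_neg_norm_sq:
  assumes "a > 0"
  shows "integrable lborel (\<lambda>z::'a::euclidean_space. exp (- a * (norm z)\<^sup>2))"
proof -
  define s where "s = sqrt (1 / (2 * a))"
  have s: "s\<^sup>2 = 1 / (2 * a)" "s > 0" using assms by (auto simp: s_def)
  have "integrable lborel (\<lambda>x. sqrt (2 * pi * s\<^sup>2) * normal_density 0 s x)"
    by (intro integrable_mult_right) (use s in auto)
  also have "(\<lambda>x. sqrt (2 * pi * s\<^sup>2) * normal_density 0 s x) = (\<lambda>x. exp (- a * x\<^sup>2))"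
    using assms s by (auto simp: normal_density_def fun_eq_iff)
  finally have "integrable lborel (\<lambda>z::'a. \<Prod>b\<in>Basis. exp (- a * (z \<bullet> b)\<^sup>2))"
    by (intro integrable_lborel_prod)
  then show ?thesis unfolding prod_exp_norm_sq .
qed

text \<open>Combines \<open>r \<le> 1 + r^2\<close> with \<open>(1 + x / k) ^ k \<le> exp x\<close>
  for \<open>x = a * r^2\<close>.\<close>

lemma power_le_exp_square:
  fixes a :: real
  assumes "a > 0"
  obtains C where "C > 0" "\<And>r. r \<ge> 0 \<Longrightarrow> r ^ k \<le> C * exp (a * r\<^sup>2)"
proof (cases "k = 0")
  case True
  then show ?thesis using assms by (intro that[of 1]) auto
next
  case False
  \<comment> \<open>The factor \<open>c\<close> must dominate both coefficients of
    \<open>1 + r^2\<close> after \<open>r^2\<close> is rescaled by \<open>a / k\<close>.\<close>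
  define c where "c = max 1 (k / a)"
  have c: "c \<ge> 1" "c * (a / k) \<ge> 1" using False assms by (auto simp: c_def max_def field_simps)
  have "r ^ k \<le> c ^ k * exp (a * r\<^sup>2)" if r: "r \<ge> 0" for r
  proof -
    have "r \<le> 1 + r\<^sup>2" using r zero_le_power2[of "r - 1"] by (simp add: power2_eq_square algebra_simps)
    also have "\<dots> \<le> c + (c * (a / k)) * r\<^sup>2"
      using c mult_right_mono[OF c(2), of "r\<^sup>2"] by simp
    also have "\<dots> = c * (1 + (a * r\<^sup>2) / k)" by (simp add: algebra_simps)
    finally have "r ^ k \<le> (c * (1 + (a * r\<^sup>2) / k)) ^ k" using r by (rule power_mono)
    also have "\<dots> = c ^ k * (1 + (a * r\<^sup>2) / k) ^ k" by (simp add: power_mult_distrib)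
    also have "\<dots> \<le> c ^ k * exp (a * r\<^sup>2)"
      using c False assms by (intro mult_left_mono exp_ge_one_plus_x_over_n_power_n) (auto intro: order_trans[of _ 0])
    finally show ?thesis .
  qed
  then show ?thesis using that[of "c ^ k"] c by auto
qed

text \<open>The density of the normal law with identity covariance. The product form gives moments
  coordinate by coordinate, the closed form \<open>std_gauss_eq\<close> gives tail
  estimates.\<close>

definition std_gauss :: "'a::euclidean_space \<Rightarrow> real" where
  "std_gauss z = (\<Prod>b\<in>Basis. std_normal_density (z \<bullet> b))"

lemma std_gauss_eq: "std_gauss (z::'a::euclidean_space) = (1 / sqrt (2 * pi)) ^ DIM('a) * exp (- (1/2) * (norm z)\<^sup>2)"
  unfolding prod_exp_norm_sq[symmetric] by (simp add: std_gauss_def std_normal_density_def prod.distrib prod_dividef power_divide)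

lemma std_gauss_nonneg [simp]: "std_gauss z \<ge> 0"
  by (simp add: std_gauss_eq)

lemma borel_measurable_std_gauss [measurable]: "std_gauss \<in> borel_measurable borel"
  unfolding std_gauss_eq[abs_def] by measurable

lemma
  fixes k :: "'a::euclidean_space \<Rightarrow> nat"
  shows integrable_std_gauss_monomial:
      "integrable lborel (\<lambda>z::'a. std_gauss z * (\<Prod>b\<in>Basis. (z \<bullet> b) ^ k b))"
    and integral_std_gauss_monomial:
      "(\<integral>z. std_gauss z * (\<Prod>b\<in>Basis. (z \<bullet> b) ^ k b) \<partial>lborel)
        = (\<Prod>b\<in>Basis. \<integral>x. std_normal_density x * x ^ k b \<partial>lborel)"
  unfolding std_gauss_def prod.distrib[symmetric]
  by (rule integrable_lborel_prod[where h = "\<lambda>b x. std_normal_density x * x ^ k b"]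
      integral_lborel_prod[where h = "\<lambda>b x. std_normal_density x * x ^ k b"]; rule integrable_std_normal_moment)+

lemma integrable_std_gauss [simp]: "integrable lborel (std_gauss :: 'a::euclidean_space \<Rightarrow> real)"
  and integral_std_gauss [simp]: "(\<integral>z. std_gauss (z::'a) \<partial>lborel) = 1"
  using integrable_std_gauss_monomial[of "\<lambda>_::'a. 0"] integral_std_gauss_monomial[of "\<lambda>_::'a. 0"] by simp_all

lemma integral_std_normal_square: "(\<integral>x. std_normal_density x * x\<^sup>2 \<partial>lborel) = 1"
  using integral_std_normal_moment_even[of 1] by (simp add: fact_numeral)

lemma integral_std_normal_id: "(\<integral>x. std_normal_density x * x \<partial>lborel) = 0"
  using integral_std_normal_moment_odd[of 0] by simp

text \<open>The exponent vector is the unit vector at \<open>b\<close>; its coordinate contributes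
  the vanishing first moment.\<close>

lemma
  fixes b :: "'a::euclidean_space"
  assumes b: "b \<in> Basis"
  shows integrable_std_gauss_first: "integrable lborel (\<lambda>z. std_gauss z * (z \<bullet> b))"
    and integral_std_gauss_first: "(\<integral>z. std_gauss z * (z \<bullet> b) \<partial>lborel) = 0"
proof -
  have "(\<Prod>c\<in>Basis. (z \<bullet> c) ^ (if c = b then 1 else 0)) = z \<bullet> b" for z
    using b by (subst prod.remove[OF _ b]) auto
  moreover have "(\<Prod>c\<in>Basis. \<integral>x. std_normal_density x * x ^ (if c = b then 1 else 0) \<partial>lborel) = 0"
    using b integral_std_normal_id by (intro prod_zero) (auto intro!: bexI[of _ b])
  ultimately show "integrable lborel (\<lambda>z. std_gauss z * (z \<bullet> b))" "(\<integral>z. std_gauss z * (z \<bullet> b) \<partial>lborel) = 0"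
    using integrable_std_gauss_monomial[of "\<lambda>c. if c = b then 1 else 0"]
      integral_std_gauss_monomial[of "\<lambda>c. if c = b then 1 else 0"] by simp_all
qed

text \<open>The exponent vector is the sum of the unit vectors at \<open>b\<close> and
  \<open>b'\<close>: distinct indices leave a vanishing first moment, equal ones the variance. This
  identity covariance turns the Hessian into the Laplacian in
  \<open>gauss_mean_expansion\<close>.\<close>

lemma
  fixes b b' :: "'a::euclidean_space"
  assumes b: "b \<in> Basis" "b' \<in> Basis"
  shows integrable_std_gauss_second: "integrable lborel (\<lambda>z. std_gauss z * ((z \<bullet> b) * (z \<bullet> b')))"
    and integral_std_gauss_second: "(\<integral>z. std_gauss z * ((z \<bullet> b) * (z \<bullet> b')) \<partial>lborel) = (if b = b' then 1 else 0)"
proof -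
  define k where "k = (\<lambda>c. (if c = b then 1 else 0) + (if c = b' then 1 else 0 :: nat))"
  have p: "(\<Prod>c\<in>Basis. (z \<bullet> c) ^ (if c = e then 1 else 0)) = z \<bullet> e" if "e \<in> Basis" for e z :: 'a
    using that by (subst prod.remove[OF _ that]) auto
  then have 1: "(\<Prod>c\<in>Basis. (z \<bullet> c) ^ k c) = (z \<bullet> b) * (z \<bullet> b')" for z
    using b by (simp add: k_def power_add prod.distrib)
  have 2: "(\<Prod>c\<in>Basis. \<integral>x. std_normal_density x * x ^ k c \<partial>lborel) = (if b = b' then 1 else 0)"
  proof (cases "b = b'")
    case True
    then have "(\<integral>x. std_normal_density x * x ^ k c \<partial>lborel) = 1" for c
      using integral_std_normal_square by (auto simp: k_def power2_eq_square numeral_2_eq_2)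
    then show ?thesis using True by simp
  next
    case False
    then have "(\<integral>x. std_normal_density x * x ^ k b \<partial>lborel) = 0"
      using integral_std_normal_id by (auto simp: k_def)
    then show ?thesis using False b by (auto intro!: prod_zero bexI[of _ b])
  qed
  show "integrable lborel (\<lambda>z. std_gauss z * ((z \<bullet> b) * (z \<bullet> b')))"
    "(\<integral>z. std_gauss z * ((z \<bullet> b) * (z \<bullet> b')) \<partial>lborel) = (if b = b' then 1 else 0)"
    using integrable_std_gauss_monomial[of k] integral_std_gauss_monomial[of k] unfolding 1 2 .
qed

text \<open>Half of the Gaussian exponent suffices for convergence. The spare half absorbs powers of
  the norm in \<open>integrable_std_gauss_power\<close> and pays for decay in
  \<open>mehler_mean_indicator_bound\<close>.\<close>

lemma integrable_std_gauss_exp: "integrable lborel (\<lambda>z::'a::euclidean_space. std_gauss z * exp ((norm z)\<^sup>2 / 4))"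
proof -
  have "std_gauss z * exp ((norm z)\<^sup>2 / 4) = (1 / sqrt (2 * pi)) ^ DIM('a) * exp (- (1/4) * (norm z)\<^sup>2)" for z :: 'a
    by (simp add: std_gauss_eq exp_add[symmetric])
  then show ?thesis using integrable_exp_neg_norm_sq[of "1/4", where 'a='a] by simp
qed

lemma integrable_std_gauss_power: "integrable lborel (\<lambda>z::'a::euclidean_space. std_gauss z * norm z ^ k)"
proof -
  obtain C where C: "C > 0" "\<And>r::real. r \<ge> 0 \<Longrightarrow> r ^ k \<le> C * exp ((1/4) * r\<^sup>2)"
    by (rule power_le_exp_square[of "1/4"]) auto
  show ?thesis
  proof (rule Bochner_Integration.integrable_bound)
    show "integrable lborel (\<lambda>z::'a. C * (std_gauss z * exp ((norm z)\<^sup>2 / 4)))"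
      by (intro integrable_mult_right integrable_std_gauss_exp)
    show "AE z::'a in lborel. norm (std_gauss z * norm z ^ k) \<le> norm (C * (std_gauss z * exp ((norm z)\<^sup>2 / 4)))"
    proof (intro always_eventually allI)
      fix z :: 'a
      have "std_gauss z * norm z ^ k \<le> std_gauss z * (C * exp ((norm z)\<^sup>2 / 4))"
        using C(2)[of "norm z"] by (intro mult_left_mono) auto
      then show "norm (std_gauss z * norm z ^ k) \<le> norm (C * (std_gauss z * exp ((norm z)\<^sup>2 / 4)))"
        using C(1) by (simp add: algebra_simps)
    qed
  qed measurable
qed

section \<open>Expectations under a shifted and scaled normal law\<close>

lemma integral_lborel_affine:
  fixes g :: "'a::euclidean_space \<Rightarrow> 'b::{banach, second_countable_topology}"
  assumes "c \<noteq> 0" and [measurable]: "g \<in> borel_measurable borel"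
  shows "(\<integral>y. g y \<partial>lborel) = (\<integral>z. (\<bar>c\<bar> ^ DIM('a)) *\<^sub>R g (x + c *\<^sub>R z) \<partial>lborel)"
  by (subst lborel_affine[OF assms(1), of x]) (simp add: integral_density integral_distr)

text \<open>The expectation of \<open>F (p + r *\<^sub>R Z)\<close> for a standard normal
  \<open>Z\<close>. The scale \<open>r\<close> is a standard deviation:
  \<open>r = sqrt (2 * \<tau>)\<close> is the heat semigroup,
  \<open>r = sqrt (tanh (2 * \<tau>))\<close> occurs in Mehler's formula.\<close>

definition gauss_mean :: "('a::euclidean_space \<Rightarrow> complex) \<Rightarrow> real \<Rightarrow> 'a \<Rightarrow> complex" where
  "gauss_mean F r p = (LINT z|lborel. std_gauss z *\<^sub>R F (p + r *\<^sub>R z))"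

lemma integrable_std_gauss_bounded:
  fixes F :: "'a::euclidean_space \<Rightarrow> complex"
  assumes [measurable]: "F \<in> borel_measurable borel" and "\<And>x. norm (F x) \<le> K"
  shows "integrable lborel (\<lambda>z. std_gauss z *\<^sub>R F z)"
proof (rule Bochner_Integration.integrable_bound)
  show "integrable lborel (\<lambda>z::'a. K * std_gauss z)" by (intro integrable_mult_right) auto
  have "K \<ge> 0" using order_trans[OF norm_ge_zero assms(2)] .
  then show "AE z in lborel. norm (std_gauss z *\<^sub>R F z) \<le> norm (K * std_gauss z)"
    using assms(2) by (auto simp: abs_mult mult.commute[of K] intro!: mult_left_mono)
qed measurable

lemma integrable_gauss_mean:
  fixes F :: "'a::euclidean_space \<Rightarrow> complex"
  assumes F: "F \<in> borel_measurable borel" and "\<And>x. norm (F x) \<le> K"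
  shows "integrable lborel (\<lambda>z. std_gauss z *\<^sub>R F (p + r *\<^sub>R z))"
  by (rule integrable_std_gauss_bounded[where K = K]) (use assms in auto)

lemma norm_gauss_mean_le:
  fixes F :: "'a::euclidean_space \<Rightarrow> complex"
  assumes F: "F \<in> borel_measurable borel" and K: "\<And>x. norm (F x) \<le> K"
  shows "norm (gauss_mean F r p) \<le> K"
proof -
  have "norm (gauss_mean F r p) \<le> (\<integral>z. K * std_gauss (z::'a) \<partial>lborel)"
    unfolding gauss_mean_def
  proof (rule Bochner_Integration.integral_norm_bound_integral)
    show "integrable lborel (\<lambda>z. std_gauss z *\<^sub>R F (p + r *\<^sub>R z))"
      using assms by (rule integrable_gauss_mean)
    show "norm (std_gauss z *\<^sub>R F (p + r *\<^sub>R z)) \<le> K * std_gauss z" for z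
      using K[of "p + r *\<^sub>R z"] by (simp add: mult.commute[of K] mult_left_mono)
  qed auto
  then show ?thesis by simp
qed

text \<open>The substitution \<open>y = x + sqrt (2 * \<tau>) *\<^sub>R z\<close> has a Jacobian
  that cancels the dependence of the normalising factor on \<open>\<tau>\<close>.\<close>

lemma gauss_kernel_integral:
  fixes F :: "'a::euclidean_space \<Rightarrow> complex"
  assumes [measurable]: "F \<in> borel_measurable borel" and \<tau>: "\<tau> > 0"
  shows "(LINT y|lborel. gauss_kernel \<tau> (x - y) *\<^sub>R F y) = gauss_mean F (sqrt (2 * \<tau>)) x"
proof -
  define c where "c = sqrt (2 * \<tau>)"
  have c: "c > 0" "c\<^sup>2 = 2 * \<tau>" using \<tau> by (auto simp: c_def)
  have [measurable]: "(\<lambda>y. gauss_kernel \<tau> (x - y)) \<in> borel_measurable borel"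
    unfolding gauss_kernel_def by measurable
  have "\<bar>c\<bar> ^ DIM('a) * gauss_kernel \<tau> (x - (x + c *\<^sub>R z)) = std_gauss z" for z
  proof -
    \<comment> \<open>The real power is written as a natural power of a one-dimensional factor, so
      that it merges with the Jacobian \<open>\<bar>c\<bar> ^ DIM('a)\<close>.\<close>
    have "(4 * pi * \<tau>) powr (- (real DIM('a) / 2)) = ((4 * pi * \<tau>) powr (-1/2)) powr real DIM('a)"
      by (simp add: powr_powr)
    also have "\<dots> = ((4 * pi * \<tau>) powr (-1/2)) ^ DIM('a)" using \<tau> by (intro powr_realpow) auto
    also have "(4 * pi * \<tau>) powr (-1/2) = 1 / (c * sqrt (2 * pi))"
      using \<tau> by (simp add: powr_minus_divide powr_half_sqrt c_def real_sqrt_mult[symmetric])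
    finally have "\<bar>c\<bar> ^ DIM('a) * (4 * pi * \<tau>) powr (- (real DIM('a) / 2)) = (1 / sqrt (2 * pi)) ^ DIM('a)"
      using c by (simp add: power_mult_distrib[symmetric] power_divide[symmetric] del: power_mult_distrib)
    moreover have "- (norm (x - (x + c *\<^sub>R z)))\<^sup>2 / (4 * \<tau>) = - (1/2) * (norm z)\<^sup>2"
      using \<tau> by (simp add: power_mult_distrib c)
    ultimately show ?thesis by (simp add: gauss_kernel_def std_gauss_eq mult.assoc[symmetric])
  qed
  then have "(\<lambda>z. \<bar>c\<bar> ^ DIM('a) *\<^sub>R gauss_kernel \<tau> (x - (x + c *\<^sub>R z)) *\<^sub>R F (x + c *\<^sub>R z))
      = (\<lambda>z. std_gauss z *\<^sub>R F (x + c *\<^sub>R z))" by (simp only: scaleR_scaleR)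
  then show ?thesis unfolding gauss_mean_def c_def[symmetric]
    by (subst integral_lborel_affine[of c _ x]) (use c in auto)
qed

text \<open>The third-order Taylor formula is integrated against the Gaussian: the linear term
  vanishes by the first moments, the covariance reduces the quadratic term to its trace, and the
  remainder costs a third absolute moment.\<close>

lemma gauss_mean_expansion:
  fixes F :: "'a::euclidean_space \<Rightarrow> complex"
  assumes F: "smooth F" and K: "\<And>x. norm (F x) \<le> K"
    and B: "\<And>b b' b'' x. b \<in> Basis \<Longrightarrow> b' \<in> Basis \<Longrightarrow> b'' \<in> Basis \<Longrightarrow>
      norm (partial_deriv b'' (partial_deriv b' (partial_deriv b F)) x) \<le> B"
    and r: "r \<ge> 0"
  shows "norm (gauss_mean F r p - F p - (r\<^sup>2 / 2) *\<^sub>R laplacian F p)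
    \<le> r ^ 3 * (real DIM('a) ^ 3 * B * (\<integral>z. std_gauss (z::'a) * norm z ^ 3 \<partial>lborel))"
proof -
  define D where "D = (\<lambda>b. partial_deriv b F p)"
  define D2 where "D2 = (\<lambda>b b'. partial_deriv b' (partial_deriv b F) p)"
  let ?T0 = "\<lambda>z. std_gauss z *\<^sub>R F (p + r *\<^sub>R z)"
  let ?T1 = "\<lambda>z::'a. std_gauss z *\<^sub>R F p"
  let ?T2 = "\<lambda>z. \<Sum>b\<in>Basis. (r * (std_gauss z * (z \<bullet> b))) *\<^sub>R D b"
  let ?T3 = "\<lambda>z. \<Sum>b\<in>Basis. \<Sum>b'\<in>Basis. (r\<^sup>2 / 2 * (std_gauss z * ((z \<bullet> b) * (z \<bullet> b')))) *\<^sub>R D2 b b'"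
  have Fm: "F \<in> borel_measurable borel"
    using smooth_continuous_on[OF F] by (rule borel_measurable_continuous_onI)
  have i0: "integrable lborel ?T0" using Fm K by (rule integrable_gauss_mean)
  have i1: "integrable lborel ?T1" by (intro integrable_scaleR_left) auto
  have i2: "integrable lborel ?T2"
    by (intro Bochner_Integration.integrable_sum integrable_scaleR_left integrable_mult_right integrable_std_gauss_first)
  have i3: "integrable lborel ?T3"
    by (intro Bochner_Integration.integrable_sum integrable_scaleR_left integrable_mult_right integrable_std_gauss_second)
  have I1: "integral\<^sup>L lborel ?T1 = F p" by simp
  have I2: "integral\<^sup>L lborel ?T2 = 0"
    by (simp add: integrable_std_gauss_first integral_std_gauss_first)
  have "integral\<^sup>L lborel ?T3 = (\<Sum>b\<in>Basis. \<Sum>b'\<in>Basis. (r\<^sup>2 / 2 * (if b = b' then 1 else 0)) *\<^sub>R D2 b b')"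
    by (simp add: integrable_std_gauss_second integral_std_gauss_second)
  also have "\<dots> = (\<Sum>b\<in>Basis. \<Sum>b'\<in>Basis. if b = b' then (r\<^sup>2 / 2) *\<^sub>R D2 b b' else 0)"
    by (intro sum.cong) auto
  also have "\<dots> = (r\<^sup>2 / 2) *\<^sub>R laplacian F p"
    by (simp add: laplacian_def D2_def scaleR_sum_right)
  finally have I3: "integral\<^sup>L lborel ?T3 = (r\<^sup>2 / 2) *\<^sub>R laplacian F p" .
  have "gauss_mean F r p - F p - (r\<^sup>2 / 2) *\<^sub>R laplacian F p
      = integral\<^sup>L lborel (\<lambda>z. ?T0 z - ?T1 z - ?T2 z - ?T3 z)"
    using i0 i1 i2 i3 I1 I2 I3 by (simp add: gauss_mean_def del: integral_sum)
  also have "norm \<dots> \<le> (\<integral>z. (r ^ 3 * (real DIM('a) ^ 3 * B)) * (std_gauss (z::'a) * norm z ^ 3) \<partial>lborel)"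
  proof (rule Bochner_Integration.integral_norm_bound_integral)
    show "integrable lborel (\<lambda>z. ?T0 z - ?T1 z - ?T2 z - ?T3 z)"
      by (intro Bochner_Integration.integrable_diff i0 i1 i2 i3)
    show "integrable lborel (\<lambda>z::'a. (r ^ 3 * (real DIM('a) ^ 3 * B)) * (std_gauss z * norm z ^ 3))"
      by (intro integrable_mult_right integrable_std_gauss_power)
    show "norm (?T0 z - ?T1 z - ?T2 z - ?T3 z) \<le> (r ^ 3 * (real DIM('a) ^ 3 * B)) * (std_gauss z * norm z ^ 3)" for z
    proof -
      have "?T0 z - ?T1 z - ?T2 z - ?T3 z = std_gauss z *\<^sub>R (F (p + r *\<^sub>R z) - F p
          - (\<Sum>b\<in>Basis. ((r *\<^sub>R z) \<bullet> b) *\<^sub>R D b)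
          - (1 / 2) *\<^sub>R (\<Sum>b\<in>Basis. \<Sum>b'\<in>Basis. (((r *\<^sub>R z) \<bullet> b) * ((r *\<^sub>R z) \<bullet> b')) *\<^sub>R D2 b b'))"
        by (simp add: scaleR_sum_right scaleR_diff_right power2_eq_square mult_ac)
      then have "norm (?T0 z - ?T1 z - ?T2 z - ?T3 z) \<le> std_gauss z * ((real DIM('a) * norm (r *\<^sub>R z)) ^ 3 * B)"
        using smooth_taylor3[OF F B, of p "r *\<^sub>R z"] by (simp add: D_def D2_def mult_left_mono)
      then show ?thesis using r by (simp add: power_mult_distrib mult_ac)
    qed
  qed
  also have "\<dots> = r ^ 3 * (real DIM('a) ^ 3 * B * (\<integral>z. std_gauss (z::'a) * norm z ^ 3 \<partial>lborel))" by simp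
  finally show ?thesis .
qed

section \<open>The Laplacian and the heat operator\<close>

lemma schwartz_uniform_bound:
  assumes "finite F" "F \<subseteq> schwartz"
  shows "\<exists>B>0. \<forall>g\<in>F. \<forall>x. norm (g x) \<le> B"
  using assms
proof (induction F)
  case empty
  show ?case by (auto intro: exI[of _ 1])
next
  case (insert g F)
  then obtain B where B: "B > 0" "\<forall>g\<in>F. \<forall>x. norm (g x) \<le> B" by auto
  obtain K where K: "K > 0" "\<And>x. norm (g x) \<le> K" using schwartz_bounded[of g] insert.prems by auto
  show ?case using B K by (intro exI[of _ "max B K"]) (auto simp: le_max_iff_disj)
qed

lemma schwartz_third_partials_bounded:
  fixes f :: "'a::euclidean_space \<Rightarrow> complex"
  assumes "f \<in> schwartz"
  obtains B where "B > 0" "\<And>b b' b'' x. b \<in> Basis \<Longrightarrow> b' \<in> Basis \<Longrightarrow> b'' \<in> Basis \<Longrightarrow>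
      norm (partial_deriv b'' (partial_deriv b' (partial_deriv b f)) x) \<le> B"
proof -
  have "\<exists>B>0. \<forall>g\<in>(\<lambda>(b, b', b''). partial_deriv b'' (partial_deriv b' (partial_deriv b f))) ` (Basis \<times> Basis \<times> Basis).
      \<forall>x. norm (g x) \<le> B"
    by (intro schwartz_uniform_bound) (auto intro!: schwartz_partial_deriv assms)
  then show ?thesis using that by fastforce
qed

lemma schwartz_tendsto_0:
  fixes f :: "'a::euclidean_space \<Rightarrow> complex"
  assumes "f \<in> schwartz"
  shows "(f \<longlongrightarrow> 0) at_infinity"
proof -
  obtain K where K: "K > 0" "\<And>p. norm p ^ 1 * norm (f p) \<le> K" using schwartz_decay[OF assms] by blast
  have "((\<lambda>p. K / norm p) \<longlongrightarrow> 0) at_infinity"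
    by (intro tendsto_divide_0[OF tendsto_const] filterlim_at_top_imp_at_infinity filterlim_norm_at_top)
  moreover have "eventually (\<lambda>p. norm (f p) \<le> K / norm p) at_infinity"
    unfolding eventually_at_infinity
  proof (intro exI allI impI)
    fix x :: 'a assume "1 \<le> norm x"
    then have "norm x > 0" by linarith
    then show "norm (f x) \<le> K / norm x" using K(2)[of x] by (simp add: pos_le_divide_eq mult.commute)
  qed
  ultimately show ?thesis by (rule Lim_null_comparison[rotated])
qed

text \<open>The error \<open>\<tau> * sqrt \<tau>\<close> is the cube of the scale
  \<open>sqrt (2 * \<tau>)\<close>. The coefficient \<open>L\<close> may vary with
  \<open>\<tau>\<close>, because for the heat operator the Laplacian is taken at the shifted time
  \<open>t - \<tau>\<close>.\<close>

lemma tendsto_difference_quotient_at_right_0: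
  fixes g :: "real \<Rightarrow> 'b::real_normed_vector"
  assumes "\<And>\<tau>. \<tau> > 0 \<Longrightarrow> \<tau> < 1 \<Longrightarrow> norm (g \<tau> - \<tau> *\<^sub>R L \<tau>) \<le> C * (\<tau> * sqrt \<tau>)" and L: "(L \<longlongrightarrow> l) (at_right 0)"
  shows "((\<lambda>\<tau>. (1 / \<tau>) *\<^sub>R g \<tau>) \<longlongrightarrow> l) (at_right 0)"
proof -
  have "((\<lambda>\<tau>. (1 / \<tau>) *\<^sub>R g \<tau> - L \<tau>) \<longlongrightarrow> 0) (at_right 0)"
  proof (rule Lim_null_comparison)
    have "eventually (\<lambda>\<tau>. \<tau> \<in> {0<..<1::real}) (at_right 0)" by (rule eventually_at_right_real) simp
    then show "eventually (\<lambda>\<tau>. norm ((1 / \<tau>) *\<^sub>R g \<tau> - L \<tau>) \<le> C * sqrt \<tau>) (at_right 0)"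
    proof eventually_elim
      case (elim \<tau>)
      then have "(1 / \<tau>) *\<^sub>R g \<tau> - L \<tau> = (1 / \<tau>) *\<^sub>R (g \<tau> - \<tau> *\<^sub>R L \<tau>)" by (simp add: scaleR_diff_right)
      also have "norm \<dots> \<le> (1 / \<tau>) * (C * (\<tau> * sqrt \<tau>))"
        using elim mult_left_mono[OF assms(1)[of \<tau>], of "1 / \<tau>"] by simp
      finally show ?case using elim by simp
    qed
    have "((\<lambda>\<tau>. C * sqrt \<tau>) \<longlongrightarrow> C * sqrt 0) (at_right 0)" by (intro tendsto_intros)
    then show "((\<lambda>\<tau>. C * sqrt \<tau>) \<longlongrightarrow> 0) (at_right 0)" by simp
  qed
  from tendsto_add[OF this L] show ?thesis by simp
qed

lemma has_vector_derivative_right_quotient: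
  assumes "(\<phi> has_vector_derivative D) (at 0)"
  shows "((\<lambda>\<tau>::real. (1 / \<tau>) *\<^sub>R (\<phi> \<tau> - \<phi> 0)) \<longlongrightarrow> D) (at_right 0)"
proof -
  have "(\<phi> has_derivative (\<lambda>h. h *\<^sub>R D)) (at_right 0)"
    using assms by (simp add: has_vector_derivative_def has_derivative_at_withinI)
  then have "((\<lambda>\<tau>. (1 / norm (\<tau> - 0)) *\<^sub>R (\<phi> \<tau> - (\<phi> 0 + (\<tau> - 0) *\<^sub>R D))) \<longlongrightarrow> 0) (at_right 0)"
    by (simp add: has_derivative_within)
  then have "((\<lambda>\<tau>. (1 / \<tau>) *\<^sub>R (\<phi> \<tau> - \<phi> 0) - D) \<longlongrightarrow> 0) (at_right 0)"
  proof (rule Lim_transform_eventually)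
    show "eventually (\<lambda>\<tau>. (1 / norm (\<tau> - 0)) *\<^sub>R (\<phi> \<tau> - (\<phi> 0 + (\<tau> - 0) *\<^sub>R D))
        = (1 / \<tau>) *\<^sub>R (\<phi> \<tau> - \<phi> 0) - D) (at_right 0)"
      using eventually_at_right_less[of 0]
      by eventually_elim (simp add: scaleR_diff_right scaleR_add_right)
  qed
  then show ?thesis by (rule LIM_zero_cancel)
qed

lemma sqrt_double_cube: "\<tau> \<ge> 0 \<Longrightarrow> sqrt (2 * \<tau>) ^ 3 = (2 * sqrt 2) * (\<tau> * sqrt \<tau>)"
  by (simp add: power3_eq_cube real_sqrt_mult[symmetric] mult.assoc[symmetric])

lemma laplace_case:
  fixes f :: "'a::euclidean_space \<Rightarrow> complex"
  assumes f: "f \<in> schwartz"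
  shows "((\<lambda>\<sigma>. frac_power laplace_semigroup \<sigma> f x) \<longlongrightarrow> - laplacian f x) (at_left 1)"
    and "((\<lambda>\<sigma>. frac_power laplace_semigroup \<sigma> f x) \<longlongrightarrow> f x) (at_right 0)"
proof -
  obtain K where K: "K > 0" "\<And>x. norm (f x) \<le> K" using schwartz_bounded[OF f] by auto
  obtain B where B: "B > 0" "\<And>b b' b'' x. b \<in> Basis \<Longrightarrow> b' \<in> Basis \<Longrightarrow> b'' \<in> Basis \<Longrightarrow>
      norm (partial_deriv b'' (partial_deriv b' (partial_deriv b f)) x) \<le> B"
    using schwartz_third_partials_bounded[OF f] by metis
  have fc: "continuous_on UNIV f" by (intro smooth_continuous_on schwartz_smooth f)
  then have [measurable]: "f \<in> borel_measurable borel" by (rule borel_measurable_continuous_onI)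
  have S: "laplace_semigroup \<tau> f x = gauss_mean f (sqrt (2 * \<tau>)) x" if "\<tau> > 0" for \<tau>
    unfolding laplace_semigroup_def by (rule gauss_kernel_integral) (use that in auto)
  have m: "(\<lambda>\<tau>. indicator {0<..} \<tau> *\<^sub>R laplace_semigroup \<tau> f x) \<in> borel_measurable borel"
  proof -
    have "(\<lambda>\<tau>. indicator {0<..} \<tau> *\<^sub>R gauss_mean f (sqrt (2 * \<tau>)) x) \<in> borel_measurable borel"
      unfolding gauss_mean_def by measurable
    also have "(\<lambda>\<tau>. indicator {0<..} \<tau> *\<^sub>R gauss_mean f (sqrt (2 * \<tau>)) x)
        = (\<lambda>\<tau>. indicator {0<..} \<tau> *\<^sub>R laplace_semigroup \<tau> f x)"
      by (auto simp: fun_eq_iff indicator_def S)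
    finally show ?thesis .
  qed
  have b: "norm (laplace_semigroup \<tau> f x) \<le> K" if "\<tau> > 0" for \<tau>
    unfolding S[OF that] by (rule norm_gauss_mean_le) (use K in auto)
  define M where "M = real DIM('a) ^ 3 * B * (\<integral>z. std_gauss (z::'a) * norm z ^ 3 \<partial>lborel)"
  have l0: "((\<lambda>\<tau>. (1 / \<tau>) *\<^sub>R (laplace_semigroup \<tau> f x - f x)) \<longlongrightarrow> - (- laplacian f x)) (at_right 0)"
  proof (rule tendsto_difference_quotient_at_right_0)
    fix \<tau> :: real assume t: "\<tau> > 0"
    have "norm (laplace_semigroup \<tau> f x - f x - \<tau> *\<^sub>R laplacian f x) \<le> sqrt (2 * \<tau>) ^ 3 * M"
      using gauss_mean_expansion[OF schwartz_smooth[OF f] K(2) B(2), of "sqrt (2 * \<tau>)" x] t by (simp add: S M_def)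
    then show "norm (laplace_semigroup \<tau> f x - f x - \<tau> *\<^sub>R laplacian f x) \<le> (2 * sqrt 2 * M) * (\<tau> * sqrt \<tau>)"
      unfolding sqrt_double_cube[OF less_imp_le[OF t]] by (simp only: mult_ac)
  qed simp
  \<comment> \<open>Long-time decay comes from spreading: the sampling points escape to infinity,
    where \<open>f\<close> vanishes, while \<open>K * std_gauss\<close> dominates.\<close>
  have "((\<lambda>\<tau>. gauss_mean f (sqrt (2 * \<tau>)) x) \<longlongrightarrow> (LINT z::'a|lborel. 0)) at_top"
    unfolding gauss_mean_def
  proof (rule integral_dominated_convergence_at_top)
    show "integrable lborel (\<lambda>z::'a. K * std_gauss z)" by (intro integrable_mult_right) auto
    show "\<forall>\<^sub>F \<tau> in at_top. AE z in lborel. norm (std_gauss z *\<^sub>R f (x + sqrt (2 * \<tau>) *\<^sub>R z)) \<le> K * std_gauss z"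
      using K by (auto intro!: always_eventually simp: mult.commute[of K] mult_left_mono)
    show "AE z::'a in lborel. ((\<lambda>\<tau>. std_gauss z *\<^sub>R f (x + sqrt (2 * \<tau>) *\<^sub>R z)) \<longlongrightarrow> 0) at_top"
      \<comment> \<open>At \<open>z = 0\<close> the sampling point stays at \<open>x\<close>; this
        single point is a null set.\<close>
      using AE_lborel_singleton[of 0]
    proof eventually_elim
      case (elim z)
      have "filterlim (\<lambda>\<tau>. norm z * sqrt (2 * \<tau>) + - norm x) at_top at_top"
        using elim
        by (intro filterlim_tendsto_add_at_top[OF tendsto_const, of _ _ "- norm x", unfolded add.commute[of "- norm x"]]
            filterlim_tendsto_pos_mult_at_top[OF tendsto_const] filterlim_compose[OF sqrt_at_top] filterlim_ident) auto
      then have "filterlim (\<lambda>\<tau>. norm (x + sqrt (2 * \<tau>) *\<^sub>R z)) at_top at_top"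
      proof (rule filterlim_at_top_mono)
        show "eventually (\<lambda>\<tau>. norm z * sqrt (2 * \<tau>) + - norm x \<le> norm (x + sqrt (2 * \<tau>) *\<^sub>R z)) at_top"
          using eventually_ge_at_top[of 0]
        proof eventually_elim
          case (elim \<tau>)
          then show ?case using norm_triangle_ineq4[of "x + sqrt (2 * \<tau>) *\<^sub>R z" x] by (simp add: mult.commute)
        qed
      qed
      then have "filterlim (\<lambda>\<tau>. x + sqrt (2 * \<tau>) *\<^sub>R z) at_infinity at_top"
        by (simp add: filterlim_at_infinity_conv_norm_at_top)
      from tendsto_compose_filtermap[of f, unfolded o_def] filterlim_compose[OF schwartz_tendsto_0[OF f] this]
      have "((\<lambda>\<tau>. f (x + sqrt (2 * \<tau>) *\<^sub>R z)) \<longlongrightarrow> 0) at_top" by simp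
      from tendsto_scaleR[OF tendsto_const this] show ?case by simp
    qed
  qed auto
  then have "((\<lambda>\<tau>. gauss_mean f (sqrt (2 * \<tau>)) x) \<longlongrightarrow> 0) at_top" by simp
  then have li: "((\<lambda>\<tau>. laplace_semigroup \<tau> f x) \<longlongrightarrow> 0) at_top"
    by (rule Lim_transform_eventually) (use eventually_gt_at_top[of 0] in \<open>eventually_elim, simp add: S\<close>)
  from frac_power_limits[where S = laplace_semigroup and f = f and p = x, OF m b l0 li]
  show "((\<lambda>\<sigma>. frac_power laplace_semigroup \<sigma> f x) \<longlongrightarrow> - laplacian f x) (at_left 1)"
    and "((\<lambda>\<sigma>. frac_power laplace_semigroup \<sigma> f x) \<longlongrightarrow> f x) (at_right 0)" by auto
qed

section \<open>Time slices and the heat operator\<close>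

lemma partial_deriv_slice: "partial_deriv b (\<lambda>y. g (s, y)) = (\<lambda>y. partial_deriv (0, b) g (s, y))"
  by (simp add: partial_deriv_def fun_eq_iff)

text \<open>Slices of arbitrary smooth functions form a class to which
  \<open>smooth_coinduct\<close> applies, since differentiating a slice in space gives a slice of a
  partial derivative.\<close>

lemma smooth_slice:
  fixes f :: "real \<times> 'a::euclidean_space \<Rightarrow> complex"
  assumes "smooth f"
  shows "smooth (\<lambda>y. f (s, y))"
proof -
  define X where "X = {\<lambda>y::'a. g (s, y) |g. smooth g}"
  show ?thesis
  proof (rule smooth_coinduct[where F = X])
  show "(\<lambda>y. f (s, y)) \<in> X" using assms by (auto simp: X_def)
next
  fix h and x :: 'a assume "h \<in> X"
  then obtain g where g: "h = (\<lambda>y. g (s, y))" "smooth g" by (auto simp: X_def)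
  have "((\<lambda>y::'a. (s, y)) has_derivative (\<lambda>h. (0, h))) (at x)"
    by (auto intro!: derivative_eq_intros)
  from has_derivative_compose[OF this has_derivative_partial_deriv[OF smooth_differentiable[OF g(2)]]]
  show "h differentiable (at x)" unfolding g differentiable_def by blast
next
  fix h and b :: 'a assume "h \<in> X" "b \<in> Basis"
  then show "partial_deriv b h \<in> X"
    by (force simp: X_def partial_deriv_slice Basis_prod_def intro!: smooth_partial_deriv)
qed
qed

text \<open>The semigroup diffuses the slice at time \<open>t - \<tau>\<close>. Its increment splits
  into diffusion away from \<open>f (t - \<tau>, x)\<close>, which yields the spatial Laplacian, and
  transport from \<open>f p\<close> to that value, which yields minus the time derivative.\<close>

lemma heat_case:
  fixes f :: "real \<times> 'a::euclidean_space \<Rightarrow> complex"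
  assumes f: "f \<in> schwartz"
  shows "((\<lambda>\<sigma>. frac_power heat_semigroup \<sigma> f p) \<longlongrightarrow> heat_op f p) (at_left 1)"
    and "((\<lambda>\<sigma>. frac_power heat_semigroup \<sigma> f p) \<longlongrightarrow> f p) (at_right 0)"
proof -
  obtain t x where p: "p = (t, x)" by (cases p)
  obtain K where K: "K > 0" "\<And>x. norm (f x) \<le> K" using schwartz_bounded[OF f] by auto
  obtain B where B: "B > 0" "\<And>b b' b'' x. b \<in> Basis \<Longrightarrow> b' \<in> Basis \<Longrightarrow> b'' \<in> Basis \<Longrightarrow>
      norm (partial_deriv b'' (partial_deriv b' (partial_deriv b f)) x) \<le> B"
    using schwartz_third_partials_bounded[OF f] by metis
  have Ba: "(0, b) \<in> Basis" if "b \<in> Basis" for b :: 'a using that by (auto simp: Basis_prod_def)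
  note sm = schwartz_smooth[OF f]
  have [measurable]: "f \<in> borel_measurable borel"
    by (rule borel_measurable_continuous_onI[OF smooth_continuous_on[OF sm]])
  have sl[measurable]: "(\<lambda>y. f (s, y)) \<in> borel_measurable borel" for s
    by (rule borel_measurable_continuous_onI[OF smooth_continuous_on[OF smooth_slice[OF sm]]])
  have S: "heat_semigroup \<tau> f p = gauss_mean (\<lambda>y. f (t - \<tau>, y)) (sqrt (2 * \<tau>)) x" if "\<tau> > 0" for \<tau>
    unfolding heat_semigroup_def p prod.case by (rule gauss_kernel_integral) (use that in auto)
  have m: "(\<lambda>\<tau>. indicator {0<..} \<tau> *\<^sub>R heat_semigroup \<tau> f p) \<in> borel_measurable borel"
  proof -
    have "(\<lambda>\<tau>. indicator {0<..} \<tau> *\<^sub>R gauss_mean (\<lambda>y. f (t - \<tau>, y)) (sqrt (2 * \<tau>)) x) \<in> borel_measurable borel"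
      unfolding gauss_mean_def by measurable
    also have "(\<lambda>\<tau>. indicator {0<..} \<tau> *\<^sub>R gauss_mean (\<lambda>y. f (t - \<tau>, y)) (sqrt (2 * \<tau>)) x)
        = (\<lambda>\<tau>. indicator {0<..} \<tau> *\<^sub>R heat_semigroup \<tau> f p)"
      by (auto simp: fun_eq_iff indicator_def S)
    finally show ?thesis .
  qed
  have b: "norm (heat_semigroup \<tau> f p) \<le> K" if "\<tau> > 0" for \<tau>
    unfolding S[OF that] by (rule norm_gauss_mean_le) (use K in auto)
  define M where "M = real DIM('a) ^ 3 * B * (\<integral>z. std_gauss (z::'a) * norm z ^ 3 \<partial>lborel)"
  define \<Lambda> where "\<Lambda> = (\<lambda>s. laplacian (\<lambda>y. f (s, y)) x)"
  have \<Lambda>: "\<Lambda> s = (\<Sum>b\<in>Basis. partial_deriv (0, b) (partial_deriv (0, b) f) (s, x))" for s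
    by (simp add: \<Lambda>_def laplacian_def partial_deriv_slice)
  \<comment> \<open>The expansion produces the Laplacian at the moving time
    \<open>t - \<tau>\<close>; continuity brings it back to \<open>t\<close>.\<close>
  have "isCont \<Lambda> s" for s
  proof -
    have "continuous_on UNIV (partial_deriv (0, b) (partial_deriv (0, b) f))" if "b \<in> Basis" for b :: 'a
      using Ba[OF that] by (intro smooth_continuous_on smooth_partial_deriv sm)
    then have "continuous_on UNIV (\<lambda>s. partial_deriv (0, b) (partial_deriv (0, b) f) (s, x))" if "b \<in> Basis" for b :: 'a
      by (rule continuous_on_compose2) (use that in \<open>auto intro!: continuous_intros\<close>)
    then have "continuous_on UNIV \<Lambda>"
      unfolding \<Lambda>[abs_def] by (rule continuous_on_sum)
    then show ?thesis by (simp add: continuous_on_eq_continuous_at)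
  qed
  then have "((\<lambda>\<tau>. \<Lambda> (t - \<tau>)) \<longlongrightarrow> \<Lambda> (t - 0)) (at_right 0)"
    by (intro isCont_tendsto_compose[of _ \<Lambda>] tendsto_intros)
  then have \<Lambda>_lim: "((\<lambda>\<tau>. \<Lambda> (t - \<tau>)) \<longlongrightarrow> \<Lambda> t) (at_right 0)" by simp
  have 1: "((\<lambda>\<tau>. (1 / \<tau>) *\<^sub>R (heat_semigroup \<tau> f p - f (t - \<tau>, x))) \<longlongrightarrow> \<Lambda> t) (at_right 0)"
  proof (rule tendsto_difference_quotient_at_right_0[OF _ \<Lambda>_lim])
    fix \<tau> :: real assume t: "\<tau> > 0"
    have "norm (heat_semigroup \<tau> f p - f (t - \<tau>, x) - \<tau> *\<^sub>R \<Lambda> (t - \<tau>)) \<le> sqrt (2 * \<tau>) ^ 3 * M"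
    proof -
      have "norm (partial_deriv b'' (partial_deriv b' (partial_deriv b (\<lambda>y. f (t - \<tau>, y)))) y) \<le> B"
        if "b \<in> Basis" "b' \<in> Basis" "b'' \<in> Basis" for b b' b'' y
        unfolding partial_deriv_slice by (intro B(2) Ba that)
      from gauss_mean_expansion[OF smooth_slice[OF sm, of "t - \<tau>"] K(2) this, of "sqrt (2 * \<tau>)" x] t
      show ?thesis by (simp add: S M_def \<Lambda>_def)
    qed
    then show "norm (heat_semigroup \<tau> f p - f (t - \<tau>, x) - \<tau> *\<^sub>R \<Lambda> (t - \<tau>)) \<le> (2 * sqrt 2 * M) * (\<tau> * sqrt \<tau>)"
      unfolding sqrt_double_cube[OF less_imp_le[OF t]] by (simp only: mult_ac)
  qed
  have 2: "((\<lambda>\<tau>. (1 / \<tau>) *\<^sub>R (f (t - \<tau>, x) - f p)) \<longlongrightarrow> - partial_deriv (1, 0) f p) (at_right 0)"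
  proof -
    obtain D where D: "(f has_derivative D) (at p)"
      using smooth_differentiable[OF sm, of p] by (auto simp: differentiable_def)
    then interpret D: bounded_linear D by (rule has_derivative_bounded_linear)
    have line: "((\<lambda>s::real. p + s *\<^sub>R (-1, 0)) has_derivative (\<lambda>s. s *\<^sub>R (-1, 0))) (at 0)"
      by (auto intro!: derivative_eq_intros)
    have "(f has_derivative D) (at (p + 0 *\<^sub>R (-1, 0)))" using D by (simp only: scaleR_zero_left add_0_right)
    from has_derivative_compose[OF line this]
    have "((\<lambda>s::real. f (p + s *\<^sub>R (-1, 0))) has_derivative (\<lambda>s. D (s *\<^sub>R (-1, 0)))) (at 0)" .
    also have "(\<lambda>s. D (s *\<^sub>R (-1, 0))) = (\<lambda>s. s *\<^sub>R (- partial_deriv (1, 0) f p))"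
      using D.scaleR[of _ "(-1, 0)"] D.neg[of "(1, 0)"] by (simp add: partial_derivI[OF D] fun_eq_iff del: scaleR_Pair)
    finally have "((\<lambda>s::real. f (p + s *\<^sub>R (-1, 0))) has_vector_derivative (- partial_deriv (1, 0) f p)) (at 0)"
      by (simp only: has_vector_derivative_def)
    from has_vector_derivative_right_quotient[OF this] show ?thesis by (simp add: p)
  qed
  have "((\<lambda>\<tau>. (1 / \<tau>) *\<^sub>R (heat_semigroup \<tau> f p - f (t - \<tau>, x)) + (1 / \<tau>) *\<^sub>R (f (t - \<tau>, x) - f p))
      \<longlongrightarrow> \<Lambda> t + - partial_deriv (1, 0) f p) (at_right 0)"
    by (intro tendsto_add 1 2)
  then have l0: "((\<lambda>\<tau>. (1 / \<tau>) *\<^sub>R (heat_semigroup \<tau> f p - f p)) \<longlongrightarrow> - heat_op f p) (at_right 0)"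
    by (simp add: scaleR_diff_right heat_op_def \<Lambda> p)
  obtain K1 where K1: "K1 > 0" "\<And>p. norm p ^ 1 * norm (f p) \<le> K1" using schwartz_decay[OF f] by blast
  have li: "((\<lambda>\<tau>. heat_semigroup \<tau> f p) \<longlongrightarrow> 0) at_top"
  proof (rule Lim_null_comparison)
    \<comment> \<open>Here decay comes from the time shift: every sampling point has norm at least
      \<open>\<tau> - t\<close>, so the decay of \<open>f\<close> bounds the whole slice
      uniformly.\<close>
    show "eventually (\<lambda>\<tau>. norm (heat_semigroup \<tau> f p) \<le> K1 / (\<tau> - t)) at_top"
      using eventually_gt_at_top[of "max 0 t"]
    proof eventually_elim
      case (elim \<tau>)
      have "norm (f (t - \<tau>, y)) \<le> K1 / (\<tau> - t)" for y
      proof -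
        have "(\<tau> - t) * norm (f (t - \<tau>, y)) \<le> norm (t - \<tau>, y) * norm (f (t - \<tau>, y))"
          using norm_fst_le[of "t - \<tau>" y] elim by (intro mult_right_mono) auto
        with K1(2)[of "(t - \<tau>, y)"] elim show ?thesis by (simp add: field_simps)
      qed
      then show ?case using elim by (subst S) (auto intro!: norm_gauss_mean_le)
    qed
    show "((\<lambda>\<tau>. K1 / (\<tau> - t)) \<longlongrightarrow> 0) at_top"
      by (intro tendsto_divide_0[OF tendsto_const] filterlim_at_top_imp_at_infinity)
         (simp add: diff_conv_add_uminus filterlim_tendsto_add_at_top[OF tendsto_const filterlim_ident, of "- t", unfolded add.commute[of "-t"]]
             del: add_uminus_conv_diff)
  qed
  from frac_power_limits[where S = heat_semigroup and f = f and p = p, OF m b l0 li]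
  show "((\<lambda>\<sigma>. frac_power heat_semigroup \<sigma> f p) \<longlongrightarrow> heat_op f p) (at_left 1)"
    and "((\<lambda>\<sigma>. frac_power heat_semigroup \<sigma> f p) \<longlongrightarrow> f p) (at_right 0)" by auto
qed

section \<open>The space of square-integrable functions\<close>

lemma L2_measurable: "u \<in> L2 \<Longrightarrow> u \<in> borel_measurable borel"
  by (simp add: L2_def)

lemma L2_integrable_square: "u \<in> L2 \<Longrightarrow> integrable lborel (\<lambda>x. (norm (u x))\<^sup>2)"
  by (simp add: L2_def)

lemma L2_I:
  assumes "u \<in> borel_measurable borel" and "integrable lborel g" and "\<And>x. (norm (u x))\<^sup>2 \<le> g x"
  shows "u \<in> L2"
proof -
  have "integrable lborel (\<lambda>x. (norm (u x))\<^sup>2)"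
    by (rule Bochner_Integration.integrable_bound[OF assms(2)])
       (use assms in \<open>auto intro!: always_eventually order_trans[OF assms(3)]\<close>)
  with assms(1) show ?thesis by (simp add: L2_def)
qed

lemma norm_lincomb_square_le:
  fixes c d u v :: complex
  shows "(norm (c * u + d * v))\<^sup>2 \<le> 2 * (norm c)\<^sup>2 * (norm u)\<^sup>2 + 2 * (norm d)\<^sup>2 * (norm v)\<^sup>2"
proof -
  have "(norm (c * u + d * v))\<^sup>2 \<le> (norm c * norm u + norm d * norm v)\<^sup>2"
    using norm_triangle_ineq[of "c * u" "d * v"] by (intro power_mono) (auto simp: norm_mult)
  also have "\<dots> \<le> 2 * (norm c * norm u)\<^sup>2 + 2 * (norm d * norm v)\<^sup>2"
    using sum_squares_bound[of "norm c * norm u" "norm d * norm v"] by (simp add: power2_sum)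
  finally show ?thesis by (simp add: power_mult_distrib)
qed

lemma L2_lincomb:
  assumes "u \<in> L2" "v \<in> L2"
  shows "(\<lambda>x. c * u x + d * v x) \<in> L2"
proof (rule L2_I)
  show "(\<lambda>x. c * u x + d * v x) \<in> borel_measurable borel"
    using assms[THEN L2_measurable] by measurable
  show "integrable lborel (\<lambda>x. 2 * (norm c)\<^sup>2 * (norm (u x))\<^sup>2 + 2 * (norm d)\<^sup>2 * (norm (v x))\<^sup>2)"
    using assms[THEN L2_integrable_square] by simp
qed (rule norm_lincomb_square_le)

lemma L2_diff: "u \<in> L2 \<Longrightarrow> v \<in> L2 \<Longrightarrow> (\<lambda>x. u x - v x) \<in> L2"
  using L2_lincomb[of u v 1 "- 1"] by simp

lemma L2_scaleR: "u \<in> L2 \<Longrightarrow> (\<lambda>x. r *\<^sub>R u x) \<in> L2"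
  using L2_lincomb[of u u "of_real r" 0] by (simp add: scaleR_conv_of_real)

lemma L2_uminus: "u \<in> L2 \<Longrightarrow> (\<lambda>x. - u x) \<in> L2"
  using L2_lincomb[of u u "- 1" 0] by simp

lemma L2_norm_nonneg [simp]: "0 \<le> L2_norm u"
  by (simp add: L2_norm_def)

lemma L2_norm_square: "(L2_norm u)\<^sup>2 = (LINT x|lborel. (norm (u x))\<^sup>2)"
  by (simp add: L2_norm_def)

lemma L2_norm_cong_AE:
  assumes "u \<in> L2" "v \<in> L2" "AE x in lborel. u x = v x"
  shows "L2_norm u = L2_norm v"
proof -
  have "(LINT x|lborel. (norm (u x))\<^sup>2) = (LINT x|lborel. (norm (v x))\<^sup>2)"
    by (rule integral_cong_AE) (use assms in \<open>auto simp: L2_def\<close>)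
  then show ?thesis by (simp add: L2_norm_def)
qed

lemma L2_mult_integrable:
  assumes "u \<in> L2" "v \<in> L2"
  shows "integrable lborel (\<lambda>x. norm (u x) * norm (v x))"
proof (rule Bochner_Integration.integrable_bound)
  show "integrable lborel (\<lambda>x. (norm (u x))\<^sup>2 + (norm (v x))\<^sup>2)"
    using assms[THEN L2_integrable_square] by simp
  show "(\<lambda>x. norm (u x) * norm (v x)) \<in> borel_measurable lborel"
    using assms[THEN L2_measurable] by measurable
  show "AE x in lborel. norm (norm (u x) * norm (v x)) \<le> norm ((norm (u x))\<^sup>2 + (norm (v x))\<^sup>2)"
  proof (intro always_eventually allI)
    fix x
    have "2 * (norm (u x) * norm (v x)) \<le> (norm (u x))\<^sup>2 + (norm (v x))\<^sup>2"
      using sum_squares_bound[of "norm (u x)" "norm (v x)"] by (simp add: mult.assoc)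
    moreover have "0 \<le> (norm (u x))\<^sup>2 + (norm (v x))\<^sup>2" by simp
    ultimately have "norm (u x) * norm (v x) \<le> (norm (u x))\<^sup>2 + (norm (v x))\<^sup>2" by linarith
    then show "norm (norm (u x) * norm (v x)) \<le> norm ((norm (u x))\<^sup>2 + (norm (v x))\<^sup>2)" by simp
  qed
qed

lemma borel_measurable_cnj [measurable (raw)]:
  "f \<in> borel_measurable M \<Longrightarrow> (\<lambda>x. cnj (f x)) \<in> borel_measurable M"
  by (rule measurable_compose[OF _ borel_measurable_continuous_onI]) (auto intro: continuous_intros)

lemma L2_inner_integrable:
  assumes "u \<in> L2" "v \<in> L2"
  shows "integrable lborel (\<lambda>x. u x * cnj (v x))"
  by (rule Bochner_Integration.integrable_bound[OF L2_mult_integrable[OF assms]])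
     (use assms[THEN L2_measurable] in \<open>auto simp: norm_mult\<close>)

lemma L2_Cauchy_Schwarz:
  assumes "u \<in> L2" "v \<in> L2"
  shows "(LINT x|lborel. norm (u x) * norm (v x)) \<le> L2_norm u * L2_norm v"
proof -
  have m: "(\<lambda>x. norm (u x)) \<in> borel_measurable lborel" "(\<lambda>x. norm (v x)) \<in> borel_measurable lborel"
    using assms[THEN L2_measurable] by measurable
  have "(\<integral>\<^sup>+x. ennreal (norm (u x)) * ennreal (norm (v x)) \<partial>lborel)\<^sup>2
      \<le> (\<integral>\<^sup>+x. (ennreal (norm (u x)))\<^sup>2 \<partial>lborel) * (\<integral>\<^sup>+x. (ennreal (norm (v x)))\<^sup>2 \<partial>lborel)"
    by (rule Cauchy_Schwarz_nn_integral) (use m in measurable)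
  also have "(\<integral>\<^sup>+x. ennreal (norm (u x)) * ennreal (norm (v x)) \<partial>lborel)
      = ennreal (LINT x|lborel. norm (u x) * norm (v x))"
    using nn_integral_eq_integral[OF L2_mult_integrable[OF assms]] by (simp add: ennreal_mult)
  also have "(\<integral>\<^sup>+x. (ennreal (norm (u x)))\<^sup>2 \<partial>lborel) = ennreal ((L2_norm u)\<^sup>2)"
    using nn_integral_eq_integral[OF L2_integrable_square[OF assms(1)]]
    by (simp add: ennreal_power L2_norm_square)
  also have "(\<integral>\<^sup>+x. (ennreal (norm (v x)))\<^sup>2 \<partial>lborel) = ennreal ((L2_norm v)\<^sup>2)"
    using nn_integral_eq_integral[OF L2_integrable_square[OF assms(2)]]
    by (simp add: ennreal_power L2_norm_square)
  finally have "(LINT x|lborel. norm (u x) * norm (v x))\<^sup>2 \<le> (L2_norm u * L2_norm v)\<^sup>2"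
    by (simp add: ennreal_power ennreal_mult[symmetric] power_mult_distrib)
  then show ?thesis by (rule power2_le_imp_le) simp
qed

lemma norm_L2_inner_le:
  assumes "u \<in> L2" "v \<in> L2"
  shows "norm (L2_inner u v) \<le> L2_norm u * L2_norm v"
proof -
  have "norm (L2_inner u v) \<le> (LINT x|lborel. norm (u x * cnj (v x)))"
    unfolding L2_inner_def by (rule integral_norm_bound)
  also have "\<dots> \<le> L2_norm u * L2_norm v"
    using L2_Cauchy_Schwarz[OF assms] by (simp add: norm_mult)
  finally show ?thesis .
qed

lemma L2_norm_triangle:
  assumes "u \<in> L2" "v \<in> L2"
  shows "L2_norm (\<lambda>x. u x + v x) \<le> L2_norm u + L2_norm v"
proof (rule power2_le_imp_le)
  note i = assms[THEN L2_integrable_square] L2_mult_integrable[OF assms]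
  have "(L2_norm (\<lambda>x. u x + v x))\<^sup>2 \<le>
      (LINT x|lborel. (norm (u x))\<^sup>2 + 2 * (norm (u x) * norm (v x)) + (norm (v x))\<^sup>2)"
    unfolding L2_norm_square
  proof (rule integral_mono)
    show "integrable lborel (\<lambda>x. (norm (u x + v x))\<^sup>2)"
      using L2_integrable_square[OF L2_lincomb[OF assms, of 1 1]] by simp
    show "(norm (u x + v x))\<^sup>2 \<le> (norm (u x))\<^sup>2 + 2 * (norm (u x) * norm (v x)) + (norm (v x))\<^sup>2" for x
      using power_mono[OF norm_triangle_ineq, of "u x" "v x" 2] by (simp add: power2_sum)
  qed (use i in simp)
  also have "\<dots> = (L2_norm u)\<^sup>2 + 2 * (LINT x|lborel. norm (u x) * norm (v x)) + (L2_norm v)\<^sup>2"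
    using i by (simp add: L2_norm_square)
  also have "\<dots> \<le> (L2_norm u + L2_norm v)\<^sup>2"
    using L2_Cauchy_Schwarz[OF assms] by (simp add: power2_sum)
  finally show "(L2_norm (\<lambda>x. u x + v x))\<^sup>2 \<le> (L2_norm u + L2_norm v)\<^sup>2" .
qed simp

lemma L2_norm_diff_commute: "L2_norm (\<lambda>x. u x - v x) = L2_norm (\<lambda>x. v x - u x)"
  by (simp add: L2_norm_def norm_minus_commute)

lemma L2_norm_diff_triangle:
  assumes "u \<in> L2" "v \<in> L2" "w \<in> L2"
  shows "L2_norm (\<lambda>x. u x - w x) \<le> L2_norm (\<lambda>x. u x - v x) + L2_norm (\<lambda>x. v x - w x)"
  using L2_norm_triangle[OF L2_diff[OF assms(1,2)] L2_diff[OF assms(2,3)]] by simp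

lemma L2_norm_diff_ge:
  assumes "u \<in> L2" "v \<in> L2"
  shows "\<bar>L2_norm u - L2_norm v\<bar> \<le> L2_norm (\<lambda>x. u x - v x)"
  using L2_norm_triangle[OF L2_diff[OF assms] assms(2)]
    L2_norm_triangle[OF L2_diff[OF assms(2,1)] assms(1)] L2_norm_diff_commute[of u v]
  by simp

lemma L2_inner_diff_left:
  "u \<in> L2 \<Longrightarrow> v \<in> L2 \<Longrightarrow> w \<in> L2 \<Longrightarrow> L2_inner (\<lambda>x. u x - v x) w = L2_inner u w - L2_inner v w"
  by (simp add: L2_inner_def left_diff_distrib L2_inner_integrable)

lemma L2_inner_diff_right:
  "u \<in> L2 \<Longrightarrow> v \<in> L2 \<Longrightarrow> w \<in> L2 \<Longrightarrow> L2_inner w (\<lambda>x. u x - v x) = L2_inner w u - L2_inner w v"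
  by (simp add: L2_inner_def right_diff_distrib L2_inner_integrable)

lemma L2_inner_scaleR_left: "L2_inner (\<lambda>x. r *\<^sub>R u x) w = r *\<^sub>R L2_inner u w"
  by (simp add: L2_inner_def)

lemma L2_inner_scaleR_right: "L2_inner w (\<lambda>x. r *\<^sub>R u x) = r *\<^sub>R L2_inner w u"
  by (simp add: L2_inner_def)

lemma L2_inner_cong_AE_right:
  assumes "u \<in> L2" "v \<in> L2" "w \<in> L2" "AE x in lborel. u x = v x"
  shows "L2_inner w u = L2_inner w v"
  unfolding L2_inner_def
  by (rule integral_cong_AE) (use assms in \<open>auto simp: L2_def\<close>)

text \<open>Joint continuity of the inner product in norm. It serves below for difference quotients
  paired with a factor that moves as well.\<close>

lemma tendsto_L2_inner:
  assumes ev: "eventually (\<lambda>n. u n \<in> L2) F" "eventually (\<lambda>n. v n \<in> L2) F" and 0: "u0 \<in> L2" "v0 \<in> L2"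
    and u: "((\<lambda>n. L2_norm (\<lambda>x. u n x - u0 x)) \<longlongrightarrow> 0) F"
    and v: "((\<lambda>n. L2_norm (\<lambda>x. v n x - v0 x)) \<longlongrightarrow> 0) F"
  shows "((\<lambda>n. L2_inner (u n) (v n)) \<longlongrightarrow> L2_inner u0 v0) F"
proof -
  define a b where "a = (\<lambda>n. L2_norm (\<lambda>x. u n x - u0 x))" and "b = (\<lambda>n. L2_norm (\<lambda>x. v n x - v0 x))"
  have bound: "eventually (\<lambda>n. norm (L2_inner (u n) (v n) - L2_inner u0 v0) \<le> a n * (b n + L2_norm v0) + L2_norm u0 * b n) F"
    using ev
  proof eventually_elim
    case (elim n)
    have "L2_inner (u n) (v n) - L2_inner u0 v0
        = L2_inner (\<lambda>x. u n x - u0 x) (v n) + L2_inner u0 (\<lambda>x. v n x - v0 x)"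
      using elim 0 by (simp add: L2_inner_diff_left L2_inner_diff_right)
    also have "norm \<dots> \<le> a n * L2_norm (v n) + L2_norm u0 * b n"
      unfolding a_def b_def
      by (intro order_trans[OF norm_triangle_ineq] add_mono norm_L2_inner_le L2_diff elim 0)
    also have "\<dots> \<le> a n * (b n + L2_norm v0) + L2_norm u0 * b n"
      using L2_norm_diff_ge[OF elim(2) 0(2)] by (intro add_right_mono mult_left_mono) (auto simp: a_def b_def)
    finally show ?case .
  qed
  have "((\<lambda>n. a n * (b n + L2_norm v0) + L2_norm u0 * b n) \<longlongrightarrow> 0 * (0 + L2_norm v0) + L2_norm u0 * 0) F"
    unfolding a_def b_def by (intro tendsto_intros u v)
  then have "((\<lambda>n. a n * (b n + L2_norm v0) + L2_norm u0 * b n) \<longlongrightarrow> 0) F" by simp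
  from Lim_null_comparison[OF bound this]
  have "((\<lambda>n. L2_inner (u n) (v n) - L2_inner u0 v0) \<longlongrightarrow> 0) F" .
  then show ?thesis by (rule LIM_zero_cancel)
qed

section \<open>Strong continuity of semigroups\<close>

text \<open>Evaluating \<open>g\<close> at the next point of an ever finer grid to the right gives
  functions that factor through the integers, hence measurable ones, and they converge to
  \<open>g\<close> by right continuity.\<close>

lemma borel_measurable_right_continuous:
  fixes g :: "real \<Rightarrow> 'b::metric_space"
  assumes "\<And>x. (g \<longlongrightarrow> g x) (at_right x)"
  shows "g \<in> borel_measurable borel"
proof (rule borel_measurable_LIMSEQ_metric)
  \<comment> \<open>The first multiple of \<open>1 / (n + 1)\<close> strictly beyond
    \<open>x\<close>. Adding 1 to the floor makes it strict, as convergence along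
    \<open>at_right x\<close> excludes \<open>x\<close> itself.\<close>
  let ?a = "\<lambda>(n::nat) x::real. (real_of_int \<lfloor>real (Suc n) * x\<rfloor> + 1) / real (Suc n)"
  show "(\<lambda>x. g (?a n x)) \<in> borel_measurable borel" for n
  proof -
    have "(\<lambda>x::real. \<lfloor>real (Suc n) * x\<rfloor>) \<in> measurable borel (count_space UNIV)" by measurable
    then show ?thesis
      by (rule measurable_compose[where g = "\<lambda>k. g ((real_of_int k + 1) / real (Suc n))"]) simp
  qed
  fix x :: real
  have lo: "x < ?a n x" for n
    by (simp add: pos_less_divide_eq mult.commute del: of_nat_Suc)
  have hi: "?a n x \<le> x + 1 / real (Suc n)" for n
    by (simp add: pos_divide_le_eq distrib_left mult.commute del: of_nat_Suc)
  have "(\<lambda>n. x + 1 / real (Suc n)) \<longlonglongrightarrow> x + 0"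
    by (intro tendsto_add tendsto_const LIMSEQ_Suc[OF lim_1_over_n])
  then have lim: "(\<lambda>n. x + 1 / real (Suc n)) \<longlonglongrightarrow> x" by simp
  have "(\<lambda>n. ?a n x) \<longlonglongrightarrow> x"
    by (rule tendsto_sandwich[OF always_eventually always_eventually tendsto_const lim])
       (intro allI less_imp_le lo, intro allI hi)
  then have "filterlim (\<lambda>n. ?a n x) (at_right x) sequentially"
    unfolding filterlim_at using less_imp_neq[OF lo, symmetric] lo
    by (intro conjI always_eventually allI) (simp_all del: of_nat_Suc)
  from filterlim_compose[OF assms this] show "(\<lambda>n. g (?a n x)) \<longlonglongrightarrow> g x" .
qed

text \<open>A continuation argument: for every slope \<open>e > 0\<close> the increment stays below
  \<open>e * (r - a)\<close> up to \<open>b\<close>, since otherwise the right derivative would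
  carry the bound past the last good point.\<close>

lemma right_derivative_zero_constant:
  fixes \<psi> :: "real \<Rightarrow> 'b::real_normed_vector"
  assumes "a \<le> b" and cont: "continuous_on {a..b} \<psi>"
    and deriv: "\<And>s. a \<le> s \<Longrightarrow> s < b \<Longrightarrow> ((\<lambda>h. (1 / h) *\<^sub>R (\<psi> (s + h) - \<psi> s)) \<longlongrightarrow> 0) (at_right 0)"
  shows "\<psi> b = \<psi> a"
proof -
  have "norm (\<psi> b - \<psi> a) \<le> e * (b - a)" if e: "e > 0" for e
  proof -
    \<comment> \<open>The bound is demanded on the whole initial segment, so that \<open>S\<close>
      is an interval starting at \<open>a\<close>.\<close>
    define S where "S = {s \<in> {a..b}. \<forall>r\<in>{a..s}. norm (\<psi> r - \<psi> a) \<le> e * (r - a)}"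
    define c where "c = Sup S"
    have aS: "a \<in> S" using \<open>a \<le> b\<close> by (auto simp: S_def)
    have bdd: "bdd_above S" by (auto simp: S_def bdd_above_def)
    have c: "a \<le> c" "c \<le> b"
    proof -
      show "a \<le> c" unfolding c_def using aS bdd by (rule cSup_upper)
      show "c \<le> b" unfolding c_def by (rule cSup_least) (use aS in \<open>auto simp: S_def\<close>)
    qed
    have below: "norm (\<psi> r - \<psi> a) \<le> e * (r - a)" if r: "a \<le> r" "r < c" for r
    proof -
      obtain s where "s \<in> S" "r < s" using less_cSupD[of S r] aS r by (auto simp: c_def)
      then show ?thesis using r by (auto simp: S_def)
    qed
    have at_c: "norm (\<psi> c - \<psi> a) \<le> e * (c - a)"
    proof (cases "c = a")
      case False
      \<comment> \<open>The supremum \<open>c\<close> is itself good: the bound holds on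
        \<open>{a..<c}\<close> and passes to the closure by continuity.\<close>
      define \<phi> where "\<phi> = (\<lambda>r. e * (r - a) - norm (\<psi> r - \<psi> a))"
      have cl: "closure {a..<c} = {a..c}" using False c by simp
      have "continuous_on (closure {a..<c}) \<phi>"
        unfolding cl \<phi>_def using c by (intro continuous_intros continuous_on_subset[OF cont]) auto
      moreover have "c \<in> closure {a..<c}" unfolding cl using c by simp
      moreover have "\<phi> r \<ge> 0" if "r \<in> {a..<c}" for r using below[of r] that by (simp add: \<phi>_def)
      ultimately have "\<phi> c \<ge> 0" by (rule continuous_ge_on_closure)
      then show ?thesis by (simp add: \<phi>_def)
    qed simp
    have "c = b"
    proof (rule ccontr)
      assume "c \<noteq> b"
      then have "c < b" using c by simp
      from tendstoD[OF deriv[OF c(1) this] e] obtain d where d: "d > 0"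
        "\<And>h. 0 < h \<Longrightarrow> h < d \<Longrightarrow> norm ((1 / h) *\<^sub>R (\<psi> (c + h) - \<psi> c)) < e"
        by (auto simp: eventually_at_right_field)
      define m where "m = min (d / 2) (b - c)"
      have m: "m > 0" "m < d" "c + m \<le> b" using d \<open>c < b\<close> by (auto simp: m_def)
      have "norm (\<psi> r - \<psi> a) \<le> e * (r - a)" if r: "a \<le> r" "r \<le> c + m" for r
      proof (cases "r \<le> c")
        case True then show ?thesis using below[of r] at_c r by (cases "r = c") auto
      next
        case False
        define h where "h = r - c"
        have h: "0 < h" "h < d" "r = c + h" using False r m by (auto simp: h_def)
        have "norm (\<psi> r - \<psi> c) \<le> e * h"
          using d(2)[OF h(1,2)] h by (simp add: divide_less_eq)
        then have "norm (\<psi> r - \<psi> a) \<le> e * h + e * (c - a)"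
          using at_c norm_triangle_ineq[of "\<psi> r - \<psi> c" "\<psi> c - \<psi> a"] by simp
        then show ?thesis using h by (simp add: algebra_simps)
      qed
      then have "c + m \<in> S" using c m by (auto simp: S_def)
      then have "c + m \<le> c" unfolding c_def using bdd by (rule cSup_upper)
      with m show False by simp
    qed
    with at_c show ?thesis by simp
  qed
  then have "norm (\<psi> b - \<psi> a) \<le> 0 + e" if "e > 0" for e
  proof (cases "a = b")
    case True then show ?thesis using that by simp
  next
    case False
    then show ?thesis using \<open>\<And>e. e > 0 \<Longrightarrow> norm (\<psi> b - \<psi> a) \<le> e * (b - a)\<close>[of "e / (b - a)"] that \<open>a \<le> b\<close> by simp
  qed
  then have "norm (\<psi> b - \<psi> a) \<le> 0" by (rule field_le_epsilon)
  then show ?thesis by simp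
qed

section \<open>Norm continuity in time of an abstract semigroup\<close>

context
  fixes T :: "real \<Rightarrow> ('a::euclidean_space \<Rightarrow> complex) \<Rightarrow> 'a \<Rightarrow> complex"
  assumes T: "C0_semigroup T"
begin

lemma semigroup_L2: "\<tau> \<ge> 0 \<Longrightarrow> u \<in> L2 \<Longrightarrow> T \<tau> u \<in> L2"
  using T by (simp add: C0_semigroup_def)

lemma semigroup_lincomb: "\<tau> \<ge> 0 \<Longrightarrow> u \<in> L2 \<Longrightarrow> v \<in> L2 \<Longrightarrow>
    AE x in lborel. T \<tau> (\<lambda>y. c * u y + d * v y) x = c * T \<tau> u x + d * T \<tau> v x"
  using T unfolding C0_semigroup_def by blast

lemma semigroup_diff: "\<tau> \<ge> 0 \<Longrightarrow> u \<in> L2 \<Longrightarrow> v \<in> L2 \<Longrightarrow>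
    AE x in lborel. T \<tau> (\<lambda>y. u y - v y) x = T \<tau> u x - T \<tau> v x"
  using semigroup_lincomb[of \<tau> u v 1 "- 1"] by simp

lemma semigroup_scaleR: "\<tau> \<ge> 0 \<Longrightarrow> u \<in> L2 \<Longrightarrow> AE x in lborel. T \<tau> (\<lambda>y. r *\<^sub>R u y) x = r *\<^sub>R T \<tau> u x"
  using semigroup_lincomb[of \<tau> u u "of_real r" 0] by (simp add: scaleR_conv_of_real)

lemma semigroup_add: "\<tau> \<ge> 0 \<Longrightarrow> \<rho> \<ge> 0 \<Longrightarrow> u \<in> L2 \<Longrightarrow> AE x in lborel. T (\<tau> + \<rho>) u x = T \<tau> (T \<rho> u) x"
  using T unfolding C0_semigroup_def by blast

lemma semigroup_zero: "u \<in> L2 \<Longrightarrow> AE x in lborel. T 0 u x = u x"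
  using T unfolding C0_semigroup_def by blast

lemma semigroup_tendsto: "u \<in> L2 \<Longrightarrow> ((\<lambda>\<tau>. L2_norm (\<lambda>x. T \<tau> u x - u x)) \<longlongrightarrow> 0) (at_right 0)"
  using T unfolding C0_semigroup_def by blast

text \<open>One bound per time is selected, with no uniformity claimed; it is made positive so that
  it can be divided by.\<close>

lemma semigroup_bound:
  "\<exists>N. \<forall>\<tau>. N \<tau> > 0 \<and> (\<forall>u\<in>L2. \<tau> \<ge> 0 \<longrightarrow> L2_norm (T \<tau> u) \<le> N \<tau> * L2_norm u)"
proof -
  have "\<exists>C>0. \<forall>u\<in>L2. \<tau> \<ge> 0 \<longrightarrow> L2_norm (T \<tau> u) \<le> C * L2_norm u" for \<tau>
  proof (cases "\<tau> \<ge> 0")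
    case True
    then obtain C where C: "\<forall>u\<in>L2. L2_norm (T \<tau> u) \<le> C * L2_norm u"
      using T unfolding C0_semigroup_def by blast
    have "L2_norm (T \<tau> u) \<le> max C 1 * L2_norm u" if "u \<in> L2" for u
    proof -
      have "L2_norm (T \<tau> u) \<le> C * L2_norm u" using C that by blast
      also have "\<dots> \<le> max C 1 * L2_norm u" by (intro mult_right_mono) auto
      finally show ?thesis .
    qed
    then show ?thesis by (intro exI[of _ "max C 1"]) auto
  qed (auto intro: exI[of _ 1])
  then have "\<forall>\<tau>. \<exists>C. C > 0 \<and> (\<forall>u\<in>L2. \<tau> \<ge> 0 \<longrightarrow> L2_norm (T \<tau> u) \<le> C * L2_norm u)" by blast
  then show ?thesis by (rule choice)
qed

lemma semigroup_diff_norm: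
  assumes "\<tau> \<ge> 0" "u \<in> L2" "v \<in> L2"
  shows "L2_norm (\<lambda>x. T \<tau> u x - T \<tau> v x) = L2_norm (T \<tau> (\<lambda>x. u x - v x))"
  by (rule L2_norm_cong_AE) (use semigroup_diff[OF assms] assms in \<open>auto intro!: L2_diff semigroup_L2\<close>)

text \<open>Up to a null set the increment is \<open>T s\<close> applied to
  \<open>T h u - u\<close>. The outer operator does not move with \<open>h\<close>, so the single
  bound \<open>N s\<close> suffices.\<close>

lemma semigroup_right_continuous:
  assumes "s \<ge> 0" "u \<in> L2"
  shows "((\<lambda>h. L2_norm (\<lambda>x. T (s + h) u x - T s u x)) \<longlongrightarrow> 0) (at_right 0)"
proof -
  from semigroup_bound obtain N where
    "\<forall>\<tau>. N \<tau> > 0 \<and> (\<forall>u\<in>L2. \<tau> \<ge> 0 \<longrightarrow> L2_norm (T \<tau> u) \<le> N \<tau> * L2_norm u)" ..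
  then have N: "N \<tau> > 0" "\<tau> \<ge> 0 \<Longrightarrow> u \<in> L2 \<Longrightarrow> L2_norm (T \<tau> u) \<le> N \<tau> * L2_norm u" for \<tau> u by auto
  show ?thesis
  proof (rule Lim_null_comparison)
    show "eventually (\<lambda>h. norm (L2_norm (\<lambda>x. T (s + h) u x - T s u x)) \<le> N s * L2_norm (\<lambda>x. T h u x - u x)) (at_right 0)"
      using eventually_at_right_less[of 0]
    proof eventually_elim
      case (elim h)
      have "L2_norm (\<lambda>x. T (s + h) u x - T s u x) = L2_norm (\<lambda>x. T s (T h u) x - T s u x)"
        by (rule L2_norm_cong_AE)
           (use elim assms semigroup_add[of s h u] in \<open>auto intro!: L2_diff semigroup_L2\<close>)
      also have "\<dots> \<le> N s * L2_norm (\<lambda>x. T h u x - u x)"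
        using elim assms by (subst semigroup_diff_norm) (auto intro!: N(2) semigroup_L2 L2_diff)
      finally show ?case by simp
    qed
    show "((\<lambda>h. N s * L2_norm (\<lambda>x. T h u x - u x)) \<longlongrightarrow> 0) (at_right 0)"
      using tendsto_mult[OF tendsto_const semigroup_tendsto[OF assms(2)], of "N s"] by simp
  qed
qed

text \<open>\<open>max 0 r\<close> extends the orbit to the whole line, because nothing is known
  about negative times; the extension is right continuous everywhere.\<close>

lemma semigroup_norm_measurable:
  assumes u: "u \<in> L2"
  shows "(\<lambda>r. L2_norm (T (max 0 r) u)) \<in> borel_measurable borel"
proof (rule borel_measurable_right_continuous)
  fix r :: real
  show "((\<lambda>r. L2_norm (T (max 0 r) u)) \<longlongrightarrow> L2_norm (T (max 0 r) u)) (at_right r)"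
  proof (cases "r < 0")
    case True
    have "eventually (\<lambda>x. x \<in> {r<..<0}) (at_right r)" using True by (rule eventually_at_right_real)
    then have "eventually (\<lambda>x. L2_norm (T (max 0 r) u) = L2_norm (T (max 0 x) u)) (at_right r)"
      by eventually_elim (use True in \<open>auto simp: max_def\<close>)
    then show ?thesis by (rule Lim_transform_eventually[OF tendsto_const])
  next
    case False
    have "((\<lambda>h. L2_norm (T (r + h) u) - L2_norm (T r u)) \<longlongrightarrow> 0) (at_right 0)"
    proof (rule Lim_null_comparison[OF _ semigroup_right_continuous])
      show "eventually (\<lambda>h. norm (L2_norm (T (r + h) u) - L2_norm (T r u)) \<le> L2_norm (\<lambda>x. T (r + h) u x - T r u x)) (at_right 0)"
        using eventually_at_right_less[of 0]
        by eventually_elim (use False u in \<open>auto intro!: L2_norm_diff_ge semigroup_L2\<close>)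
    qed (use False u in auto)
    then have "((\<lambda>h. L2_norm (T (r + h) u)) \<longlongrightarrow> L2_norm (T r u)) (at_right 0)" by (rule LIM_zero_cancel)
    then have "((\<lambda>x. L2_norm (T x u)) \<longlongrightarrow> L2_norm (T r u)) (at_right r)"
      by (subst at_right_to_0) (simp add: filterlim_filtermap add.commute)
    then have "((\<lambda>x. L2_norm (T x u)) \<longlongrightarrow> L2_norm (T (max 0 r) u)) (at_right r)" using False by (simp add: max_def)
    moreover have "eventually (\<lambda>x. L2_norm (T x u) = L2_norm (T (max 0 x) u)) (at_right r)"
      using eventually_at_right_less[of r] by eventually_elim (use False in \<open>auto simp: max_def\<close>)
    ultimately show ?thesis by (rule Lim_transform_eventually)
  qed
qed

text \<open>This replaces the uniform boundedness principle: if \<open>\<parallel>T (X n) (u n)\<parallel> \<ge> e\<close> for all \<open>n\<close>, then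
  \<open>e \<le> \<parallel>T t\<parallel> * \<parallel>T (X n - t) (u n)\<parallel>\<close> for all \<open>t\<close> in an interval, although the last factor
  converges to \<open>0\<close> in measure.\<close>

lemma semigroup_tendsto_0:
  assumes \<gamma>: "\<gamma> > 0" and X: "X \<longlonglongrightarrow> \<gamma>" and u: "\<And>n. u n \<in> L2" and u0: "(\<lambda>n. L2_norm (u n)) \<longlonglongrightarrow> 0"
  shows "(\<lambda>n. L2_norm (T (X n) (u n))) \<longlonglongrightarrow> 0"
proof (rule ccontr)
  assume "\<not> ?thesis"
  then obtain e where e: "e > 0" "\<not> eventually (\<lambda>n. L2_norm (T (X n) (u n)) < e) sequentially"
    by (auto simp: tendsto_iff dist_norm)
  define \<delta> where "\<delta> = \<gamma> / 2"
  have \<delta>: "\<delta> > 0" using \<gamma> by (simp add: \<delta>_def)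
  have ev: "eventually (\<lambda>n. X n \<in> {\<delta><..<\<gamma> + 1}) sequentially"
    by (rule topological_tendstoD[OF X open_greaterThanLessThan]) (use \<gamma> in \<open>auto simp: \<delta>_def\<close>)
  define A where "A = {n. e \<le> L2_norm (T (X n) (u n)) \<and> X n \<in> {\<delta><..<\<gamma> + 1}}"
  have "infinite A"
  proof
    assume "finite A"
    then have "eventually (\<lambda>n. n \<notin> A) sequentially"
      by (simp add: eventually_sequentially) (metis finite_nat_set_iff_bounded_le not_less_eq_eq)
    with ev have "eventually (\<lambda>n. L2_norm (T (X n) (u n)) < e) sequentially"
      by eventually_elim (auto simp: A_def)
    with e(2) show False by simp
  qed
  \<comment> \<open>Enumerating the bad indices passes to a subsequence along which the lower bound
    \<open>e\<close> holds always, not merely infinitely often.\<close>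
  define r where "r = enumerate A"
  have r: "strict_mono r" "\<And>n. r n \<in> A"
    unfolding r_def using \<open>infinite A\<close> by (auto intro: strict_mono_enumerate enumerate_in_set)
  define Y v where "Y = X \<circ> r" and "v = u \<circ> r"
  have v: "v n \<in> L2" and Y: "\<delta> < Y n" "Y n < \<gamma> + 1" and big: "e \<le> L2_norm (T (Y n) (v n))" for n
    using r(2)[of n] u by (auto simp: A_def Y_def v_def)
  have v0: "(\<lambda>n. L2_norm (v n)) \<longlonglongrightarrow> 0"
    using LIMSEQ_subseq_LIMSEQ[OF u0 r(1)] by (simp add: v_def o_def)
  from semigroup_bound obtain N where
    "\<forall>\<tau>. N \<tau> > 0 \<and> (\<forall>u\<in>L2. \<tau> \<ge> 0 \<longrightarrow> L2_norm (T \<tau> u) \<le> N \<tau> * L2_norm u)" ..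
  then have N: "N \<tau> > 0" "\<tau> \<ge> 0 \<Longrightarrow> u \<in> L2 \<Longrightarrow> L2_norm (T \<tau> u) \<le> N \<tau> * L2_norm u" for \<tau> u by auto
  \<comment> \<open>Truncation at 1 makes the indicator of an interval a dominating function,
    although the operator bounds over that interval may be unbounded.\<close>
  define q where "q = (\<lambda>n r. min 1 (L2_norm (T (max 0 r) (v n))))"
  have q01: "0 \<le> q n r" "q n r \<le> 1" for n r by (auto simp: q_def)
  have qm[measurable]: "q n \<in> borel_measurable borel" for n
    unfolding q_def using semigroup_norm_measurable[OF v, of n] by measurable
  have q_lim: "(\<lambda>n. q n r) \<longlonglongrightarrow> 0" for r
  proof (rule Lim_null_comparison)
    show "eventually (\<lambda>n. norm (q n r) \<le> N (max 0 r) * L2_norm (v n)) sequentially"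
      using N(2)[OF _ v, of "max 0 r"] by (intro always_eventually allI) (auto simp: q_def min_le_iff_disj)
    show "(\<lambda>n. N (max 0 r) * L2_norm (v n)) \<longlonglongrightarrow> 0"
      using tendsto_mult[OF tendsto_const v0] by simp
  qed
  define I where "I = (\<lambda>n. LINT r|lborel. indicator {0..\<gamma> + 1} r * q n r)"
  have ind: "integrable lborel (\<lambda>r. indicator {0..\<gamma> + 1} r :: real)"
    by (simp add: integrable_indicator_iff emeasure_lborel_Icc_eq)
  have qi: "integrable lborel (\<lambda>r. indicator {0..\<gamma> + 1} r * q n r)" for n
    by (rule Bochner_Integration.integrable_bound[OF ind])
       (use q01 in \<open>auto intro!: always_eventually simp: indicator_def\<close>)
  have "I \<longlonglongrightarrow> (LINT r::real|lborel. 0::real)"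
    unfolding I_def
  proof (rule integral_dominated_convergence)
    show "AE r in lborel. (\<lambda>n. indicator {0..\<gamma> + 1} r * q n r) \<longlonglongrightarrow> 0"
      using tendsto_mult[OF tendsto_const q_lim] by (intro always_eventually) auto
    show "AE r in lborel. norm (indicator {0..\<gamma> + 1} r * q n r) \<le> indicator {0..\<gamma> + 1} r" for n
      using q01 by (intro always_eventually) (auto simp: indicator_def)
  qed (use ind in auto)
  then have I0: "I \<longlonglongrightarrow> 0" by simp
  \<comment> \<open>The reflection \<open>t \<mapsto> Y n - t\<close> carries
    \<open>{0..\<delta>}\<close> into \<open>{0..\<gamma> + 1}\<close>, because \<open>Y n\<close>
    lies between \<open>\<delta>\<close> and \<open>\<gamma> + 1\<close>; so the integral of
    \<open>g n\<close> is at most \<open>I n\<close>.\<close>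
  define g where "g = (\<lambda>n t. indicator {0..\<delta>} t * q n (Y n - t))"
  have gm[measurable]: "g n \<in> borel_measurable lborel" for n unfolding g_def by measurable
  have g0: "0 \<le> g n t" for n t using q01 by (auto simp: g_def indicator_def)
  have gi: "integrable lborel (g n)" for n
  proof (rule Bochner_Integration.integrable_bound)
    show "integrable lborel (\<lambda>r. indicator {0..\<delta>} r :: real)" by (simp add: integrable_indicator_iff emeasure_lborel_Icc_eq)
    show "AE t in lborel. norm (g n t) \<le> norm (indicator {0..\<delta>} t :: real)"
      using q01 by (intro always_eventually) (auto simp: indicator_def g_def)
  qed simp
  have gI: "(LINT t|lborel. norm (g n t)) \<le> I n" for n
  proof -
    have "(LINT t|lborel. norm (g n t)) = (LINT t|lborel. g n t)" using g0 by simp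
    also have "\<dots> = (LINT r|lborel. g n (Y n + -1 * r))"
      using lborel_integral_real_affine[of "-1" "g n" "Y n"] by simp
    also have "\<dots> \<le> I n"
      unfolding I_def
    proof (rule integral_mono[OF _ qi])
      show "integrable lborel (\<lambda>r. g n (Y n + -1 * r))"
        using gi[of n] by (subst lborel_integrable_real_affine_iff) auto
      show "g n (Y n + -1 * r) \<le> indicator {0..\<gamma> + 1} r * q n r" for r
        using Y[of n] q01[of n r] \<delta> by (auto simp: g_def indicator_def)
    qed
    finally show ?thesis .
  qed
  have "(\<lambda>n. LINT t|lborel. norm (g n t)) \<longlonglongrightarrow> 0"
    by (rule tendsto_sandwich[OF _ _ tendsto_const I0]) (use gI in auto)
  from tendsto_L1_AE_subseq[OF gi this] obtain r' where
    r': "strict_mono r'" "AE t in lborel. (\<lambda>n. g (r' n) t) \<longlonglongrightarrow> 0" by blast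
  have "\<not> (AE t in lborel. t \<notin> {0..\<delta>})"
  proof
    assume "AE t in lborel. t \<notin> {0..\<delta>}"
    then have "{0..\<delta>} \<in> null_sets lborel" by (simp add: AE_iff_null_sets)
    then show False using \<delta> by (simp add: null_sets_def)
  qed
  moreover have "AE t in lborel. t \<notin> {0..\<delta>}"
    using r'(2)
  proof eventually_elim
    case (elim t)
    show ?case
    proof
      assume t: "t \<in> {0..\<delta>}"
      \<comment> \<open>Splitting time \<open>Y m\<close> into \<open>t\<close> and
        \<open>Y m - t\<close> bounds the second factor from below independently of
        \<open>n\<close>, contradicting almost everywhere convergence of the subsequence to
        0.\<close>
      have "min 1 (e / N t) \<le> g (r' n) t" for n
      proof -
        define m where "m = r' n"
        have s: "Y m - t \<ge> 0" using Y[of m] t by auto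
        have "e \<le> L2_norm (T (t + (Y m - t)) (v m))" using big[of m] by simp
        also have "\<dots> = L2_norm (T t (T (Y m - t) (v m)))"
          using t s v Y[of m] \<delta> by (intro L2_norm_cong_AE semigroup_add semigroup_L2) auto
        also have "\<dots> \<le> N t * L2_norm (T (Y m - t) (v m))" using t s v by (intro N(2) semigroup_L2) auto
        finally have "e / N t \<le> L2_norm (T (Y m - t) (v m))"
          using N(1)[of t] by (simp add: divide_le_eq mult.commute)
        then show ?thesis using t s by (auto simp: g_def q_def m_def max_def)
      qed
      then have "min 1 (e / N t) \<le> 0" using elim by (intro LIMSEQ_le_const) auto
      with e(1) N(1)[of t] show False by (auto simp: min_le_iff_disj divide_le_0_iff)
    qed
  qed
  ultimately show False by simp
qed

text \<open>The increment is \<open>T (s - h)\<close> applied to \<open>u - T h u\<close>. Now the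
  outer operator moves with \<open>h\<close>, which is what \<open>semigroup_tendsto_0\<close> is
  for.\<close>

lemma semigroup_left_continuous:
  assumes s: "s > 0" and u: "u \<in> L2"
  shows "((\<lambda>h. L2_norm (\<lambda>x. T (s - h) u x - T s u x)) \<longlongrightarrow> 0) (at_right 0)"
  unfolding tendsto_at_iff_sequentially
proof (intro allI impI)
  fix X :: "nat \<Rightarrow> real" assume X: "\<forall>i. X i \<in> {0<..} - {0}" "X \<longlonglongrightarrow> 0"
  then have Xp: "X n > 0" for n by auto
  define w where "w = (\<lambda>n x. u x - T (X n) u x)"
  have w: "w n \<in> L2" for n unfolding w_def using u Xp by (auto intro!: L2_diff semigroup_L2 less_imp_le)
  have "filterlim X (at_right 0) sequentially" using X(2) Xp
    by (auto simp: filterlim_at less_le intro!: always_eventually)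
  from filterlim_compose[OF semigroup_tendsto[OF u] this]
  have w0: "(\<lambda>n. L2_norm (w n)) \<longlonglongrightarrow> 0" unfolding w_def by (subst L2_norm_diff_commute)
  have "(\<lambda>n. s - X n) \<longlonglongrightarrow> s - 0" by (intro tendsto_intros X)
  then have lim: "(\<lambda>n. L2_norm (T (s - X n) (w n))) \<longlonglongrightarrow> 0" using s by (intro semigroup_tendsto_0[OF s _ w w0]) simp
  have "eventually (\<lambda>n. X n < s) sequentially" using X(2) s by (rule order_tendstoD(2))
  then have "eventually (\<lambda>n. L2_norm (T (s - X n) (w n)) = L2_norm (\<lambda>x. T (s - X n) u x - T s u x)) sequentially"
  proof eventually_elim
    case (elim n)
    have "L2_norm (T (s - X n) (w n)) = L2_norm (\<lambda>x. T (s - X n) u x - T (s - X n) (T (X n) u) x)"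
      unfolding w_def using elim u Xp[of n] by (intro semigroup_diff_norm[symmetric] semigroup_L2) auto
    also have "\<dots> = L2_norm (\<lambda>x. T (s - X n) u x - T s u x)"
      by (rule L2_norm_cong_AE)
         (use elim u Xp[of n] s semigroup_add[of "s - X n" "X n" u] in \<open>auto intro!: L2_diff semigroup_L2\<close>)
    finally show ?case .
  qed
  from Lim_transform_eventually[OF lim this]
  show "((\<lambda>h. L2_norm (\<lambda>x. T (s - h) u x - T s u x)) \<circ> X) \<longlonglongrightarrow> 0" by (simp add: o_def)
qed

lemma semigroup_continuous:
  assumes s: "s \<ge> 0" and u: "u \<in> L2"
  shows "((\<lambda>r. L2_norm (\<lambda>x. T r u x - T s u x)) \<longlongrightarrow> 0) (at s within {0..})"
proof -
  have r: "((\<lambda>r. L2_norm (\<lambda>x. T r u x - T s u x)) \<longlongrightarrow> 0) (at_right s)"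
    using semigroup_right_continuous[OF s u]
    by (subst at_right_to_0) (simp add: filterlim_filtermap add.commute)
  show ?thesis
  proof (cases "s = 0")
    case True
    with r show ?thesis by (simp add: at_within_Ici_at_right)
  next
    case False
    then have "s > 0" using s by simp
    have "((\<lambda>r. L2_norm (\<lambda>x. T r u x - T s u x)) \<longlongrightarrow> 0) (at_left s)"
    proof -
      have "at_left s = filtermap (\<lambda>h. s - h) (at_right 0)"
        by (subst at_left_minus) (simp add: at_right_to_0[of "-s"] filtermap_filtermap)
      then show ?thesis using semigroup_left_continuous[OF \<open>s > 0\<close> u] by (simp add: filterlim_filtermap)
    qed
    with r have "((\<lambda>r. L2_norm (\<lambda>x. T r u x - T s u x)) \<longlongrightarrow> 0) (at s)" by (simp add: filterlim_split_at)
    then show ?thesis by (rule tendsto_within_subset) simp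
  qed
qed

end

section \<open>Duality for the harmonic oscillator\<close>

context
  fixes H :: "('a::euclidean_space \<Rightarrow> complex) rel"
  assumes H: "harmonic_oscillator H"
begin

lemma harmonic_graph_L2:
  assumes "(u, v) \<in> H"
  shows "u \<in> L2" "v \<in> L2"
  using H assms by (auto simp: harmonic_oscillator_def self_adjoint_def adjoint_graph_def)

lemma harmonic_graph_symmetric:
  assumes "(p, q) \<in> H" "(u, v) \<in> H"
  shows "L2_inner q u = L2_inner p v"
proof -
  have "(u, v) \<in> adjoint_graph H" using H assms(2) by (simp add: harmonic_oscillator_def self_adjoint_def)
  with assms(1) show ?thesis unfolding adjoint_graph_def by blast
qed

lemma schwartz_harmonic_graph: "u \<in> schwartz \<Longrightarrow> (u, harmonic_op u) \<in> H"
  using H by (simp add: harmonic_oscillator_def)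

text \<open>Square integrability of Schwartz functions and of their images under the operator is
  read off from the graph, all of whose pairs lie in \<open>L2\<close>. This is why kernel lemmas
  below carry \<open>H\<close> as a hypothesis.\<close>

lemmas schwartz_L2 = harmonic_graph_L2(1)[OF schwartz_harmonic_graph]
  and harmonic_op_L2 = harmonic_graph_L2(2)[OF schwartz_harmonic_graph]

end

context
  fixes T :: "real \<Rightarrow> ('a::euclidean_space \<Rightarrow> complex) \<Rightarrow> 'a \<Rightarrow> complex"
    and H :: "('a \<Rightarrow> complex) rel"
  assumes H: "harmonic_oscillator H" and TH: "generated_by_minus T H"
begin

lemma T_C0: "C0_semigroup T"
  using TH by (simp add: generated_by_minus_def)

text \<open>Applying \<open>T s\<close> to the difference quotient at time 0 gives the derivative at
  \<open>s\<close>. Read instead as a quotient of \<open>T h\<close> at \<open>T s f\<close>, the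
  same limit shows that the orbit stays in the domain, so that symmetry of \<open>H\<close> is
  available along it.\<close>

lemma semigroup_right_derivative:
  assumes f: "f \<in> schwartz" and s: "s \<ge> 0"
  shows "((\<lambda>h. L2_norm (\<lambda>x. (1 / h) *\<^sub>R (T (s + h) f x - T s f x) - T s (\<lambda>x. - harmonic_op f x) x)) \<longlongrightarrow> 0) (at_right 0)"
    and "(T s f, \<lambda>x. - T s (\<lambda>x. - harmonic_op f x) x) \<in> H"
proof -
  define w where "w = (\<lambda>x. - harmonic_op f x)"
  note f2 = schwartz_L2[OF H f]
  have w2: "w \<in> L2" unfolding w_def by (intro L2_uminus harmonic_op_L2[OF H] f)
  have gen: "generator T = {(u, \<lambda>x. - v x) |u v. (u, v) \<in> H}"
    using TH by (simp add: generated_by_minus_def)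
  have "(f, w) \<in> generator T" unfolding gen w_def using schwartz_harmonic_graph[OF H f] by blast
  then have lim: "((\<lambda>h. L2_norm (\<lambda>x. (1 / h) *\<^sub>R (T h f x - f x) - w x)) \<longlongrightarrow> 0) (at_right 0)"
    by (simp add: generator_def)
  from semigroup_bound[OF T_C0] obtain N where
    "\<forall>\<tau>. N \<tau> > 0 \<and> (\<forall>u\<in>L2. \<tau> \<ge> 0 \<longrightarrow> L2_norm (T \<tau> u) \<le> N \<tau> * L2_norm u)" ..
  then have N: "u \<in> L2 \<Longrightarrow> L2_norm (T s u) \<le> N s * L2_norm u" for u using s by auto
  define D where "D = (\<lambda>h. L2_norm (\<lambda>x. (1 / h) *\<^sub>R (T h f x - f x) - w x))"
  have main: "L2_norm (\<lambda>x. (1 / h) *\<^sub>R (T s (T h f) x - T s f x) - T s w x) \<le> N s * D h" if h: "h > 0" for h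
  proof -
    have Th: "T h f \<in> L2" using h by (intro semigroup_L2[OF T_C0] f2) simp
    have d: "(\<lambda>x. T h f x - f x) \<in> L2" by (intro L2_diff Th f2)
    have ds: "(\<lambda>x. (1 / h) *\<^sub>R (T h f x - f x)) \<in> L2" by (intro L2_scaleR d)
    have "AE x in lborel. T s (\<lambda>x. (1 / h) *\<^sub>R (T h f x - f x) - w x) x = (1 / h) *\<^sub>R (T s (T h f) x - T s f x) - T s w x"
      using semigroup_diff[OF T_C0 s ds w2] semigroup_scaleR[OF T_C0 s d, of "1 / h"] semigroup_diff[OF T_C0 s Th f2]
      by eventually_elim simp
    then have "L2_norm (\<lambda>x. (1 / h) *\<^sub>R (T s (T h f) x - T s f x) - T s w x)
        = L2_norm (T s (\<lambda>x. (1 / h) *\<^sub>R (T h f x - f x) - w x))"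
      by (intro L2_norm_cong_AE L2_diff L2_scaleR semigroup_L2[OF T_C0] Th f2 w2 s) (auto elim: eventually_mono)
    also have "\<dots> \<le> N s * D h" unfolding D_def by (intro N L2_diff ds w2)
    finally show ?thesis .
  qed
  have ND: "((\<lambda>h. N s * D h) \<longlongrightarrow> 0) (at_right 0)"
    using tendsto_mult[OF tendsto_const lim, of "N s"] by (simp add: D_def)
  have add_eq: "L2_norm (\<lambda>x. (1 / h) *\<^sub>R (T (s + h) f x - T s f x) - T s w x)
      = L2_norm (\<lambda>x. (1 / h) *\<^sub>R (T s (T h f) x - T s f x) - T s w x)"
    and add_eq': "L2_norm (\<lambda>x. (1 / h) *\<^sub>R (T h (T s f) x - T s f x) - T s w x)
      = L2_norm (\<lambda>x. (1 / h) *\<^sub>R (T s (T h f) x - T s f x) - T s w x)" if h: "h > 0" for h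
  proof -
    have L: "T s f \<in> L2" "T s w \<in> L2" "T (s + h) f \<in> L2" "T s (T h f) \<in> L2" "T h (T s f) \<in> L2"
      using h s f2 w2 by (auto intro!: semigroup_L2[OF T_C0])
    have 1: "AE x in lborel. T (s + h) f x = T s (T h f) x" using s h by (intro semigroup_add[OF T_C0] f2) auto
    have "AE x in lborel. T (h + s) f x = T h (T s f) x" using s h by (intro semigroup_add[OF T_C0] f2) auto
    then have 2: "AE x in lborel. T (s + h) f x = T h (T s f) x" by (simp add: add.commute)
    show "L2_norm (\<lambda>x. (1 / h) *\<^sub>R (T (s + h) f x - T s f x) - T s w x)
        = L2_norm (\<lambda>x. (1 / h) *\<^sub>R (T s (T h f) x - T s f x) - T s w x)"
      by (intro L2_norm_cong_AE L2_diff L2_scaleR L eventually_mono[OF 1]) simp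
    have "AE x in lborel. T h (T s f) x = T s (T h f) x" using 1 2 by eventually_elim simp
    from eventually_mono[OF this]
    show "L2_norm (\<lambda>x. (1 / h) *\<^sub>R (T h (T s f) x - T s f x) - T s w x)
        = L2_norm (\<lambda>x. (1 / h) *\<^sub>R (T s (T h f) x - T s f x) - T s w x)"
      by (intro L2_norm_cong_AE L2_diff L2_scaleR L) simp
  qed
  have pos: "eventually (\<lambda>h::real. h > 0) (at_right 0)" by (rule eventually_at_right_less)
  show "((\<lambda>h. L2_norm (\<lambda>x. (1 / h) *\<^sub>R (T (s + h) f x - T s f x) - T s (\<lambda>x. - harmonic_op f x) x)) \<longlongrightarrow> 0) (at_right 0)"
    unfolding w_def[symmetric]
    by (rule Lim_null_comparison[OF eventually_mono[OF pos] ND]) (simp add: add_eq main)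
  have "((\<lambda>h. L2_norm (\<lambda>x. (1 / h) *\<^sub>R (T h (T s f) x - T s f x) - T s w x)) \<longlongrightarrow> 0) (at_right 0)"
    by (rule Lim_null_comparison[OF eventually_mono[OF pos] ND]) (simp add: add_eq' main)
  then have "(T s f, T s w) \<in> generator T"
    unfolding generator_def using s f2 w2 by (auto intro: semigroup_L2[OF T_C0])
  then obtain v where "(T s f, v) \<in> H" "T s w = (\<lambda>x. - v x)" unfolding gen by auto
  then show "(T s f, \<lambda>x. - T s (\<lambda>x. - harmonic_op f x) x) \<in> H"
    unfolding w_def[symmetric] by simp
qed

text \<open>\<open>\<kappa>\<close> evolves with the opposite sign, so by symmetry of the graph the
  two halves of the product rule for \<open>L2_inner (\<kappa> s) (T s f)\<close> cancel, and the
  pairing is constant.\<close>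

lemma semigroup_duality:
  fixes \<kappa> :: "real \<Rightarrow> 'a \<Rightarrow> complex"
  assumes f: "f \<in> schwartz" and \<tau>: "\<tau> \<ge> 0"
    and \<kappa>: "\<And>s. 0 \<le> s \<Longrightarrow> s \<le> \<tau> \<Longrightarrow> \<kappa> s \<in> schwartz"
    and cont: "\<And>s. 0 \<le> s \<Longrightarrow> s \<le> \<tau> \<Longrightarrow> ((\<lambda>r. L2_norm (\<lambda>y. \<kappa> r y - \<kappa> s y)) \<longlongrightarrow> 0) (at s within {0..\<tau>})"
    and deriv: "\<And>s. 0 \<le> s \<Longrightarrow> s < \<tau> \<Longrightarrow>
      ((\<lambda>h. L2_norm (\<lambda>y. (1 / h) *\<^sub>R (\<kappa> (s + h) y - \<kappa> s y) - harmonic_op (\<kappa> s) y)) \<longlongrightarrow> 0) (at_right 0)"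
  shows "L2_inner (\<kappa> \<tau>) (T \<tau> f) = L2_inner (\<kappa> 0) f"
proof -
  define w where "w = (\<lambda>x. - harmonic_op f x)"
  note f2 = schwartz_L2[OF H f] and w2 = L2_uminus[OF harmonic_op_L2[OF H f], folded w_def]
  define \<psi> where "\<psi> = (\<lambda>s. L2_inner (\<kappa> s) (T s f))"
  have \<kappa>2: "\<kappa> s \<in> L2" if "0 \<le> s" "s \<le> \<tau>" for s by (intro schwartz_L2[OF H] \<kappa> that)
  have U2: "T s f \<in> L2" "T s w \<in> L2" if "0 \<le> s" for s by (intro semigroup_L2[OF T_C0] f2 w2 that)+
  have "\<psi> \<tau> = \<psi> 0"
  proof (rule right_derivative_zero_constant[OF \<tau>])
    show "continuous_on {0..\<tau>} \<psi>"
      unfolding continuous_on_def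
    proof
      fix s assume s: "s \<in> {0..\<tau>}"
      have "((\<lambda>r. L2_norm (\<lambda>x. T r f x - T s f x)) \<longlongrightarrow> 0) (at s within {0..\<tau>})"
        using s by (intro tendsto_within_subset[OF semigroup_continuous[OF T_C0 _ f2]]) auto
      moreover have "eventually (\<lambda>r. r \<in> {0..\<tau>}) (at s within {0..\<tau>})" by (simp add: eventually_at_filter)
      then have "eventually (\<lambda>r. \<kappa> r \<in> L2) (at s within {0..\<tau>})" "eventually (\<lambda>r. T r f \<in> L2) (at s within {0..\<tau>})"
        by (auto elim!: eventually_mono intro: \<kappa>2 U2)
      ultimately show "(\<psi> \<longlongrightarrow> \<psi> s) (at s within {0..\<tau>})"
        unfolding \<psi>_def using s cont[of s] by (intro tendsto_L2_inner \<kappa>2 U2) auto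
    qed
  next
    fix s assume s: "0 \<le> s" "s < \<tau>"
    define p where "p = (\<lambda>h y. (1 / h) *\<^sub>R (\<kappa> (s + h) y - \<kappa> s y))"
    define d where "d = (\<lambda>h y. (1 / h) *\<^sub>R (T (s + h) f y - T s f y))"
    have ev: "eventually (\<lambda>h. h \<in> {0<..<\<tau> - s}) (at_right 0)" using s by (intro eventually_at_right_real) simp
    have p2: "p h \<in> L2" and d2: "d h \<in> L2" if "h \<in> {0<..<\<tau> - s}" for h
      unfolding p_def d_def using that s by (auto intro!: L2_scaleR L2_diff \<kappa>2 U2)
    have Lk: "harmonic_op (\<kappa> s) \<in> L2" using s by (intro harmonic_op_L2[OF H] \<kappa>) auto
    have "((\<lambda>h. L2_inner (p h) (T (s + h) f)) \<longlongrightarrow> L2_inner (harmonic_op (\<kappa> s)) (T s f)) (at_right 0)"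
    proof (rule tendsto_L2_inner)
      show "eventually (\<lambda>h. p h \<in> L2) (at_right 0)" "eventually (\<lambda>h. T (s + h) f \<in> L2) (at_right 0)"
        using ev s by (auto elim!: eventually_mono intro!: p2 U2)
      show "((\<lambda>h. L2_norm (\<lambda>x. p h x - harmonic_op (\<kappa> s) x)) \<longlongrightarrow> 0) (at_right 0)"
        unfolding p_def using s by (rule deriv)
      show "((\<lambda>h. L2_norm (\<lambda>x. T (s + h) f x - T s f x)) \<longlongrightarrow> 0) (at_right 0)"
        using s(1) f2 by (rule semigroup_right_continuous[OF T_C0])
    qed (use Lk U2 s in auto)
    moreover have "((\<lambda>h. L2_inner (\<kappa> s) (d h)) \<longlongrightarrow> L2_inner (\<kappa> s) (T s w)) (at_right 0)"
    proof (rule tendsto_L2_inner)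
      show "eventually (\<lambda>h. \<kappa> s \<in> L2) (at_right (0::real))" using \<kappa>2 s by simp
      show "eventually (\<lambda>h. d h \<in> L2) (at_right 0)" using ev by (auto elim!: eventually_mono intro!: d2)
      show "((\<lambda>h. L2_norm (\<lambda>x. d h x - T s w x)) \<longlongrightarrow> 0) (at_right 0)"
        unfolding d_def w_def by (rule semigroup_right_derivative(1)[OF f s(1)])
      show "((\<lambda>h. L2_norm (\<lambda>x. \<kappa> s x - \<kappa> s x)) \<longlongrightarrow> 0) (at_right (0::real))"
        by (simp add: L2_norm_def)
    qed (use \<kappa>2 U2 s in auto)
    ultimately have "((\<lambda>h. L2_inner (p h) (T (s + h) f) + L2_inner (\<kappa> s) (d h)) \<longlongrightarrow>
        L2_inner (harmonic_op (\<kappa> s)) (T s f) + L2_inner (\<kappa> s) (T s w)) (at_right 0)"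
      by (rule tendsto_add)
    moreover have "L2_inner (harmonic_op (\<kappa> s)) (T s f) = L2_inner (\<kappa> s) (\<lambda>x. - T s w x)"
      using harmonic_graph_symmetric[OF H schwartz_harmonic_graph[OF H \<kappa>] semigroup_right_derivative(2)[OF f s(1)], of s] s
      by (simp add: w_def)
    moreover have "L2_inner (\<kappa> s) (\<lambda>x. - T s w x) = - L2_inner (\<kappa> s) (T s w)" by (simp add: L2_inner_def)
    ultimately have "((\<lambda>h. L2_inner (p h) (T (s + h) f) + L2_inner (\<kappa> s) (d h)) \<longlongrightarrow> 0) (at_right 0)" by simp
    \<comment> \<open>The discrete product rule: the increment of \<open>\<kappa>\<close> is paired
      with the orbit at the later time \<open>s + h\<close>, the increment of the orbit with
      \<open>\<kappa> s\<close>.\<close>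
    moreover have "eventually (\<lambda>h. L2_inner (p h) (T (s + h) f) + L2_inner (\<kappa> s) (d h) = (1 / h) *\<^sub>R (\<psi> (s + h) - \<psi> s)) (at_right 0)"
      using ev
    proof eventually_elim
      case (elim h)
      then have m: "\<kappa> (s + h) \<in> L2" "\<kappa> s \<in> L2" "T (s + h) f \<in> L2" "T s f \<in> L2" using s by (auto intro!: \<kappa>2 U2)
      show ?case
        unfolding p_def d_def L2_inner_scaleR_left L2_inner_scaleR_right \<psi>_def
        using m by (simp add: L2_inner_diff_left L2_inner_diff_right algebra_simps)
    qed
    ultimately show "((\<lambda>h. (1 / h) *\<^sub>R (\<psi> (s + h) - \<psi> s)) \<longlongrightarrow> 0) (at_right 0)"
      by (rule Lim_transform_eventually)
  qed
  moreover have "L2_inner (\<kappa> 0) (T 0 f) = L2_inner (\<kappa> 0) f"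
    using \<tau> by (intro L2_inner_cong_AE_right semigroup_zero[OF T_C0] f2 U2 \<kappa>2) auto
  ultimately show ?thesis by (simp add: \<psi>_def)
qed

end

section \<open>Gaussians as Schwartz functions\<close>

text \<open>By the sum and Leibniz rules, closure under partial derivatives needs checking on
  generators only. Polynomials arise from \<open>coordinates\<close>; the Mehler average uses a
  larger generating set.\<close>

inductive_set function_algebra :: "('a \<Rightarrow> complex) set \<Rightarrow> ('a \<Rightarrow> complex) set" for G where
  generator: "g \<in> G \<Longrightarrow> g \<in> function_algebra G"
| const: "(\<lambda>_. c) \<in> function_algebra G"
| add: "f \<in> function_algebra G \<Longrightarrow> g \<in> function_algebra G \<Longrightarrow> (\<lambda>x. f x + g x) \<in> function_algebra G"
| mult: "f \<in> function_algebra G \<Longrightarrow> g \<in> function_algebra G \<Longrightarrow> (\<lambda>x. f x * g x) \<in> function_algebra G"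

lemma partial_deriv_const: "partial_deriv b (\<lambda>_. c) = (\<lambda>_. 0)"
  by (rule ext, rule trans[OF partial_derivI[OF has_derivative_const]]) simp

lemma
  assumes "f differentiable (at x)" "g differentiable (at x)"
  shows partial_deriv_add: "partial_deriv b (\<lambda>x. f x + g x) x = partial_deriv b f x + partial_deriv b g x"
    and partial_deriv_mult: "partial_deriv b (\<lambda>x. f x * g x) x = partial_deriv b f x * g x + f x * partial_deriv b g x"
proof -
  from assms obtain D E where D: "(f has_derivative D) (at x)" and E: "(g has_derivative E) (at x)"
    by (auto simp: differentiable_def)
  show "partial_deriv b (\<lambda>x. f x + g x) x = partial_deriv b f x + partial_deriv b g x"
    using partial_derivI[OF has_derivative_add[OF D E]] partial_derivI[OF D] partial_derivI[OF E] by simp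
  show "partial_deriv b (\<lambda>x. f x * g x) x = partial_deriv b f x * g x + f x * partial_deriv b g x"
    using partial_derivI[OF has_derivative_mult[OF D E]] partial_derivI[OF D] partial_derivI[OF E] by simp
qed

lemma function_algebra_differentiable:
  assumes "f \<in> function_algebra G" and "\<And>g x. g \<in> G \<Longrightarrow> g differentiable (at x)"
  shows "f differentiable (at x)"
  using assms by (induction rule: function_algebra.induct) auto

lemma function_algebra_partial_deriv:
  assumes f: "f \<in> function_algebra G" and G: "\<And>g x. g \<in> G \<Longrightarrow> g differentiable (at x)"
    and "\<And>g. g \<in> G \<Longrightarrow> partial_deriv b g \<in> function_algebra G"
  shows "partial_deriv b f \<in> function_algebra G"
  using f
proof (induction rule: function_algebra.induct)
  case (add f g)
  then have "partial_deriv b (\<lambda>x. f x + g x) = (\<lambda>x. partial_deriv b f x + partial_deriv b g x)"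
    by (intro ext partial_deriv_add function_algebra_differentiable[OF _ G])
  with add show ?case by (simp add: function_algebra.add)
next
  case (mult f g)
  then have "partial_deriv b (\<lambda>x. f x * g x) = (\<lambda>x. partial_deriv b f x * g x + f x * partial_deriv b g x)"
    by (intro ext partial_deriv_mult function_algebra_differentiable[OF _ G])
  with mult show ?case by (simp add: function_algebra.add function_algebra.mult)
qed (auto simp: assms partial_deriv_const intro: function_algebra.const)

lemma function_algebra_smooth:
  assumes "f \<in> function_algebra G" and "\<And>g x. g \<in> G \<Longrightarrow> g differentiable (at x)"
    and "\<And>g b. g \<in> G \<Longrightarrow> b \<in> Basis \<Longrightarrow> partial_deriv b g \<in> function_algebra G"
  shows "smooth f"
  by (rule smooth_coinduct[where F = "function_algebra G"])
     (use assms in \<open>auto intro: function_algebra_differentiable function_algebra_partial_deriv\<close>)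

section \<open>Polynomials and Gaussian bounds\<close>

definition coordinates :: "('a::euclidean_space \<Rightarrow> complex) set" where
  "coordinates = {\<lambda>y. of_real (y \<bullet> b) |b. b \<in> Basis}"

lemma coordinate_has_derivative:
  "((\<lambda>y. complex_of_real (y \<bullet> b)) has_derivative (\<lambda>h. of_real (h \<bullet> b))) (at x)"
  by (auto intro!: derivative_eq_intros)

lemma coordinates_differentiable: "g \<in> coordinates \<Longrightarrow> g differentiable (at x)"
  unfolding coordinates_def differentiable_def using coordinate_has_derivative by blast

lemma coordinates_partial_deriv: "g \<in> coordinates \<Longrightarrow> partial_deriv b g \<in> function_algebra G"
  by (auto simp: coordinates_def partial_derivI[OF coordinate_has_derivative, abs_def] intro: function_algebra.const)

lemma polynomial_growth:
  assumes "q \<in> function_algebra coordinates"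
  shows "\<exists>C k. C \<ge> 0 \<and> (\<forall>y. norm (q y) \<le> C * (1 + norm y) ^ k)"
  using assms
proof (induction rule: function_algebra.induct)
  case (generator g)
  then obtain b where b: "b \<in> Basis" "g = (\<lambda>y. of_real (y \<bullet> b))" by (auto simp: coordinates_def)
  have "norm (g y) \<le> 1 * (1 + norm y) ^ 1" for y using Basis_le_norm[OF b(1), of y] by (simp add: b(2))
  then show ?case by (intro exI[of _ 1] exI[of _ "1::nat"]) auto
next
  case (const c)
  show ?case by (intro exI[of _ "norm c"] exI[of _ 0]) auto
next
  case (add f g)
  then obtain C k D l where CD: "C \<ge> 0" "\<And>y. norm (f y) \<le> C * (1 + norm y) ^ k"
    "D \<ge> 0" "\<And>y. norm (g y) \<le> D * (1 + norm y) ^ l" by blast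
  have "norm (f y + g y) \<le> (C + D) * (1 + norm y) ^ (k + l)" for y
  proof -
    have "norm (f y + g y) \<le> C * (1 + norm y) ^ k + D * (1 + norm y) ^ l"
      using CD by (intro order_trans[OF norm_triangle_ineq] add_mono)
    also have "\<dots> \<le> C * (1 + norm y) ^ (k + l) + D * (1 + norm y) ^ (k + l)"
      using CD by (intro add_mono mult_left_mono power_increasing) auto
    finally show ?thesis by (simp add: distrib_right)
  qed
  then show ?case using CD by (intro exI[of _ "C + D"] exI[of _ "k + l"]) auto
next
  case (mult f g)
  then obtain C k D l where CD: "C \<ge> 0" "\<And>y. norm (f y) \<le> C * (1 + norm y) ^ k"
    "D \<ge> 0" "\<And>y. norm (g y) \<le> D * (1 + norm y) ^ l" by blast
  have "norm (f y * g y) \<le> (C * D) * (1 + norm y) ^ (k + l)" for y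
    using mult_mono[OF CD(2,4), of y y] CD by (simp add: norm_mult power_add mult_ac)
  then show ?case using CD by (intro exI[of _ "C * D"] exI[of _ "k + l"]) auto
qed

text \<open>Half of the quadratic decay pays for everything else: a quarter of it for the polynomial
  and a quarter for the linear exponent, up to a constant.\<close>

lemma polynomial_times_gaussian_bound:
  fixes c v :: real
  assumes c: "c > 0"
  obtains M where "M > 0" "\<And>r. r \<ge> 0 \<Longrightarrow> (1 + r) ^ m * exp (v * r - c * r\<^sup>2) \<le> M * exp (- (c / 2) * r\<^sup>2)"
proof -
  \<comment> \<open>The rate \<open>c / 8\<close> is chosen for \<open>1 + r\<close>: since
    \<open>(1 + r)^2 \<le> 2 + 2 * r^2\<close>, it costs \<open>c / 4\<close> in terms of
    \<open>r^2\<close>.\<close>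
  obtain C where C: "C > 0" "\<And>r::real. r \<ge> 0 \<Longrightarrow> r ^ m \<le> C * exp (c / 8 * r\<^sup>2)"
    by (rule power_le_exp_square[of "c / 8"]) (use c in auto)
  have "(1 + r) ^ m * exp (v * r - c * r\<^sup>2) \<le> C * exp (c / 4 + v\<^sup>2 / c) * exp (- (c / 2) * r\<^sup>2)" if r: "r \<ge> 0" for r
  proof -
    have "0 \<le> (1 - r)\<^sup>2" by simp
    then have 1: "(1 + r)\<^sup>2 \<le> 2 + 2 * r\<^sup>2" by (simp add: power2_eq_square algebra_simps)
    have "0 \<le> (c * r / 2 - v)\<^sup>2 / c" using c by simp
    also have "\<dots> = c / 4 * r\<^sup>2 - v * r + v\<^sup>2 / c" using c by (simp add: power2_eq_square field_simps)
    finally have 2: "v * r \<le> c / 4 * r\<^sup>2 + v\<^sup>2 / c" by simp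
    have 3: "c / 8 * (1 + r)\<^sup>2 \<le> c / 8 * (2 + 2 * r\<^sup>2)" using c 1 by (intro mult_left_mono) auto
    have "(1 + r) ^ m * exp (v * r - c * r\<^sup>2) \<le> (C * exp (c / 8 * (1 + r)\<^sup>2)) * exp (v * r - c * r\<^sup>2)"
      using C(2)[of "1 + r"] r by (intro mult_right_mono) auto
    also have "\<dots> = C * exp (c / 8 * (1 + r)\<^sup>2 + (v * r - c * r\<^sup>2))" by (simp add: exp_add)
    also have "\<dots> \<le> C * exp ((c / 4 + v\<^sup>2 / c) + - (c / 2) * r\<^sup>2)"
      using C(1) 2 3 by (intro mult_left_mono) (auto simp: algebra_simps)
    finally show ?thesis by (simp only: exp_add mult.assoc)
  qed
  then show ?thesis using C(1) by (intro that[of "C * exp (c / 4 + v\<^sup>2 / c)"]) auto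
qed

definition gaussian :: "real \<Rightarrow> 'a::euclidean_space \<Rightarrow> real \<Rightarrow> 'a \<Rightarrow> real" where
  "gaussian a v c y = exp (a + v \<bullet> y - c * (norm y)\<^sup>2)"

lemma gaussian_nonneg [simp]: "gaussian a v c y \<ge> 0"
  by (simp add: gaussian_def)

lemma gaussian_has_derivative:
  "((\<lambda>y. complex_of_real (gaussian a v c y)) has_derivative
    (\<lambda>h. of_real ((v \<bullet> h - 2 * c * (x \<bullet> h)) * gaussian a v c x))) (at x)"
  unfolding gaussian_def power2_norm_eq_inner
  by (auto intro!: derivative_eq_intros simp: inner_commute algebra_simps)

lemma gaussian_differentiable: "(\<lambda>y. complex_of_real (gaussian a v c y)) differentiable (at x)"
  unfolding differentiable_def by (rule exI) (rule gaussian_has_derivative)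

lemma partial_deriv_gaussian:
  "partial_deriv b (\<lambda>y. complex_of_real (gaussian a v c y)) = (\<lambda>y. of_real (v \<bullet> b - 2 * c * (y \<bullet> b)) * of_real (gaussian a v c y))"
  by (rule ext) (simp add: partial_derivI[OF gaussian_has_derivative])

lemma affine_in_function_algebra:
  assumes "b \<in> Basis"
  shows "(\<lambda>y. complex_of_real (d + e * (y \<bullet> b))) \<in> function_algebra coordinates"
proof -
  have "(\<lambda>y. of_real d + of_real e * complex_of_real (y \<bullet> b)) \<in> function_algebra coordinates"
    using assms by (intro function_algebra.intros) (auto simp: coordinates_def)
  then show ?thesis by simp
qed

text \<open>Each derivative replaces the polynomial factor \<open>q\<close> by its derivative plus
  \<open>q\<close> times an affine function, which is again a polynomial.\<close>

lemma iterated_partial_gaussian: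
  assumes "bs \<in> lists Basis"
  shows "\<exists>q\<in>function_algebra coordinates. iterated_partial bs (\<lambda>y. complex_of_real (gaussian a v c y))
    = (\<lambda>y. q y * of_real (gaussian a v c y))"
  using assms
proof (induction bs)
  case Nil
  show ?case by (intro bexI[of _ "\<lambda>_. 1"]) (auto intro: function_algebra.const)
next
  case (Cons b bs)
  let ?g = "\<lambda>y. complex_of_real (gaussian a v c y)"
  from Cons have b: "b \<in> Basis" by simp
  from Cons obtain q where q: "q \<in> function_algebra coordinates" "iterated_partial bs ?g = (\<lambda>y. q y * ?g y)" by auto
  let ?q = "\<lambda>y. partial_deriv b q y + q y * complex_of_real (v \<bullet> b + (- 2 * c) * (y \<bullet> b))"
  have "partial_deriv b (\<lambda>y. q y * ?g y) = (\<lambda>y. ?q y * ?g y)"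
    by (rule ext, subst partial_deriv_mult[OF function_algebra_differentiable[OF q(1) coordinates_differentiable] gaussian_differentiable])
       (simp_all add: partial_deriv_gaussian algebra_simps)
  moreover have "partial_deriv b q \<in> function_algebra coordinates"
    using q(1) coordinates_differentiable coordinates_partial_deriv by (rule function_algebra_partial_deriv)
  then have "?q \<in> function_algebra coordinates"
    by (intro function_algebra.add function_algebra.mult[OF q(1)] affine_in_function_algebra b)
  ultimately show ?case using q(2) by (intro bexI[of _ ?q]) simp_all
qed

lemma gaussian_schwartz:
  assumes c: "c > 0"
  shows "(\<lambda>y. complex_of_real (gaussian a v c y)) \<in> schwartz"
  unfolding schwartz_def
proof (intro CollectI conjI allI ballI)
  let ?g = "\<lambda>y. complex_of_real (gaussian a v c y)"
  show "smooth ?g"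
    unfolding smooth_def differentiable_on_def
  proof (intro ballI)
    fix bs :: "'a list" and x :: 'a assume "bs \<in> lists Basis"
    then obtain q where q: "q \<in> function_algebra coordinates" "iterated_partial bs ?g = (\<lambda>y. q y * ?g y)"
      using iterated_partial_gaussian by blast
    show "iterated_partial bs ?g differentiable (at x)"
      unfolding q(2) by (intro differentiable_mult gaussian_differentiable
          function_algebra_differentiable[OF q(1) coordinates_differentiable])
  qed
  fix k :: nat and bs :: "'a list" assume "bs \<in> lists Basis"
  then obtain q where q: "q \<in> function_algebra coordinates" "iterated_partial bs ?g = (\<lambda>y. q y * ?g y)"
    using iterated_partial_gaussian by blast
  from polynomial_growth[OF q(1)] obtain C m where C: "C \<ge> 0" "\<And>y. norm (q y) \<le> C * (1 + norm y) ^ m" by blast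
  obtain M where M: "M > 0" "\<And>r. r \<ge> 0 \<Longrightarrow> (1 + r) ^ (k + m) * exp (norm v * r - c * r\<^sup>2) \<le> M * exp (- (c / 2) * r\<^sup>2)"
    by (rule polynomial_times_gaussian_bound[OF c, of "k + m" "norm v"]) blast
  have "norm (norm y ^ k *\<^sub>R iterated_partial bs ?g y) \<le> C * exp a * M" for y
  proof -
    have g: "gaussian a v c y \<le> exp a * exp (norm v * norm y - c * (norm y)\<^sup>2)"
      using norm_cauchy_schwarz[of v y] by (simp add: gaussian_def exp_add[symmetric])
    have "norm (norm y ^ k *\<^sub>R iterated_partial bs ?g y) = norm y ^ k * (norm (q y) * gaussian a v c y)"
      unfolding q(2) by (simp add: norm_mult)
    also have "\<dots> \<le> (1 + norm y) ^ k * ((C * (1 + norm y) ^ m) * (exp a * exp (norm v * norm y - c * (norm y)\<^sup>2)))"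
      using C g by (intro mult_mono power_mono) (auto simp: gaussian_def)
    also have "\<dots> = C * exp a * ((1 + norm y) ^ (k + m) * exp (norm v * norm y - c * (norm y)\<^sup>2))"
      by (simp add: power_add mult_ac)
    also have "\<dots> \<le> C * exp a * M"
    proof (intro mult_left_mono)
      have "M * exp (- (c / 2) * (norm y)\<^sup>2) \<le> M * 1" using M(1) c by (intro mult_left_mono) auto
      with M(2)[of "norm y"] show "(1 + norm y) ^ (k + m) * exp (norm v * norm y - c * (norm y)\<^sup>2) \<le> M" by simp
    qed (use C in auto)
    finally show ?thesis .
  qed
  then show "bounded (range (\<lambda>p. norm p ^ k *\<^sub>R iterated_partial bs ?g p))" by (auto simp: bounded_iff)
qed

text \<open>The image is a quadratic polynomial times the same Gaussian. Comparing its coefficients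
  with the derivatives of time-dependent parameters reduces the evolution equation to three scalar
  ones.\<close>

lemma harmonic_op_gaussian:
  "harmonic_op (\<lambda>y. complex_of_real (gaussian a v c y)) y = of_real
    ((- (norm v)\<^sup>2 + 2 * c * real DIM('a) + 4 * c * (v \<bullet> y) + (1 - 4 * c\<^sup>2) * (norm y)\<^sup>2) * gaussian a (v::'a::euclidean_space) c y)"
proof -
  let ?g = "\<lambda>y. complex_of_real (gaussian a v c y)"
  have pd2: "partial_deriv b (partial_deriv b ?g) y = of_real (((v \<bullet> b - 2 * c * (y \<bullet> b))\<^sup>2 - 2 * c) * gaussian a v c y)"
    if b: "b \<in> Basis" for b
  proof -
    have "((\<lambda>y. complex_of_real (v \<bullet> b - 2 * c * (y \<bullet> b))) has_derivative (\<lambda>h. of_real (- 2 * c * (h \<bullet> b)))) (at y)"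
      by (auto intro!: derivative_eq_intros)
    from partial_derivI[OF has_derivative_mult[OF this gaussian_has_derivative], of b a v c] b
    show ?thesis unfolding partial_deriv_gaussian by (simp add: power2_eq_square algebra_simps)
  qed
  have s: "(\<Sum>b\<in>Basis. (u \<bullet> b) * (w \<bullet> b)) = u \<bullet> w" for u w :: 'a by (rule euclidean_inner[symmetric])
  have "(\<Sum>b\<in>Basis. (v \<bullet> b - 2 * c * (y \<bullet> b))\<^sup>2 - 2 * c)
      = (\<Sum>b\<in>Basis. (v \<bullet> b) * (v \<bullet> b) - (4 * c) * ((v \<bullet> b) * (y \<bullet> b)) + (4 * c\<^sup>2) * ((y \<bullet> b) * (y \<bullet> b)) - 2 * c)"
    by (intro sum.cong) (auto simp: power2_eq_square algebra_simps)
  also have "\<dots> = (norm v)\<^sup>2 - 4 * c * (v \<bullet> y) + 4 * c\<^sup>2 * (norm y)\<^sup>2 - 2 * c * real DIM('a)"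
    by (simp only: sum.distrib sum_subtractf sum_distrib_left[symmetric] s) (simp add: power2_norm_eq_inner)
  finally have sum: "(\<Sum>b\<in>Basis. (v \<bullet> b - 2 * c * (y \<bullet> b))\<^sup>2 - 2 * c)
      = (norm v)\<^sup>2 - 4 * c * (v \<bullet> y) + 4 * c\<^sup>2 * (norm y)\<^sup>2 - 2 * c * real DIM('a)" .
  have "laplacian ?g y = of_real ((\<Sum>b\<in>Basis. (v \<bullet> b - 2 * c * (y \<bullet> b))\<^sup>2 - 2 * c) * gaussian a v c y)"
    by (simp add: laplacian_def pd2 sum_distrib_right)
  then show ?thesis unfolding sum harmonic_op_def by (simp add: scaleR_conv_of_real algebra_simps)
qed

section \<open>The Mehler kernel\<close>

text \<open>The pointwise derivative in \<open>\<sigma>\<close> is upgraded to one in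
  \<open>L2\<close>: on a neighbourhood both the derivative and, by the mean value theorem, the
  quotients lie below one fixed Gaussian, so dominated convergence applies to the squared
  difference.\<close>

lemma gaussian_family_L2_derivative:
  fixes x :: "'a::euclidean_space" and A B C A' B' C' :: "real \<Rightarrow> real"
  assumes \<sigma>0: "l < \<sigma>0" "\<sigma>0 < u" and c: "c > 0" "\<And>\<sigma>. \<sigma> \<in> {l..u} \<Longrightarrow> C \<sigma> \<ge> c"
    and A: "\<And>\<sigma>. \<sigma> \<in> {l..u} \<Longrightarrow> (A has_real_derivative A' \<sigma>) (at \<sigma>)"
    and B: "\<And>\<sigma>. \<sigma> \<in> {l..u} \<Longrightarrow> (B has_real_derivative B' \<sigma>) (at \<sigma>)"
    and C: "\<And>\<sigma>. \<sigma> \<in> {l..u} \<Longrightarrow> (C has_real_derivative C' \<sigma>) (at \<sigma>)"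
    and K: "\<And>\<sigma>. \<sigma> \<in> {l..u} \<Longrightarrow> \<bar>A \<sigma>\<bar> \<le> K \<and> \<bar>B \<sigma>\<bar> \<le> K \<and> \<bar>A' \<sigma>\<bar> \<le> K \<and> \<bar>B' \<sigma>\<bar> \<le> K \<and> \<bar>C' \<sigma>\<bar> \<le> K"
  shows "((\<lambda>\<sigma>. L2_norm (\<lambda>y. (1 / (\<sigma> - \<sigma>0)) *\<^sub>R (complex_of_real (gaussian (A \<sigma>) (B \<sigma> *\<^sub>R x) (C \<sigma>) y)
        - complex_of_real (gaussian (A \<sigma>0) (B \<sigma>0 *\<^sub>R x) (C \<sigma>0) y))
      - complex_of_real ((A' \<sigma>0 + B' \<sigma>0 * (x \<bullet> y) - C' \<sigma>0 * (norm y)\<^sup>2) * gaussian (A \<sigma>0) (B \<sigma>0 *\<^sub>R x) (C \<sigma>0) y)))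
    \<longlongrightarrow> 0) (at \<sigma>0)"
proof -
  define G where "G = (\<lambda>\<sigma> y. gaussian (A \<sigma>) (B \<sigma> *\<^sub>R x) (C \<sigma>) y)"
  define G' where "G' = (\<lambda>\<sigma> y. (A' \<sigma> + B' \<sigma> * (x \<bullet> y) - C' \<sigma> * (norm y)\<^sup>2) * G \<sigma> y)"
  define Q where "Q = (\<lambda>\<sigma> y. (G \<sigma> y - G \<sigma>0 y) / (\<sigma> - \<sigma>0))"
  have \<sigma>0i: "\<sigma>0 \<in> {l..u}" using \<sigma>0 by simp
  have K0: "K \<ge> 0" using K[OF \<sigma>0i] abs_ge_zero[of "A \<sigma>0"] by linarith
  have G_deriv: "((\<lambda>\<sigma>. G \<sigma> y) has_real_derivative G' \<sigma> y) (at \<sigma>)" if "\<sigma> \<in> {l..u}" for \<sigma> y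
    unfolding G_def G'_def gaussian_def using A[OF that] B[OF that] C[OF that]
    by (auto intro!: derivative_eq_intros simp: algebra_simps)
  \<comment> \<open>The exponent 2 accounts for the factor of the derivative that is quadratic in
    \<open>y\<close>.\<close>
  obtain M0 where M0: "M0 > 0" "\<And>r. r \<ge> 0 \<Longrightarrow> (1 + r) ^ 2 * exp (K * norm x * r - c * r\<^sup>2) \<le> M0 * exp (- (c / 2) * r\<^sup>2)"
    by (rule polynomial_times_gaussian_bound[OF c(1), of 2 "K * norm x"]) blast
  define M where "M = K * (1 + norm x) * exp K * M0"
  define D where "D = (\<lambda>y::'a. M * exp (- (c / 2) * (norm y)\<^sup>2))"
  have G'_bound: "\<bar>G' \<sigma> y\<bar> \<le> D y" if \<sigma>: "\<sigma> \<in> {l..u}" for \<sigma> y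
  proof -
    have xy: "\<bar>x \<bullet> y\<bar> \<le> norm x * norm y" by (rule Cauchy_Schwarz_ineq2)
    have "\<bar>A' \<sigma> + B' \<sigma> * (x \<bullet> y) - C' \<sigma> * (norm y)\<^sup>2\<bar> \<le> \<bar>A' \<sigma>\<bar> + \<bar>B' \<sigma>\<bar> * \<bar>x \<bullet> y\<bar> + \<bar>C' \<sigma>\<bar> * (norm y)\<^sup>2"
      using abs_triangle_ineq4[of "A' \<sigma> + B' \<sigma> * (x \<bullet> y)" "C' \<sigma> * (norm y)\<^sup>2"]
        abs_triangle_ineq[of "A' \<sigma>" "B' \<sigma> * (x \<bullet> y)"] by (simp add: abs_mult)
    also have "\<dots> \<le> K + K * (norm x * norm y) + K * (norm y)\<^sup>2"
      using K[OF \<sigma>] xy K0 by (intro add_mono mult_mono) auto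
    also have "\<dots> = K * (1 + norm x * norm y + (norm y)\<^sup>2)" by (simp add: algebra_simps)
    also have "\<dots> \<le> K * ((1 + norm x) * (1 + norm y)\<^sup>2)"
      using K0 by (intro mult_left_mono) (auto simp: power2_eq_square algebra_simps)
    finally have 1: "\<bar>A' \<sigma> + B' \<sigma> * (x \<bullet> y) - C' \<sigma> * (norm y)\<^sup>2\<bar> \<le> K * (1 + norm x) * (1 + norm y)\<^sup>2"
      by (simp add: mult.assoc)
    have "B \<sigma> * (x \<bullet> y) \<le> \<bar>B \<sigma>\<bar> * \<bar>x \<bullet> y\<bar>" by (simp add: abs_mult[symmetric])
    also have "\<dots> \<le> K * (norm x * norm y)" using K[OF \<sigma>] xy K0 by (intro mult_mono) auto
    finally have "B \<sigma> * (x \<bullet> y) \<le> K * norm x * norm y" by (simp add: mult.assoc)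
    moreover have "c * (norm y)\<^sup>2 \<le> C \<sigma> * (norm y)\<^sup>2" using c(2)[OF \<sigma>] by (intro mult_right_mono) auto
    moreover have "A \<sigma> \<le> K" using K[OF \<sigma>] by auto
    ultimately have 2: "G \<sigma> y \<le> exp K * exp (K * norm x * norm y - c * (norm y)\<^sup>2)"
      by (simp add: G_def gaussian_def exp_add[symmetric])
    have "\<bar>G' \<sigma> y\<bar> \<le> (K * (1 + norm x) * (1 + norm y)\<^sup>2) * (exp K * exp (K * norm x * norm y - c * (norm y)\<^sup>2))"
      unfolding G'_def abs_mult using 1 2 K0 by (intro mult_mono) (auto simp: G_def)
    also have "\<dots> = K * (1 + norm x) * exp K * ((1 + norm y)\<^sup>2 * exp (K * norm x * norm y - c * (norm y)\<^sup>2))"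
      by (simp add: mult_ac)
    also have "\<dots> \<le> K * (1 + norm x) * exp K * (M0 * exp (- (c / 2) * (norm y)\<^sup>2))"
      using K0 by (intro mult_left_mono M0(2)) auto
    finally show ?thesis by (simp add: D_def M_def mult.assoc)
  qed
  have Q_bound: "\<bar>Q \<sigma> y\<bar> \<le> D y" if "\<sigma> \<in> {l..u}" "\<sigma> \<noteq> \<sigma>0" for \<sigma> y
  proof -
    have "norm (G \<sigma> y - G \<sigma>0 y) \<le> D y * norm (\<sigma> - \<sigma>0)"
      by (rule field_differentiable_bound[of "{l..u}" "\<lambda>\<sigma>. G \<sigma> y" "\<lambda>\<sigma>. G' \<sigma> y"])
         (use that \<sigma>0i G'_bound G_deriv in \<open>auto intro: has_field_derivative_at_within\<close>)
    then show ?thesis using that(2) by (simp add: Q_def divide_le_eq)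
  qed
  have Q_lim: "((\<lambda>\<sigma>. Q \<sigma> y) \<longlongrightarrow> G' \<sigma>0 y) (at \<sigma>0)" for y
    using G_deriv[OF \<sigma>0i, of y] by (simp add: has_field_derivative_iff Q_def)
  have Gm[measurable]: "G \<sigma> \<in> borel_measurable borel" for \<sigma>
    unfolding G_def gaussian_def by measurable
  have Qm[measurable]: "Q \<sigma> \<in> borel_measurable borel" "G' \<sigma> \<in> borel_measurable borel" for \<sigma>
    unfolding Q_def G'_def by measurable
  have "((\<lambda>\<sigma>. LINT y|lborel. (Q \<sigma> y - G' \<sigma>0 y)\<^sup>2) \<longlongrightarrow> 0) (at \<sigma>0)"
    unfolding tendsto_at_iff_sequentially
  proof (intro allI impI)
    fix X assume X: "\<forall>i. X i \<in> UNIV - {\<sigma>0}" "X \<longlonglongrightarrow> \<sigma>0"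
    have "eventually (\<lambda>i. X i \<in> {l<..<u}) sequentially"
      by (rule topological_tendstoD[OF X(2) open_greaterThanLessThan]) (use \<sigma>0 in simp)
    then obtain N where N: "\<And>i. i \<ge> N \<Longrightarrow> X i \<in> {l<..<u}" by (auto simp: eventually_sequentially)
    \<comment> \<open>The sequence is shifted by \<open>N\<close> because domination is known only
      for parameters in the interval.\<close>
    have "(\<lambda>i. LINT y|lborel. (Q (X (i + N)) y - G' \<sigma>0 y)\<^sup>2) \<longlonglongrightarrow> (LINT y::'a|lborel. 0)"
    proof (rule integral_dominated_convergence)
      show "integrable lborel (\<lambda>y::'a. 4 * M\<^sup>2 * exp (- c * (norm y)\<^sup>2))"
        by (intro integrable_mult_right integrable_exp_neg_norm_sq c)
      show "AE y in lborel. norm ((Q (X (i + N)) y - G' \<sigma>0 y)\<^sup>2) \<le> 4 * M\<^sup>2 * exp (- c * (norm y)\<^sup>2)" for i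
      proof (intro always_eventually allI)
        fix y
        have "\<bar>Q (X (i + N)) y - G' \<sigma>0 y\<bar> \<le> 2 * D y"
          using Q_bound[of "X (i + N)" y] G'_bound[OF \<sigma>0i, of y] N[of "i + N"] X(1) by auto
        then have "(Q (X (i + N)) y - G' \<sigma>0 y)\<^sup>2 \<le> (2 * D y)\<^sup>2" by (rule abs_le_square_iff[THEN iffD1, OF order_trans]) simp
        also have "\<dots> = 4 * M\<^sup>2 * exp (- c * (norm y)\<^sup>2)"
          by (simp add: D_def power_mult_distrib exp_double[symmetric])
        finally show "norm ((Q (X (i + N)) y - G' \<sigma>0 y)\<^sup>2) \<le> 4 * M\<^sup>2 * exp (- c * (norm y)\<^sup>2)" by simp
      qed
      show "AE y in lborel. (\<lambda>i. (Q (X (i + N)) y - G' \<sigma>0 y)\<^sup>2) \<longlonglongrightarrow> 0"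
      proof (intro always_eventually allI)
        fix y
        have "(\<lambda>i. Q (X i) y) \<longlonglongrightarrow> G' \<sigma>0 y"
          using Q_lim[of y] X unfolding tendsto_at_iff_sequentially o_def by auto
        from LIMSEQ_ignore_initial_segment[OF this, of N]
        have "(\<lambda>i. (Q (X (i + N)) y - G' \<sigma>0 y)\<^sup>2) \<longlonglongrightarrow> (G' \<sigma>0 y - G' \<sigma>0 y)\<^sup>2" by (intro tendsto_intros)
        then show "(\<lambda>i. (Q (X (i + N)) y - G' \<sigma>0 y)\<^sup>2) \<longlonglongrightarrow> 0" by simp
      qed
    qed measurable
    then have "(\<lambda>i. LINT y|lborel. (Q (X (i + N)) y - G' \<sigma>0 y)\<^sup>2) \<longlonglongrightarrow> 0" by simp
    then show "((\<lambda>\<sigma>. LINT y|lborel. (Q \<sigma> y - G' \<sigma>0 y)\<^sup>2) \<circ> X) \<longlonglongrightarrow> 0"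
      unfolding o_def by (rule LIMSEQ_offset)
  qed
  then have "((\<lambda>\<sigma>. sqrt (LINT y|lborel. (Q \<sigma> y - G' \<sigma>0 y)\<^sup>2)) \<longlongrightarrow> sqrt 0) (at \<sigma>0)" by (rule tendsto_real_sqrt)
  moreover have "L2_norm (\<lambda>y. (1 / (\<sigma> - \<sigma>0)) *\<^sub>R (complex_of_real (G \<sigma> y) - complex_of_real (G \<sigma>0 y)) - complex_of_real (G' \<sigma>0 y))
      = sqrt (LINT y|lborel. (Q \<sigma> y - G' \<sigma>0 y)\<^sup>2)" for \<sigma>
  proof -
    have "(1 / (\<sigma> - \<sigma>0)) *\<^sub>R (complex_of_real (G \<sigma> y) - complex_of_real (G \<sigma>0 y)) - complex_of_real (G' \<sigma>0 y)
        = complex_of_real (Q \<sigma> y - G' \<sigma>0 y)" for y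
      by (simp add: Q_def scaleR_conv_of_real)
    then show ?thesis unfolding L2_norm_def by (simp only: norm_of_real power2_abs)
  qed
  ultimately show ?thesis unfolding G'_def G_def by simp
qed

text \<open>In the usual notation, with \<open>n\<close> the dimension: \<open>(2 pi sinh
  2\<sigma>)^(-n/2) exp (x.y / sinh 2\<sigma> - coth 2\<sigma> (|x|^2 + |y|^2) / 2)\<close>. The
  normalising factor enters the exponent as a logarithm, so that the kernel is a member of the
  family \<open>gaussian\<close>.\<close>

definition mehler_kernel :: "real \<Rightarrow> 'a::euclidean_space \<Rightarrow> 'a \<Rightarrow> real" where
  "mehler_kernel \<sigma> x = gaussian
     (- (cosh (2 * \<sigma>) / (2 * sinh (2 * \<sigma>))) * (norm x)\<^sup>2 - real DIM('a) / 2 * ln (2 * pi * sinh (2 * \<sigma>)))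
     ((1 / sinh (2 * \<sigma>)) *\<^sub>R x) (cosh (2 * \<sigma>) / (2 * sinh (2 * \<sigma>)))"

lemma sinh_double_pos: "\<sigma> > 0 \<Longrightarrow> sinh (2 * \<sigma> :: real) > 0"
  by simp

lemma coth_half_ge: "\<sigma> > 0 \<Longrightarrow> cosh (2 * \<sigma>) / (2 * sinh (2 * \<sigma> :: real)) \<ge> 1 / 2"
  using sinh_le_cosh_real[of "2 * \<sigma>"] sinh_double_pos[of \<sigma>] by (simp add: pos_le_divide_eq)

lemma mehler_kernel_schwartz:
  assumes "\<sigma> > 0"
  shows "(\<lambda>y. complex_of_real (mehler_kernel \<sigma> x y)) \<in> schwartz"
  unfolding mehler_kernel_def
  by (rule gaussian_schwartz) (use coth_half_ge[OF assms] in linarith)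

text \<open>The parameters must solve \<open>C' = 1 - 4 C^2\<close>, \<open>B' = - 4 B C\<close> and
  \<open>A' = B^2 |x|^2 - 2 n C\<close>, with \<open>n\<close> the dimension. The hyperbolic
  coefficients do, by \<open>cosh^2 - sinh^2 = 1\<close>.\<close>

lemma mehler_kernel_L2_derivative:
  fixes x :: "'a::euclidean_space"
  assumes \<sigma>0: "\<sigma>0 > 0"
  shows "((\<lambda>\<sigma>. L2_norm (\<lambda>y. (1 / (\<sigma> - \<sigma>0)) *\<^sub>R (complex_of_real (mehler_kernel \<sigma> x y) - complex_of_real (mehler_kernel \<sigma>0 x y))
      + harmonic_op (\<lambda>y. complex_of_real (mehler_kernel \<sigma>0 x y)) y)) \<longlongrightarrow> 0) (at \<sigma>0)"
proof -
  define A B C where "A = (\<lambda>\<sigma>. - (cosh (2 * \<sigma>) / (2 * sinh (2 * \<sigma>))) * (norm x)\<^sup>2 - real DIM('a) / 2 * ln (2 * pi * sinh (2 * \<sigma>)))"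
    and "B = (\<lambda>\<sigma>::real. 1 / sinh (2 * \<sigma>))" and "C = (\<lambda>\<sigma>::real. cosh (2 * \<sigma>) / (2 * sinh (2 * \<sigma>)))"
  define A' B' C' where "A' = (\<lambda>\<sigma>. (norm x)\<^sup>2 / (sinh (2 * \<sigma>))\<^sup>2 - real DIM('a) * (cosh (2 * \<sigma>) / sinh (2 * \<sigma>)))"
    and "B' = (\<lambda>\<sigma>::real. - 2 * cosh (2 * \<sigma>) / (sinh (2 * \<sigma>))\<^sup>2)" and "C' = (\<lambda>\<sigma>::real. - 1 / (sinh (2 * \<sigma>))\<^sup>2)"
  have C: "(C has_real_derivative C' \<sigma>) (at \<sigma>)" if "\<sigma> > 0" for \<sigma>
  proof -
    have s: "sinh (2 * \<sigma>) \<noteq> 0" using sinh_double_pos[OF that] by simp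
    have "(C has_real_derivative (sinh (2 * \<sigma>) * 2 * (2 * sinh (2 * \<sigma>)) - cosh (2 * \<sigma>) * (2 * (cosh (2 * \<sigma>) * 2))) / (2 * sinh (2 * \<sigma>))\<^sup>2) (at \<sigma>)"
      unfolding C_def using that s by (auto intro!: derivative_eq_intros simp: power2_eq_square)
    also have "(sinh (2 * \<sigma>) * 2 * (2 * sinh (2 * \<sigma>)) - cosh (2 * \<sigma>) * (2 * (cosh (2 * \<sigma>) * 2))) / (2 * sinh (2 * \<sigma>))\<^sup>2
        = ((sinh (2 * \<sigma>))\<^sup>2 - (cosh (2 * \<sigma>))\<^sup>2) / (sinh (2 * \<sigma>))\<^sup>2"
      using s by (simp add: field_simps power2_eq_square)
    also have "\<dots> = C' \<sigma>" by (simp add: C'_def cosh_square_eq)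
    finally show ?thesis .
  qed
  have B: "(B has_real_derivative B' \<sigma>) (at \<sigma>)" if "\<sigma> > 0" for \<sigma>
    unfolding B_def B'_def using sinh_double_pos[OF that]
    by (auto intro!: derivative_eq_intros simp: power2_eq_square)
  have A: "(A has_real_derivative A' \<sigma>) (at \<sigma>)" if "\<sigma> > 0" for \<sigma>
  proof -
    have s: "sinh (2 * \<sigma>) > 0" using sinh_double_pos[OF that] .
    have "((\<lambda>\<sigma>. ln (2 * pi * sinh (2 * \<sigma>))) has_real_derivative (2 * (cosh (2 * \<sigma>) / sinh (2 * \<sigma>)))) (at \<sigma>)"
      using s by (auto intro!: derivative_eq_intros)
    from DERIV_diff[OF DERIV_cmult_right[OF DERIV_minus[OF C[OF that]], of "(norm x)\<^sup>2"] DERIV_cmult[OF this, of "real DIM('a) / 2"]]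
    show ?thesis by (simp add: A_def A'_def C_def C'_def)
  qed
  \<comment> \<open>A compact interval around \<open>\<sigma>0\<close> that stays away from 0, where
    \<open>sinh\<close> vanishes. All coefficients are bounded on it, and the quadratic one is at
    least 1/2 because \<open>coth \<ge> 1\<close>.\<close>
  define l u where "l = \<sigma>0 / 2" and "u = \<sigma>0 + 1"
  have lu: "l > 0" "l < \<sigma>0" "\<sigma>0 < u" using \<sigma>0 by (auto simp: l_def u_def)
  have pos: "\<sigma> > 0" if "\<sigma> \<in> {l..u}" for \<sigma> using that lu by auto
  have s0: "sinh (2 * \<sigma>) \<noteq> 0" if "\<sigma> \<in> {l..u}" for \<sigma>
    using sinh_double_pos[OF pos[OF that]] by simp
  have bdd: "\<exists>K. \<forall>\<sigma>\<in>{l..u}. \<bar>F \<sigma>\<bar> \<le> K" if "continuous_on {l..u} F" for F :: "real \<Rightarrow> real"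
    using compact_imp_bounded[OF compact_continuous_image[OF that compact_Icc]] by (auto simp: bounded_iff)
  have "continuous_on {l..u} A" "continuous_on {l..u} B"
    using A B pos by (meson DERIV_isCont continuous_at_imp_continuous_on)+
  moreover have "continuous_on {l..u} A'" "continuous_on {l..u} B'" "continuous_on {l..u} C'"
    unfolding A'_def B'_def C'_def using s0 by (auto intro!: continuous_intros)
  ultimately obtain K1 K2 K3 K4 K5 where K:
    "\<And>\<sigma>. \<sigma>\<in>{l..u} \<Longrightarrow> \<bar>A \<sigma>\<bar> \<le> K1" "\<And>\<sigma>. \<sigma>\<in>{l..u} \<Longrightarrow> \<bar>B \<sigma>\<bar> \<le> K2" "\<And>\<sigma>. \<sigma>\<in>{l..u} \<Longrightarrow> \<bar>A' \<sigma>\<bar> \<le> K3"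
    "\<And>\<sigma>. \<sigma>\<in>{l..u} \<Longrightarrow> \<bar>B' \<sigma>\<bar> \<le> K4" "\<And>\<sigma>. \<sigma>\<in>{l..u} \<Longrightarrow> \<bar>C' \<sigma>\<bar> \<le> K5"
    by (metis bdd)
  define K where "K = Max {K1, K2, K3, K4, K5}"
  have "K1 \<le> K" "K2 \<le> K" "K3 \<le> K" "K4 \<le> K" "K5 \<le> K" by (auto simp: K_def)
  with K have KK: "\<bar>A \<sigma>\<bar> \<le> K \<and> \<bar>B \<sigma>\<bar> \<le> K \<and> \<bar>A' \<sigma>\<bar> \<le> K \<and> \<bar>B' \<sigma>\<bar> \<le> K \<and> \<bar>C' \<sigma>\<bar> \<le> K" if "\<sigma> \<in> {l..u}" for \<sigma>
    using that by (meson order_trans)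
  have k: "mehler_kernel \<sigma> x y = gaussian (A \<sigma>) (B \<sigma> *\<^sub>R x) (C \<sigma>) y" for \<sigma> y
    by (simp add: mehler_kernel_def A_def B_def C_def)
  have "harmonic_op (\<lambda>y. complex_of_real (mehler_kernel \<sigma>0 x y)) y
      = - complex_of_real ((A' \<sigma>0 + B' \<sigma>0 * (x \<bullet> y) - C' \<sigma>0 * (norm y)\<^sup>2) * gaussian (A \<sigma>0) (B \<sigma>0 *\<^sub>R x) (C \<sigma>0) y)" for y
  proof -
    have s: "sinh (2 * \<sigma>0) \<noteq> 0" using sinh_double_pos[OF \<sigma>0] by simp
    have "1 - 4 * (C \<sigma>0)\<^sup>2 = ((sinh (2 * \<sigma>0))\<^sup>2 - (cosh (2 * \<sigma>0))\<^sup>2) / (sinh (2 * \<sigma>0))\<^sup>2"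
      using s by (simp add: C_def power_divide power_mult_distrib field_simps)
    then have 3: "1 - 4 * (C \<sigma>0)\<^sup>2 = C' \<sigma>0" by (simp add: C'_def cosh_square_eq)
    have 2: "4 * C \<sigma>0 * ((B \<sigma>0 *\<^sub>R x) \<bullet> y) = - B' \<sigma>0 * (x \<bullet> y)"
      using s by (simp add: C_def B_def B'_def power2_eq_square)
    have 1: "- (norm (B \<sigma>0 *\<^sub>R x))\<^sup>2 + 2 * C \<sigma>0 * real DIM('a) = - A' \<sigma>0"
      using s by (simp add: C_def B_def A'_def power_mult_distrib power_divide)
    show ?thesis unfolding k harmonic_op_gaussian 1 2 3 by (simp add: algebra_simps)
  qed
  then show ?thesis
    using gaussian_family_L2_derivative[of l \<sigma>0 u "1/2" C A A' B B' C' K x, OF lu(2,3) _ _ A B C KK] pos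
      coth_half_ge by (simp add: k C_def)
qed

lemma L2_norm_scaleR: "L2_norm (\<lambda>x. r *\<^sub>R u x) = \<bar>r\<bar> * L2_norm u"
  by (simp add: L2_norm_def power_mult_distrib real_sqrt_mult)

lemma mehler_kernel_commute: "mehler_kernel \<sigma> x y = mehler_kernel \<sigma> y x"
  by (simp add: mehler_kernel_def gaussian_def inner_commute)

text \<open>Differentiability implies continuity: the increment is
  \<open>\<bar>\<sigma> - \<sigma>0\<bar>\<close> times a quotient whose norm stays bounded.\<close>

lemma mehler_kernel_L2_continuous:
  fixes x :: "'a::euclidean_space" and H :: "('a \<Rightarrow> complex) rel"
  assumes H: "harmonic_oscillator H" and \<sigma>0: "\<sigma>0 > 0"
  shows "((\<lambda>\<sigma>. L2_norm (\<lambda>y. complex_of_real (mehler_kernel \<sigma> x y) - complex_of_real (mehler_kernel \<sigma>0 x y))) \<longlongrightarrow> 0) (at \<sigma>0)"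
proof -
  define k where "k = (\<lambda>\<sigma> y. complex_of_real (mehler_kernel \<sigma> x y))"
  define D where "D = (\<lambda>\<sigma>. L2_norm (\<lambda>y. (1 / (\<sigma> - \<sigma>0)) *\<^sub>R (k \<sigma> y - k \<sigma>0 y) + harmonic_op (k \<sigma>0) y))"
  have D0: "(D \<longlongrightarrow> 0) (at \<sigma>0)" unfolding D_def k_def by (rule mehler_kernel_L2_derivative[OF \<sigma>0])
  have k2: "k \<sigma> \<in> L2" if "\<sigma> > 0" for \<sigma>
    unfolding k_def by (intro schwartz_L2[OF H] mehler_kernel_schwartz that)
  have Lk: "harmonic_op (k \<sigma>0) \<in> L2"
    unfolding k_def by (intro harmonic_op_L2[OF H] mehler_kernel_schwartz \<sigma>0)
  have ev: "eventually (\<lambda>\<sigma>. \<sigma> > 0 \<and> \<sigma> \<noteq> \<sigma>0) (at \<sigma>0)"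
    using order_tendstoD(1)[OF tendsto_ident_at \<sigma>0] by (simp add: eventually_conj eventually_neq_at_within)
  have "eventually (\<lambda>\<sigma>. norm (L2_norm (\<lambda>y. k \<sigma> y - k \<sigma>0 y)) \<le> \<bar>\<sigma> - \<sigma>0\<bar> * (D \<sigma> + L2_norm (harmonic_op (k \<sigma>0)))) (at \<sigma>0)"
    using ev
  proof eventually_elim
    case (elim \<sigma>)
    define Q where "Q = (\<lambda>y. (1 / (\<sigma> - \<sigma>0)) *\<^sub>R (k \<sigma> y - k \<sigma>0 y))"
    have Q2: "Q \<in> L2" unfolding Q_def using elim \<sigma>0 by (intro L2_scaleR L2_diff k2) auto
    have "(\<lambda>y. k \<sigma> y - k \<sigma>0 y) = (\<lambda>y. (\<sigma> - \<sigma>0) *\<^sub>R Q y)" using elim by (simp add: Q_def fun_eq_iff)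
    then have "L2_norm (\<lambda>y. k \<sigma> y - k \<sigma>0 y) = \<bar>\<sigma> - \<sigma>0\<bar> * L2_norm Q" by (simp only: L2_norm_scaleR)
    also have "L2_norm Q \<le> D \<sigma> + L2_norm (harmonic_op (k \<sigma>0))"
      using L2_norm_diff_triangle[of Q "\<lambda>y. - harmonic_op (k \<sigma>0) y" "\<lambda>_. 0"] Q2 L2_uminus[OF Lk]
      by (simp add: D_def Q_def L2_def L2_norm_def)
    finally show ?case by (simp add: mult_left_mono)
  qed
  moreover have "((\<lambda>\<sigma>. \<bar>\<sigma> - \<sigma>0\<bar> * (D \<sigma> + L2_norm (harmonic_op (k \<sigma>0)))) \<longlongrightarrow> \<bar>\<sigma>0 - \<sigma>0\<bar> * (0 + L2_norm (harmonic_op (k \<sigma>0)))) (at \<sigma>0)"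
    by (intro tendsto_intros D0)
  then have "((\<lambda>\<sigma>. \<bar>\<sigma> - \<sigma>0\<bar> * (D \<sigma> + L2_norm (harmonic_op (k \<sigma>0)))) \<longlongrightarrow> 0) (at \<sigma>0)" by simp
  ultimately show ?thesis unfolding k_def by (rule Lim_null_comparison)
qed

context
  fixes T :: "real \<Rightarrow> ('a::euclidean_space \<Rightarrow> complex) \<Rightarrow> 'a \<Rightarrow> complex"
    and H :: "('a \<Rightarrow> complex) rel"
  assumes H: "harmonic_oscillator H" and TH: "generated_by_minus T H"
begin

lemma mehler_kernel_duality:
  assumes f: "f \<in> schwartz" and \<tau>: "\<tau> \<ge> 0" and \<epsilon>: "\<epsilon> > 0"
  shows "(LINT y|lborel. mehler_kernel \<epsilon> x y *\<^sub>R T \<tau> f y) = (LINT y|lborel. mehler_kernel (\<tau> + \<epsilon>) x y *\<^sub>R f y)"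
proof -
  \<comment> \<open>Kernel time runs backwards from \<open>\<tau> + \<epsilon>\<close> to
    \<open>\<epsilon>\<close> and never reaches 0; the reversal supplies the sign that
    \<open>semigroup_duality\<close> asks for.\<close>
  define \<kappa> where "\<kappa> = (\<lambda>s y. complex_of_real (mehler_kernel (\<tau> + \<epsilon> - s) x y))"
  have "L2_inner (\<kappa> \<tau>) (T \<tau> f) = L2_inner (\<kappa> 0) f"
  proof (rule semigroup_duality[OF H TH f \<tau>])
    fix s assume s: "0 \<le> s" "s \<le> \<tau>"
    show "\<kappa> s \<in> schwartz" unfolding \<kappa>_def using s \<epsilon> by (intro mehler_kernel_schwartz) auto
    have "filterlim (\<lambda>r. \<tau> + \<epsilon> - r) (at (\<tau> + \<epsilon> - s)) (at s within {0..\<tau>})"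
      unfolding filterlim_at by (auto intro!: tendsto_intros simp: eventually_at_filter)
    from filterlim_compose[OF mehler_kernel_L2_continuous[OF H] this, of x] s \<epsilon>
    show "((\<lambda>r. L2_norm (\<lambda>y. \<kappa> r y - \<kappa> s y)) \<longlongrightarrow> 0) (at s within {0..\<tau>})" by (simp add: \<kappa>_def)
  next
    fix s assume s: "0 \<le> s" "s < \<tau>"
    define \<sigma> where "\<sigma> = \<tau> + \<epsilon> - s"
    have \<sigma>: "\<sigma> > 0" using s \<epsilon> by (simp add: \<sigma>_def)
    have "filterlim (\<lambda>h. \<sigma> - h) (at \<sigma>) (at_right 0)"
      unfolding filterlim_at by (auto intro!: tendsto_eq_intros simp: eventually_at_filter)
    from filterlim_compose[OF mehler_kernel_L2_derivative[OF \<sigma>, of x] this]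
    have "((\<lambda>h. L2_norm (\<lambda>y. (1 / (\<sigma> - h - \<sigma>)) *\<^sub>R (complex_of_real (mehler_kernel (\<sigma> - h) x y) - complex_of_real (mehler_kernel \<sigma> x y))
      + harmonic_op (\<lambda>y. complex_of_real (mehler_kernel \<sigma> x y)) y)) \<longlongrightarrow> 0) (at_right 0)" .
    also have "(\<lambda>h. L2_norm (\<lambda>y. (1 / (\<sigma> - h - \<sigma>)) *\<^sub>R (complex_of_real (mehler_kernel (\<sigma> - h) x y) - complex_of_real (mehler_kernel \<sigma> x y))
        + harmonic_op (\<lambda>y. complex_of_real (mehler_kernel \<sigma> x y)) y))
      = (\<lambda>h. L2_norm (\<lambda>y. (1 / h) *\<^sub>R (\<kappa> (s + h) y - \<kappa> s y) - harmonic_op (\<kappa> s) y))"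
    proof
      fix h
      have e: "\<kappa> (s + h) = (\<lambda>y. complex_of_real (mehler_kernel (\<sigma> - h) x y))" "\<kappa> s = (\<lambda>y. complex_of_real (mehler_kernel \<sigma> x y))"
        by (simp_all add: \<kappa>_def \<sigma>_def diff_diff_eq)
      \<comment> \<open>Since kernel time decreases, the quotients on the two sides differ by an
        overall sign, to which the norm is blind.\<close>
      have n: "L2_norm u = L2_norm v" if "\<And>y. u y = - v y" for u v :: "'a \<Rightarrow> complex"
        using that by (simp add: L2_norm_def)
      show "L2_norm (\<lambda>y. (1 / (\<sigma> - h - \<sigma>)) *\<^sub>R (complex_of_real (mehler_kernel (\<sigma> - h) x y) - complex_of_real (mehler_kernel \<sigma> x y))
          + harmonic_op (\<lambda>y. complex_of_real (mehler_kernel \<sigma> x y)) y)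
        = L2_norm (\<lambda>y. (1 / h) *\<^sub>R (\<kappa> (s + h) y - \<kappa> s y) - harmonic_op (\<kappa> s) y)"
        unfolding e by (rule n) simp
    qed
    finally show "((\<lambda>h. L2_norm (\<lambda>y. (1 / h) *\<^sub>R (\<kappa> (s + h) y - \<kappa> s y) - harmonic_op (\<kappa> s) y)) \<longlongrightarrow> 0) (at_right 0)" .
  qed
  \<comment> \<open>The inner product is conjugate linear in its second slot; as the kernel is real,
    it equals the conjugate of a plain integral.\<close>
  moreover have "L2_inner (\<lambda>y. complex_of_real (k y)) u = cnj (LINT y|lborel. k y *\<^sub>R u y)" for k :: "'a \<Rightarrow> real" and u
  proof -
    have "complex_of_real (k y) * cnj (u y) = cnj (k y *\<^sub>R u y)" for y by (simp add: scaleR_conv_of_real)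
    then show ?thesis unfolding L2_inner_def by (simp only: Bochner_Integration.integral_cnj)
  qed
  ultimately have "cnj (LINT y|lborel. mehler_kernel \<epsilon> x y *\<^sub>R T \<tau> f y)
      = cnj (LINT y|lborel. mehler_kernel (\<tau> + \<epsilon>) x y *\<^sub>R f y)"
    by (simp only: \<kappa>_def add_diff_cancel_left' diff_0_right)
  then show ?thesis by (simp only: complex_cnj_cancel_iff)
qed

end

text \<open>Mehler's formula: completing the square in the kernel turns the integral against it into a
  Gaussian average.\<close>

definition mehler_mean :: "real \<Rightarrow> ('a::euclidean_space \<Rightarrow> complex) \<Rightarrow> 'a \<Rightarrow> complex" where
  "mehler_mean \<tau> f x = ((1 / sqrt (cosh (2 * \<tau>))) ^ DIM('a) * exp (- (tanh (2 * \<tau>) / 2) * (norm x)\<^sup>2)) *\<^sub>R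
     gauss_mean f (sqrt (tanh (2 * \<tau>))) ((1 / cosh (2 * \<tau>)) *\<^sub>R x)"

lemma exp_minus_half_ln:
  assumes "w > 0"
  shows "exp (- (real n / 2 * ln w)) = (1 / sqrt w) ^ n"
proof -
  have "exp (- (real n / 2 * ln w)) = exp (- (ln w / 2)) ^ n"
    by (simp add: exp_of_nat_mult[symmetric])
  also have "exp (- (ln w / 2)) = 1 / sqrt w"
    using assms by (simp add: exp_minus ln_sqrt[symmetric] inverse_eq_divide)
  finally show ?thesis .
qed

lemma mehler_kernel_integral:
  fixes f :: "'a::euclidean_space \<Rightarrow> complex"
  assumes [measurable]: "f \<in> borel_measurable borel" and \<tau>: "\<tau> > 0"
  shows "(LINT y|lborel. mehler_kernel \<tau> x y *\<^sub>R f y) = mehler_mean \<tau> f x"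
proof -
  define c s t where "c = cosh (2 * \<tau>)" and "s = sinh (2 * \<tau>)" and "t = tanh (2 * \<tau>)"
  have cs: "c > 0" "s > 0" "t > 0" "t = s / c" using \<tau> by (auto simp: c_def s_def t_def tanh_def)
  have csq: "c\<^sup>2 = s\<^sup>2 + 1" unfolding c_def s_def by (rule cosh_square_eq)
  define r where "r = sqrt t"
  have r: "r > 0" "r\<^sup>2 = t" using cs by (auto simp: r_def)
  have [measurable]: "mehler_kernel \<tau> x \<in> borel_measurable borel"
    unfolding mehler_kernel_def gaussian_def[abs_def] by measurable
  \<comment> \<open>The centre \<open>x / c\<close> removes the term linear in \<open>z\<close>, and
    \<open>r^2 = s / c\<close> normalises the quadratic coefficient \<open>c / (2 * s)\<close> to
    1/2.\<close>
  have "\<bar>r\<bar> ^ DIM('a) * mehler_kernel \<tau> x ((1 / c) *\<^sub>R x + r *\<^sub>R z)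
      = (1 / sqrt c) ^ DIM('a) * exp (- (t / 2) * (norm x)\<^sup>2) * std_gauss z" for z
  proof -
    define y where "y = (1 / c) *\<^sub>R x + r *\<^sub>R z"
    have ny: "(norm y)\<^sup>2 = (norm x)\<^sup>2 / c\<^sup>2 + 2 * (r / c) * (x \<bullet> z) + t * (norm z)\<^sup>2"
      unfolding y_def r(2)[symmetric] power2_norm_eq_inner
      by (simp add: inner_add_left inner_add_right inner_commute power2_eq_square add_divide_distrib)
    have xy: "x \<bullet> y = (norm x)\<^sup>2 / c + r * (x \<bullet> z)"
      by (simp add: y_def inner_add_right power2_norm_eq_inner)
    have c1: "(1 / s) * (r * q) - c / (2 * s) * (2 * (r / c) * q) = 0" for q using cs by simp
    have c2: "c / (2 * s) * (t * q) = (1/2) * q" for q using cs by simp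
    \<comment> \<open>Collects the terms in \<open>x\<close> alone; \<open>c^2 = s^2 + 1\<close>
      turns them into the prefactor with \<open>t = s / c\<close>.\<close>
    have c3: "- (c / (2 * s)) * q + 1 / s * (q / c) - c / (2 * s) * (q / c\<^sup>2) = - (t / 2) * q" for q
    proof -
      have "- (c / (2 * s)) * q + 1 / s * (q / c) - c / (2 * s) * (q / c\<^sup>2) = q * (1 - c\<^sup>2) / (2 * s * c)"
        using cs(1,2) by (simp add: field_simps power2_eq_square)
      also have "\<dots> = - (t / 2) * q" unfolding csq cs(4) using cs(1,2) by (simp add: field_simps power2_eq_square)
      finally show ?thesis .
    qed
    have "- (c / (2 * s)) * (norm x)\<^sup>2 + (1 / s) * (x \<bullet> y) - c / (2 * s) * (norm y)\<^sup>2
        = (- (c / (2 * s)) * (norm x)\<^sup>2 + 1 / s * ((norm x)\<^sup>2 / c) - c / (2 * s) * ((norm x)\<^sup>2 / c\<^sup>2))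
          + ((1 / s) * (r * (x \<bullet> z)) - c / (2 * s) * (2 * (r / c) * (x \<bullet> z))) - c / (2 * s) * (t * (norm z)\<^sup>2)"
      unfolding ny xy by (simp add: distrib_left)
    also have "\<dots> = - (t / 2) * (norm x)\<^sup>2 - (1/2) * (norm z)\<^sup>2" unfolding c1 c2 c3 by simp
    finally have ex: "- (c / (2 * s)) * (norm x)\<^sup>2 + (1 / s) * (x \<bullet> y) - c / (2 * s) * (norm y)\<^sup>2
        = - (t / 2) * (norm x)\<^sup>2 - (1/2) * (norm z)\<^sup>2" .
    have "mehler_kernel \<tau> x y = exp (- (real DIM('a) / 2 * ln (2 * pi * s)) +
        (- (c / (2 * s)) * (norm x)\<^sup>2 + (1 / s) * (x \<bullet> y) - c / (2 * s) * (norm y)\<^sup>2))"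
      by (simp add: mehler_kernel_def gaussian_def c_def s_def)
    also have "\<dots> = (1 / sqrt (2 * pi * s)) ^ DIM('a) * (exp (- (t / 2) * (norm x)\<^sup>2) * exp (- (1/2) * (norm z)\<^sup>2))"
      unfolding ex exp_add exp_minus_half_ln[OF mult_pos_pos[OF mult_pos_pos[OF zero_less_numeral pi_gt_zero] cs(2)]]
      by (simp add: exp_add[symmetric])
    finally have k: "mehler_kernel \<tau> x y = (1 / sqrt (2 * pi * s)) ^ DIM('a) * (exp (- (t / 2) * (norm x)\<^sup>2) * exp (- (1/2) * (norm z)\<^sup>2))" .
    \<comment> \<open>In each dimension the Jacobian cancels \<open>s\<close> in the normalising
      factor and leaves \<open>1 / sqrt c\<close> beside the normal constant.\<close>
    have "r * (1 / sqrt (2 * pi * s)) = (1 / sqrt c) * (1 / sqrt (2 * pi))"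
      using cs(1,2) unfolding r_def cs(4) by (simp add: real_sqrt_divide real_sqrt_mult)
    then have "r ^ DIM('a) * (1 / sqrt (2 * pi * s)) ^ DIM('a) = (1 / sqrt c) ^ DIM('a) * (1 / sqrt (2 * pi)) ^ DIM('a)"
      by (simp only: power_mult_distrib[symmetric])
    then show ?thesis using r(1) unfolding y_def[symmetric] k std_gauss_eq by (simp add: mult_ac)
  qed
  then have eq: "(\<lambda>z. (\<bar>r\<bar> ^ DIM('a)) *\<^sub>R mehler_kernel \<tau> x ((1 / c) *\<^sub>R x + r *\<^sub>R z) *\<^sub>R f ((1 / c) *\<^sub>R x + r *\<^sub>R z))
      = (\<lambda>z. ((1 / sqrt c) ^ DIM('a) * exp (- (t / 2) * (norm x)\<^sup>2)) *\<^sub>R (std_gauss z *\<^sub>R f ((1 / c) *\<^sub>R x + r *\<^sub>R z)))"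
    by (simp only: scaleR_scaleR)
  have "(LINT y|lborel. mehler_kernel \<tau> x y *\<^sub>R f y)
      = (LINT z|lborel. (\<bar>r\<bar> ^ DIM('a)) *\<^sub>R mehler_kernel \<tau> x ((1 / c) *\<^sub>R x + r *\<^sub>R z) *\<^sub>R f ((1 / c) *\<^sub>R x + r *\<^sub>R z))"
    by (rule integral_lborel_affine) (use r(1) in auto)
  then show ?thesis
    unfolding eq mehler_mean_def gauss_mean_def c_def[symmetric] t_def[symmetric] r_def[symmetric]
    by (simp only: integral_scaleR_right)
qed

lemma mehler_factor_bounds:
  assumes "\<tau> \<ge> 0"
  shows "0 \<le> (1 / sqrt (cosh (2 * \<tau>))) ^ n * exp (- (tanh (2 * \<tau>) / 2) * r\<^sup>2)"
    and "(1 / sqrt (cosh (2 * \<tau>))) ^ n * exp (- (tanh (2 * \<tau>) / 2) * r\<^sup>2) \<le> 1"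
proof -
  have "cosh (2 * \<tau>) \<ge> 1" by (rule cosh_real_ge_1)
  then have "(1 / sqrt (cosh (2 * \<tau>))) ^ n \<le> 1" by (intro power_le_one) auto
  moreover have "exp (- (tanh (2 * \<tau>) / 2) * r\<^sup>2) \<le> 1" using assms by simp
  ultimately show "(1 / sqrt (cosh (2 * \<tau>))) ^ n * exp (- (tanh (2 * \<tau>) / 2) * r\<^sup>2) \<le> 1" by (intro mult_le_one) auto
qed auto

lemma norm_mehler_mean_le:
  fixes f :: "'a::euclidean_space \<Rightarrow> complex"
  assumes "\<tau> \<ge> 0"
  shows "norm (mehler_mean \<tau> f x) \<le> norm (gauss_mean f (sqrt (tanh (2 * \<tau>))) ((1 / cosh (2 * \<tau>)) *\<^sub>R x))"
  unfolding mehler_mean_def norm_scaleR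
  using mehler_factor_bounds[OF assms, of "DIM('a)" "norm x"] by (intro mult_left_le_one_le) auto

lemma mehler_mean_0: "mehler_mean 0 f x = f x"
  by (simp add: mehler_mean_def gauss_mean_def)

text \<open>Continuity is asked for only at the limiting sampling points. At
  \<open>\<tau> = 0\<close> they all equal \<open>x\<close>, so the lemma also covers a box
  indicator away from the boundary of the box.\<close>

lemma mehler_mean_tendsto:
  fixes f :: "'a::euclidean_space \<Rightarrow> complex"
  assumes [measurable]: "f \<in> borel_measurable borel" and K: "\<And>x. norm (f x) \<le> K" and X: "X \<longlonglongrightarrow> \<tau>"
    and cont: "\<And>z. isCont f ((1 / cosh (2 * \<tau>)) *\<^sub>R x + sqrt (tanh (2 * \<tau>)) *\<^sub>R z)"
  shows "(\<lambda>n. mehler_mean (X n) f x) \<longlonglongrightarrow> mehler_mean \<tau> f x"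
proof -
  have c0: "cosh (2 * \<tau>) \<noteq> 0" using cosh_real_pos[of "2 * \<tau>"] by simp
  have ch: "(\<lambda>n. cosh (2 * X n)) \<longlonglongrightarrow> cosh (2 * \<tau>)" and th: "(\<lambda>n. tanh (2 * X n)) \<longlonglongrightarrow> tanh (2 * \<tau>)"
    using c0 by (auto intro!: tendsto_intros X)
  have "(\<lambda>n. gauss_mean f (sqrt (tanh (2 * X n))) ((1 / cosh (2 * X n)) *\<^sub>R x))
      \<longlonglongrightarrow> gauss_mean f (sqrt (tanh (2 * \<tau>))) ((1 / cosh (2 * \<tau>)) *\<^sub>R x)"
    unfolding gauss_mean_def
  proof (rule integral_dominated_convergence)
    show "integrable lborel (\<lambda>z::'a. K * std_gauss z)" by (intro integrable_mult_right) auto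
    show "AE z in lborel. norm (std_gauss z *\<^sub>R f ((1 / cosh (2 * X n)) *\<^sub>R x + sqrt (tanh (2 * X n)) *\<^sub>R z)) \<le> K * std_gauss z" for n
      using K by (auto intro!: always_eventually simp: mult.commute[of K] mult_left_mono)
    show "AE z in lborel. (\<lambda>n. std_gauss z *\<^sub>R f ((1 / cosh (2 * X n)) *\<^sub>R x + sqrt (tanh (2 * X n)) *\<^sub>R z))
        \<longlonglongrightarrow> std_gauss z *\<^sub>R f ((1 / cosh (2 * \<tau>)) *\<^sub>R x + sqrt (tanh (2 * \<tau>)) *\<^sub>R z)"
      by (intro always_eventually allI tendsto_intros isCont_tendsto_compose[OF cont] ch th c0)
  qed measurable
  then show ?thesis unfolding mehler_mean_def
    by (intro tendsto_scaleR tendsto_intros ch th) (use cosh_real_pos[of "2 * \<tau>"] in auto)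
qed

section \<open>Identification of the harmonic oscillator semigroup\<close>

text \<open>If the sampling point lies in \<open>B\<close>, then
  \<open>norm y \<le> cosh 2 * (R + norm z)\<close>, so decay in \<open>y\<close> can be bought with
  \<open>exp ((norm z)\<^sup>2 / 4)\<close>. Uniformity over \<open>\<epsilon> \<le> 1\<close>
  supplies the dominating function for the limit \<open>\<epsilon> \<rightarrow> 0\<close>.\<close>

lemma mehler_mean_indicator_bound:
  assumes R: "\<And>z::'a::euclidean_space. z \<in> B \<Longrightarrow> norm z \<le> R" and B[measurable]: "B \<in> sets borel"
  obtains K where "K > 0"
    "\<And>\<epsilon> y. 0 \<le> \<epsilon> \<Longrightarrow> \<epsilon> \<le> 1 \<Longrightarrow> norm (mehler_mean \<epsilon> (\<lambda>x. of_real (indicator B x)) y) \<le> K * exp (- (1 / (8 * (cosh 2)\<^sup>2)) * (norm y)\<^sup>2)"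
proof -
  \<comment> \<open>With \<open>(R + norm z)^2 \<le> 2 * R^2 + 2 * (norm z)^2\<close>, the factor 8
    leaves exactly \<open>R^2 / 4 + (norm z)^2 / 4\<close>.\<close>
  define \<kappa> where "\<kappa> = 1 / (8 * (cosh (2::real))\<^sup>2)"
  have ch2: "cosh (2::real) > 0" by (rule cosh_real_pos)
  define I where "I = (\<integral>z. std_gauss (z::'a) * exp ((norm z)\<^sup>2 / 4) \<partial>lborel)"
  have I0: "I \<ge> 0" unfolding I_def by (rule Bochner_Integration.integral_nonneg) auto
  have "norm (mehler_mean \<epsilon> (\<lambda>x. of_real (indicator B x)) y) \<le> (exp (R\<^sup>2 / 4) * (I + 1)) * exp (- \<kappa> * (norm y)\<^sup>2)"
    if \<epsilon>: "0 \<le> \<epsilon>" "\<epsilon> \<le> 1" for \<epsilon> y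
  proof -
    define c t where "c = cosh (2 * \<epsilon>)" and "t = tanh (2 * \<epsilon>)"
    have c: "1 \<le> c" "c \<le> cosh 2"
      using \<epsilon> unfolding c_def by (auto simp: cosh_real_ge_1 cosh_real_nonneg_le_iff)
    have t: "0 \<le> t" "t \<le> 1" using \<epsilon> tanh_real_lt_1[of "2 * \<epsilon>"] unfolding t_def by auto
    let ?J = "\<lambda>z. of_real (indicator B ((1 / c) *\<^sub>R y + sqrt t *\<^sub>R z)) :: complex"
    have "norm (mehler_mean \<epsilon> (\<lambda>x. of_real (indicator B x)) y) \<le> norm (LINT z|lborel. std_gauss z *\<^sub>R ?J z)"
      using norm_mehler_mean_le[OF \<epsilon>(1)] by (simp add: gauss_mean_def c_def t_def)
    also have "\<dots> \<le> (LINT z|lborel. (exp (R\<^sup>2 / 4) * exp (- \<kappa> * (norm y)\<^sup>2)) * (std_gauss (z::'a) * exp ((norm z)\<^sup>2 / 4)))"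
    proof (rule Bochner_Integration.integral_norm_bound_integral)
      show "integrable lborel (\<lambda>z. std_gauss z *\<^sub>R ?J z)"
        by (rule integrable_std_gauss_bounded[where K = 1]) (auto simp: indicator_def)
      show "integrable lborel (\<lambda>z::'a. (exp (R\<^sup>2 / 4) * exp (- \<kappa> * (norm y)\<^sup>2)) * (std_gauss z * exp ((norm z)\<^sup>2 / 4)))"
        by (intro integrable_mult_right integrable_std_gauss_exp)
      fix z :: 'a
      show "norm (std_gauss z *\<^sub>R ?J z) \<le> (exp (R\<^sup>2 / 4) * exp (- \<kappa> * (norm y)\<^sup>2)) * (std_gauss z * exp ((norm z)\<^sup>2 / 4))"
      proof (cases "(1 / c) *\<^sub>R y + sqrt t *\<^sub>R z \<in> B")
        case True
        have "norm ((1 / c) *\<^sub>R y) \<le> norm ((1 / c) *\<^sub>R y + sqrt t *\<^sub>R z) + norm (sqrt t *\<^sub>R z)"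
          using norm_triangle_ineq4[of "(1 / c) *\<^sub>R y + sqrt t *\<^sub>R z" "sqrt t *\<^sub>R z"] by simp
        also have "\<dots> \<le> R + norm z"
          using R[OF True] t by (intro add_mono) (auto intro: mult_left_le_one_le)
        finally have "norm y \<le> c * (R + norm z)" using c by (simp add: field_simps)
        also have "\<dots> \<le> cosh 2 * (R + norm z)"
          using c(2) order_trans[OF norm_ge_zero R[OF True]] by (intro mult_right_mono add_nonneg_nonneg) auto
        finally have "(norm y)\<^sup>2 \<le> (cosh 2 * (R + norm z))\<^sup>2" by (intro power_mono) auto
        also have "\<dots> = (cosh 2)\<^sup>2 * (R + norm z)\<^sup>2" by (rule power_mult_distrib)
        also have "\<dots> \<le> (cosh 2)\<^sup>2 * (2 * R\<^sup>2 + 2 * (norm z)\<^sup>2)"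
          using sum_squares_bound[of R "norm z"] by (intro mult_left_mono) (auto simp: power2_sum)
        finally have "\<kappa> * (norm y)\<^sup>2 \<le> \<kappa> * ((cosh 2)\<^sup>2 * (2 * R\<^sup>2 + 2 * (norm z)\<^sup>2))"
          by (intro mult_left_mono) (auto simp: \<kappa>_def)
        also have "\<dots> = R\<^sup>2 / 4 + (norm z)\<^sup>2 / 4" using ch2 by (simp add: \<kappa>_def field_simps)
        finally have "exp 0 \<le> exp (R\<^sup>2 / 4 + - \<kappa> * (norm y)\<^sup>2 + (norm z)\<^sup>2 / 4)" by (subst exp_le_cancel_iff) simp
        then have "1 \<le> exp (R\<^sup>2 / 4) * exp (- \<kappa> * (norm y)\<^sup>2) * exp ((norm z)\<^sup>2 / 4)" by (simp only: exp_add exp_zero)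
        from mult_left_mono[OF this, of "std_gauss z"] True show ?thesis by (simp add: mult_ac)
      qed simp
    qed
    also have "\<dots> = exp (R\<^sup>2 / 4) * exp (- \<kappa> * (norm y)\<^sup>2) * I" by (simp add: I_def)
    also have "\<dots> \<le> (exp (R\<^sup>2 / 4) * (I + 1)) * exp (- \<kappa> * (norm y)\<^sup>2)" by (simp add: algebra_simps)
    finally show ?thesis .
  qed
  moreover have "exp (R\<^sup>2 / 4) * (I + 1) > 0" using I0 by simp
  ultimately show ?thesis by (intro that[of "exp (R\<^sup>2 / 4) * (I + 1)"]) (auto simp: \<kappa>_def)
qed

text \<open>A bound uniform over \<open>x\<close> in a ball, for the interchange of integrals. Its
  constants depend on \<open>\<epsilon>\<close>, so the limit
  \<open>\<epsilon> \<rightarrow> 0\<close> relies on \<open>mehler_mean_indicator_bound\<close>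
  instead.\<close>

lemma mehler_kernel_upper_bound:
  fixes R :: real
  assumes \<epsilon>: "\<epsilon> > 0" and R: "R \<ge> 0"
  obtains M \<kappa> where "M > 0" "\<kappa> > 0"
    "\<And>x y::'a::euclidean_space. norm x \<le> R \<Longrightarrow> mehler_kernel \<epsilon> x y \<le> M * exp (- \<kappa> * (norm y)\<^sup>2)"
proof -
  define c s where "c = cosh (2 * \<epsilon>) / (2 * sinh (2 * \<epsilon>))" and "s = sinh (2 * \<epsilon>)"
  have c: "c > 0" using coth_half_ge[OF \<epsilon>] by (simp add: c_def)
  have s: "s > 0" using sinh_double_pos[OF \<epsilon>] by (simp add: s_def)
  define a where "a = - (real DIM('a) / 2 * ln (2 * pi * s))"
  obtain M where M: "M > 0" "\<And>r. r \<ge> 0 \<Longrightarrow> (1 + r) ^ 0 * exp ((R / s) * r - c * r\<^sup>2) \<le> M * exp (- (c / 2) * r\<^sup>2)"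
    by (rule polynomial_times_gaussian_bound[OF c, of 0 "R / s"]) blast
  have "mehler_kernel \<epsilon> x y \<le> (exp a * M) * exp (- (c / 2) * (norm y)\<^sup>2)" if x: "norm x \<le> R" for x y :: 'a
  proof -
    have "x \<bullet> y \<le> norm x * norm y" by (rule norm_cauchy_schwarz)
    also have "\<dots> \<le> R * norm y" using x by (intro mult_right_mono) auto
    finally have "(x \<bullet> y) / s \<le> (R * norm y) / s" using s by (simp add: divide_right_mono)
    moreover have "0 \<le> c * (norm x)\<^sup>2" using c by simp
    moreover have "mehler_kernel \<epsilon> x y = exp (a - c * (norm x)\<^sup>2 + (x \<bullet> y) / s - c * (norm y)\<^sup>2)"
      by (simp add: mehler_kernel_def gaussian_def c_def s_def a_def)
    ultimately have "mehler_kernel \<epsilon> x y \<le> exp (a + ((R / s) * norm y - c * (norm y)\<^sup>2))"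
      by simp
    also have "\<dots> = exp a * exp ((R / s) * norm y - c * (norm y)\<^sup>2)" by (rule exp_add)
    also have "\<dots> \<le> exp a * (M * exp (- (c / 2) * (norm y)\<^sup>2))" using M(2)[of "norm y"] by (intro mult_left_mono) auto
    finally show ?thesis by (simp only: mult.assoc)
  qed
  then show ?thesis using M(1) c by (intro that[of "exp a * M" "c / 2"]) auto
qed

lemma exp_neg_norm_sq_L2:
  assumes "a > 0"
  shows "(\<lambda>y::'a::euclidean_space. complex_of_real (exp (- a * (norm y)\<^sup>2))) \<in> L2"
proof (rule L2_I)
  show "integrable lborel (\<lambda>y::'a. exp (- (2 * a) * (norm y)\<^sup>2))"
    using assms by (intro integrable_exp_neg_norm_sq) simp
  show "(norm (complex_of_real (exp (- a * (norm y)\<^sup>2))))\<^sup>2 \<le> exp (- (2 * a) * (norm y)\<^sup>2)" for y :: 'a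
    by (simp add: exp_double[symmetric])
qed measurable

text \<open>Interchanging the integrals and using symmetry of the kernel moves the smoothing from
  \<open>u\<close>, known only as an element of \<open>L2\<close>, onto the indicator, whose
  smoothing is explicit.\<close>

lemma mehler_kernel_Fubini:
  fixes u :: "'a::euclidean_space \<Rightarrow> complex"
  assumes u: "u \<in> L2" and \<epsilon>: "\<epsilon> > 0" and B[measurable]: "B \<in> sets borel" "bounded B"
  shows "(LINT x|lborel. indicator B x *\<^sub>R (LINT y|lborel. mehler_kernel \<epsilon> x y *\<^sub>R u y))
    = (LINT y|lborel. mehler_mean \<epsilon> (\<lambda>x. of_real (indicator B x)) y * u y)"
proof -
  from \<open>bounded B\<close> obtain R where R: "R > 0" "\<And>x. x \<in> B \<Longrightarrow> norm x \<le> R" by (auto simp: bounded_pos)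
  obtain M \<kappa> where M: "M > 0" "\<kappa> > 0"
    "\<And>x y::'a. norm x \<le> R \<Longrightarrow> mehler_kernel \<epsilon> x y \<le> M * exp (- \<kappa> * (norm y)\<^sup>2)"
    by (rule mehler_kernel_upper_bound[OF \<epsilon>, of R]) (use R in auto)
  have [measurable]: "u \<in> borel_measurable borel" using u by (rule L2_measurable)
  have [measurable]: "(\<lambda>p. mehler_kernel \<epsilon> (fst p) (snd p :: 'a)) \<in> borel_measurable (borel \<Otimes>\<^sub>M borel)"
    unfolding mehler_kernel_def gaussian_def by measurable
  define g where "g = (\<lambda>y. exp (- \<kappa> * (norm y)\<^sup>2) * norm (u y))"
  from L2_mult_integrable[OF exp_neg_norm_sq_L2[OF M(2)] u] have gi: "integrable lborel g" by (simp add: g_def)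
  then have [measurable]: "g \<in> borel_measurable borel" by auto
  have g0: "g y \<ge> 0" for y by (simp add: g_def)
  have Bi: "integrable lborel (\<lambda>x. indicator B x :: real)"
    using emeasure_bounded_finite[OF \<open>bounded B\<close>] by (simp add: integrable_indicator_iff)
  have dom: "integrable (lborel \<Otimes>\<^sub>M lborel) (\<lambda>(x, y). indicator B x * (M * g y))"
  \<comment> \<open>The majorant is a product of functions of one variable each: finite measure of
    \<open>B\<close> handles \<open>x\<close>, and Cauchy-Schwarz against a Gaussian handles
    \<open>y\<close>.\<close>
  proof (rule lborel_pair.Fubini_integrable)
    show "integrable lborel (\<lambda>x. LINT y|lborel. norm (case (x, y) of (x, y) \<Rightarrow> indicator B x * (M * g y)))"
      using g0 M(1) Bi by (simp add: abs_mult)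
    show "AE x in lborel. integrable lborel (\<lambda>y. case (x, y) of (x, y) \<Rightarrow> indicator B x * (M * g y))"
      using gi by simp
  qed measurable
  define F where "F = (\<lambda>x y. (indicator B x * mehler_kernel \<epsilon> x y) *\<^sub>R u y)"
  have Fi: "integrable (lborel \<Otimes>\<^sub>M lborel) (case_prod F)"
  proof (rule Bochner_Integration.integrable_bound[OF dom])
    show "AE p in lborel \<Otimes>\<^sub>M lborel. norm (case_prod F p) \<le> norm (case p of (x, y) \<Rightarrow> indicator B x * (M * g y))"
    proof (intro always_eventually allI, clarify)
      fix x y
      have "mehler_kernel \<epsilon> x y * norm (u y) \<le> M * g y" if "x \<in> B"
        unfolding g_def mult.assoc[symmetric] using M(3) R(2)[OF that] by (intro mult_right_mono) auto
      moreover have "mehler_kernel \<epsilon> x y \<ge> 0" by (simp add: mehler_kernel_def)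
      ultimately show "norm (F x y) \<le> norm (indicator B x * (M * g y))"
        using M(1) g0[of y] by (auto simp: F_def indicator_def)
    qed
  qed (unfold F_def, measurable)
  have "(LINT x|lborel. indicator B x *\<^sub>R (LINT y|lborel. mehler_kernel \<epsilon> x y *\<^sub>R u y)) = (LINT x|lborel. LINT y|lborel. F x y)"
    unfolding F_def scaleR_scaleR[symmetric] by (simp only: integral_scaleR_right)
  also have "\<dots> = (LINT y|lborel. LINT x|lborel. F x y)"
    by (rule lborel_pair.Fubini_integral[OF Fi, symmetric])
  also have "\<dots> = (LINT y|lborel. mehler_mean \<epsilon> (\<lambda>x. of_real (indicator B x)) y * u y)"
  proof (rule arg_cong[where f = "integral\<^sup>L lborel"], rule ext)
    fix y
    have "(LINT x|lborel. F x y) = (LINT x|lborel. (mehler_kernel \<epsilon> y x *\<^sub>R of_real (indicator B x)) * u y)"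
      by (simp add: F_def mehler_kernel_commute[of \<epsilon> _ y] scaleR_conv_of_real mult_ac)
    also have "\<dots> = (LINT x|lborel. mehler_kernel \<epsilon> y x *\<^sub>R of_real (indicator B x)) * u y"
      by (rule integral_mult_left_zero)
    also have "(LINT x|lborel. mehler_kernel \<epsilon> y x *\<^sub>R complex_of_real (indicator B x)) = mehler_mean \<epsilon> (\<lambda>x. of_real (indicator B x)) y"
      by (rule mehler_kernel_integral[OF _ \<epsilon>]) measurable
    finally show "(LINT x|lborel. F x y) = mehler_mean \<epsilon> (\<lambda>x. of_real (indicator B x)) y * u y" .
  qed
  finally show ?thesis .
qed

text \<open>Lebesgue differentiation: outside a null set the value is the limit of averages over
  shrinking cubes, all of which vanish.\<close>

lemma AE_zero_if_box_integrals_zero: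
  fixes v :: "'a::euclidean_space \<Rightarrow> complex"
  assumes m[measurable]: "v \<in> borel_measurable borel"
    and i: "\<And>a b. set_integrable lborel (cbox a b) v" and z: "\<And>a b. (LINT x:cbox a b|lborel. v x) = 0"
  shows "AE x in lborel. v x = 0"
proof -
  have HK: "v integrable_on cbox a b" "integral (cbox a b) v = 0" for a b
    using set_borel_integral_eq_integral[OF i[of a b]] z[of a b] by auto
  obtain N where N: "negligible N" "\<And>x e. x \<notin> N \<Longrightarrow> 0 < e \<Longrightarrow>
      \<exists>d>0. \<forall>h. 0 < h \<and> h < d \<longrightarrow> norm (integral (cbox x (x + h *\<^sub>R One)) v /\<^sub>R h ^ DIM('a) - v x) < e"
    by (rule integrable_ccontinuous_explicit[OF HK(1)]) blast
  have "v x = 0" if xN: "x \<notin> N" for x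
  proof (rule ccontr)
    assume "v x \<noteq> 0"
    then obtain d where d: "d > 0" "\<forall>h. 0 < h \<and> h < d \<longrightarrow> norm (integral (cbox x (x + h *\<^sub>R One)) v /\<^sub>R h ^ DIM('a) - v x) < norm (v x)"
      using N(2)[OF xN, of "norm (v x)"] by auto
    have "norm (integral (cbox x (x + (d / 2) *\<^sub>R One)) v /\<^sub>R (d / 2) ^ DIM('a) - v x) < norm (v x)"
      using d(1) by (intro d(2)[rule_format]) auto
    then show False by (simp add: HK(2))
  qed
  then have "negligible {x. v x \<noteq> 0}" by (intro negligible_subset[OF N(1)]) auto
  then have "{x. v x \<noteq> 0} \<in> null_sets lborel"
    by (simp add: negligible_iff_null_sets null_sets_completion_iff)
  then show ?thesis by (rule AE_I') auto
qed

text \<open>Both sides have the same integral over every box. For the shifted times this is duality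
  combined with Fubini, and both sides of that identity converge as the shift tends to 0.\<close>

lemma semigroup_eq_mehler_mean:
  fixes T :: "real \<Rightarrow> ('a::euclidean_space \<Rightarrow> complex) \<Rightarrow> 'a \<Rightarrow> complex"
  assumes H: "harmonic_oscillator H" and TH: "generated_by_minus T H" and f: "f \<in> schwartz" and \<tau>: "\<tau> \<ge> 0"
    and mm: "\<And>\<tau>. mehler_mean \<tau> f \<in> borel_measurable borel"
  shows "AE x in lborel. T \<tau> f x = mehler_mean \<tau> f x"
proof -
  define u where "u = T \<tau> f"
  have u: "u \<in> L2" unfolding u_def
    by (intro semigroup_L2[OF T_C0[OF H TH]] \<tau> schwartz_L2[OF H] f)
  note um[measurable] = L2_measurable[OF u]
  note [measurable] = mm
  obtain K where K: "K > 0" "\<And>x. norm (f x) \<le> K" using schwartz_bounded[OF f] by auto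
  have fc: "continuous_on UNIV f" by (intro smooth_continuous_on schwartz_smooth f)
  then have [measurable]: "f \<in> borel_measurable borel" by (rule borel_measurable_continuous_onI)
  have mK: "norm (mehler_mean \<sigma> f x) \<le> K" if "\<sigma> \<ge> 0" for \<sigma> x
    by (rule order_trans[OF norm_mehler_mean_le[OF that] norm_gauss_mean_le]) (use K in auto)
  have box_i: "integrable lborel (\<lambda>x. indicator (cbox a b) x :: real)" for a b :: 'a
    by (simp add: integrable_indicator_iff emeasure_lborel_cbox_eq)
  have ui: "set_integrable lborel (cbox a b) u" for a b
    unfolding set_integrable_def
  proof (rule Bochner_Integration.integrable_bound)
    show "integrable lborel (\<lambda>x. indicator (cbox a b) x + (norm (u x))\<^sup>2 :: real)"
      by (intro Bochner_Integration.integrable_add box_i L2_integrable_square u)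
    show "AE x in lborel. norm (indicator (cbox a b) x *\<^sub>R u x) \<le> norm (indicator (cbox a b) x + (norm (u x))\<^sup>2)"
    proof (intro always_eventually allI)
      fix x
      have "2 * norm (u x) \<le> 1 + (norm (u x))\<^sup>2" using sum_squares_bound[of 1 "norm (u x)"] by simp
      with norm_ge_zero[of "u x"] have "norm (u x) \<le> 1 + (norm (u x))\<^sup>2" by linarith
      then show "norm (indicator (cbox a b) x *\<^sub>R u x) \<le> norm (indicator (cbox a b) x + (norm (u x))\<^sup>2)"
        by (auto simp: indicator_def)
    qed
  qed measurable
  have mi: "set_integrable lborel (cbox a b) (mehler_mean \<tau> f)" for a b
    unfolding set_integrable_def
    by (rule Bochner_Integration.integrable_bound[OF integrable_mult_right[OF box_i[of a b], of K]])
       (use mK[OF \<tau>] K in \<open>auto simp: indicator_def\<close>)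
  have eq: "(LINT x:cbox a b|lborel. u x) = (LINT x:cbox a b|lborel. mehler_mean \<tau> f x)" for a b
  proof -
    \<comment> \<open>Equality is first tested on one arbitrary box \<open>B\<close>.\<close>
    define B where "B = cbox a b"
    have Bm[measurable]: "B \<in> sets borel" and Bb: "bounded B" by (auto simp: B_def bounded_cbox)
    define \<epsilon> where "\<epsilon> = (\<lambda>n::nat. 1 / real (Suc n))"
    have \<epsilon>: "\<epsilon> n > 0" "\<epsilon> n \<le> 1" for n by (auto simp: \<epsilon>_def)
    have \<epsilon>0: "\<epsilon> \<longlonglongrightarrow> 0" unfolding \<epsilon>_def by (rule LIMSEQ_Suc[OF lim_1_over_n])
    let ?J = "\<lambda>x::'a. complex_of_real (indicator B x)"
    \<comment> \<open>Left: the smoothed indicator against the unknown \<open>u\<close>. Right: the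
      plain indicator against the explicit average at the later time
      \<open>\<tau> + \<epsilon> n\<close>.\<close>
    have key: "(LINT y|lborel. mehler_mean (\<epsilon> n) ?J y * u y) = (LINT x|lborel. indicator B x *\<^sub>R mehler_mean (\<tau> + \<epsilon> n) f x)" for n
    proof -
      have "(LINT y|lborel. mehler_kernel (\<epsilon> n) x y *\<^sub>R u y) = mehler_mean (\<tau> + \<epsilon> n) f x" for x
        unfolding u_def mehler_kernel_duality[OF H TH f \<tau> \<epsilon>(1)]
        by (rule mehler_kernel_integral) (use \<tau> \<epsilon>(1)[of n] in auto)
      with mehler_kernel_Fubini[OF u \<epsilon>(1) Bm Bb, of n] show ?thesis by simp
    qed
    have rhs: "(\<lambda>n. LINT x|lborel. indicator B x *\<^sub>R mehler_mean (\<tau> + \<epsilon> n) f x) \<longlonglongrightarrow> (LINT x|lborel. indicator B x *\<^sub>R mehler_mean \<tau> f x)"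
    proof (rule integral_dominated_convergence)
      show "integrable lborel (\<lambda>x. K * indicator B x)" unfolding B_def by (intro integrable_mult_right box_i)
      show "AE x in lborel. norm (indicator B x *\<^sub>R mehler_mean (\<tau> + \<epsilon> n) f x) \<le> K * indicator B x" for n
        using mK[of "\<tau> + \<epsilon> n"] \<tau> \<epsilon>(1)[of n] by (auto simp: indicator_def)
      have "(\<lambda>n. \<tau> + \<epsilon> n) \<longlonglongrightarrow> \<tau> + 0" by (intro tendsto_intros \<epsilon>0)
      then have "(\<lambda>n. mehler_mean (\<tau> + \<epsilon> n) f x) \<longlonglongrightarrow> mehler_mean \<tau> f x" for x
        using fc K by (intro mehler_mean_tendsto) (auto simp: continuous_on_eq_continuous_at)
      then show "AE x in lborel. (\<lambda>n. indicator B x *\<^sub>R mehler_mean (\<tau> + \<epsilon> n) f x) \<longlonglongrightarrow> indicator B x *\<^sub>R mehler_mean \<tau> f x"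
        by (intro always_eventually allI tendsto_intros)
    qed measurable
    from Bb obtain R where R: "\<And>x. x \<in> B \<Longrightarrow> norm x \<le> R" by (auto simp: bounded_iff)
    define \<kappa> where "\<kappa> = 1 / (8 * (cosh (2::real))\<^sup>2)"
    obtain C where C: "C > 0" "\<And>\<epsilon> y. 0 \<le> \<epsilon> \<Longrightarrow> \<epsilon> \<le> 1 \<Longrightarrow> norm (mehler_mean \<epsilon> ?J y) \<le> C * exp (- \<kappa> * (norm y)\<^sup>2)"
      unfolding \<kappa>_def by (rule mehler_mean_indicator_bound[OF R Bm]) auto
    have \<kappa>: "\<kappa> > 0" unfolding \<kappa>_def using cosh_real_pos[of 2] by simp
    from L2_mult_integrable[OF exp_neg_norm_sq_L2[OF \<kappa>] u] have gi: "integrable lborel (\<lambda>y. exp (- \<kappa> * (norm y)\<^sup>2) * norm (u y))" by simp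
    have Jm: "mehler_mean s ?J \<in> borel_measurable borel" for s
      unfolding mehler_mean_def gauss_mean_def by measurable
    note [measurable] = Jm
    \<comment> \<open>The smoothed indicators converge to the indicator where it is continuous, that
      is off the frontier, which is null as \<open>B\<close> is convex.\<close>
    have "frontier B \<in> null_sets lborel"
      using negligible_convex_frontier[OF convex_box(1)[of a b]] unfolding B_def
      by (simp add: negligible_iff_null_sets null_sets_completion_iff)
    then have fr: "AE y in lborel. y \<notin> frontier B" by (rule AE_not_in)
    have lhs: "(\<lambda>n. LINT y|lborel. mehler_mean (\<epsilon> n) ?J y * u y) \<longlonglongrightarrow> (LINT y|lborel. ?J y * u y)"
    proof (rule integral_dominated_convergence)
      show "integrable lborel (\<lambda>y. C * (exp (- \<kappa> * (norm y)\<^sup>2) * norm (u y)))" by (intro integrable_mult_right gi)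
      show "AE y in lborel. norm (mehler_mean (\<epsilon> n) ?J y * u y) \<le> C * (exp (- \<kappa> * (norm y)\<^sup>2) * norm (u y))" for n
        unfolding norm_mult mult.assoc[symmetric]
        using C(2)[of "\<epsilon> n"] \<epsilon>[of n] by (intro always_eventually allI mult_right_mono) auto
      show "AE y in lborel. (\<lambda>n. mehler_mean (\<epsilon> n) ?J y * u y) \<longlonglongrightarrow> ?J y * u y"
        using fr
      proof eventually_elim
        case (elim y)
        then have "isCont (indicator B :: 'a \<Rightarrow> real) y" by (simp add: isCont_indicator)
        then have "isCont ?J y" by (intro continuous_intros)
        then have "(\<lambda>n. mehler_mean (\<epsilon> n) ?J y) \<longlonglongrightarrow> mehler_mean 0 ?J y"
          by (intro mehler_mean_tendsto[where K = 1] \<epsilon>0) (auto simp: indicator_def)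
        then show ?case unfolding mehler_mean_0 by (intro tendsto_intros)
      qed
    qed measurable
    have "(LINT y|lborel. ?J y * u y) = (LINT x|lborel. indicator B x *\<^sub>R mehler_mean \<tau> f x)"
      using lhs rhs unfolding key by (rule LIMSEQ_unique)
    then show ?thesis by (simp add: set_lebesgue_integral_def B_def scaleR_conv_of_real)
  qed
  have "AE x in lborel. u x - mehler_mean \<tau> f x = 0"
  proof (rule AE_zero_if_box_integrals_zero)
    show "set_integrable lborel (cbox a b) (\<lambda>x. u x - mehler_mean \<tau> f x)" for a b
      using ui mi by (rule set_integral_diff(1))
    show "(LINT x:cbox a b|lborel. u x - mehler_mean \<tau> f x) = 0" for a b
      using set_integral_diff(2)[OF ui mi, of a b] eq[of a b] by simp
  qed measurable
  then show ?thesis by (simp add: u_def)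
qed

section \<open>Fractional powers of the harmonic oscillator\<close>

lemma has_derivative_quadratic_remainder:
  assumes D: "bounded_linear D" and C: "\<And>h. norm (F (x + h) - F x - D h) \<le> C * (norm h)\<^sup>2"
  shows "(F has_derivative D) (at x)"
  unfolding has_derivative_at
proof (intro conjI D)
  show "((\<lambda>h. norm (F (x + h) - F x - D h) / norm h) \<longlongrightarrow> 0) (at 0)"
  proof (rule Lim_null_comparison)
    show "eventually (\<lambda>h. norm (norm (F (x + h) - F x - D h) / norm h) \<le> C * norm h) (at 0)"
    proof (intro always_eventually allI)
      fix h
      show "norm (norm (F (x + h) - F x - D h) / norm h) \<le> C * norm h"
        using C[of h] by (cases "h = 0") (auto simp: divide_le_eq power2_eq_square mult.assoc)
    qed
    show "((\<lambda>h. C * norm h) \<longlongrightarrow> 0) (at 0)"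
      by (intro tendsto_mult_right_zero tendsto_norm_zero tendsto_ident_at)
  qed
qed

text \<open>Differentiation under the integral: second derivatives of \<open>f\<close> are bounded
  uniformly, so the Taylor remainder is quadratic in \<open>h\<close> uniformly over the sampling
  points and survives averaging.\<close>

lemma gauss_mean_has_derivative:
  fixes f :: "'a::euclidean_space \<Rightarrow> complex"
  assumes f: "f \<in> schwartz"
  shows "((\<lambda>x. gauss_mean f r (a *\<^sub>R x)) has_derivative
    (\<lambda>h. \<Sum>b\<in>Basis. (h \<bullet> b) *\<^sub>R (a *\<^sub>R gauss_mean (partial_deriv b f) r (a *\<^sub>R x)))) (at x)"
proof -
  have "\<exists>B>0. \<forall>g\<in>(\<lambda>(b, b'). partial_deriv b' (partial_deriv b f)) ` (Basis \<times> Basis). \<forall>x. norm (g x) \<le> B"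
    by (intro schwartz_uniform_bound) (auto intro!: schwartz_partial_deriv f)
  then obtain B where B: "\<And>b b' x. b \<in> Basis \<Longrightarrow> b' \<in> Basis \<Longrightarrow> norm (partial_deriv b' (partial_deriv b f) x) \<le> B"
    by fastforce
  have int: "integrable lborel (\<lambda>z. std_gauss z *\<^sub>R g (p + r *\<^sub>R z))" if "g \<in> schwartz" for g :: "'a \<Rightarrow> complex" and p
  proof -
    obtain K where "\<And>x. norm (g x) \<le> K" using schwartz_bounded[OF \<open>g \<in> schwartz\<close>] by blast
    moreover have "g \<in> borel_measurable borel"
      using smooth_continuous_on[OF schwartz_smooth[OF that]] by (rule borel_measurable_continuous_onI)
    ultimately show ?thesis by (intro integrable_gauss_mean)
  qed
  show ?thesis
  proof (rule has_derivative_quadratic_remainder)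
    show "bounded_linear (\<lambda>h. \<Sum>b\<in>Basis. (h \<bullet> b) *\<^sub>R (a *\<^sub>R gauss_mean (partial_deriv b f) r (a *\<^sub>R x)))"
      by (intro bounded_linear_sum bounded_linear_scaleR_const bounded_linear_inner_left)
    fix h :: 'a
    \<comment> \<open>Scaling the argument by \<open>a\<close> turns the increment \<open>h\<close>
      into \<open>a *\<^sub>R h\<close>; this is the source of the factor \<open>a\<close> in the
      derivative.\<close>
    define v where "v = a *\<^sub>R h"
    let ?p = "a *\<^sub>R x"
    let ?R = "\<lambda>z. f (?p + r *\<^sub>R z + v) - f (?p + r *\<^sub>R z) - (\<Sum>b\<in>Basis. (v \<bullet> b) *\<^sub>R partial_deriv b f (?p + r *\<^sub>R z))"
    have i: "integrable lborel (\<lambda>z. std_gauss z *\<^sub>R f (?p + r *\<^sub>R z))"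
      "integrable lborel (\<lambda>z. std_gauss z *\<^sub>R f (?p + r *\<^sub>R z + v))"
      "\<And>b. b \<in> Basis \<Longrightarrow> integrable lborel (\<lambda>z. std_gauss z *\<^sub>R partial_deriv b f (?p + r *\<^sub>R z))"
      using int[OF f, of ?p] int[OF f, of "?p + v"] int[OF schwartz_partial_deriv[OF f], of _ ?p]
      by (auto simp: add_ac)
    have e: "std_gauss z *\<^sub>R ?R z = std_gauss z *\<^sub>R f (?p + r *\<^sub>R z + v) - std_gauss z *\<^sub>R f (?p + r *\<^sub>R z)
        - (\<Sum>b\<in>Basis. (v \<bullet> b) *\<^sub>R (std_gauss z *\<^sub>R partial_deriv b f (?p + r *\<^sub>R z)))" for z
      by (simp add: scaleR_diff_right scaleR_sum_right mult.commute)
    have ii: "integrable lborel (\<lambda>z. std_gauss z *\<^sub>R ?R z)"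
      unfolding e by (intro Bochner_Integration.integrable_diff Bochner_Integration.integrable_sum integrable_scaleR_right i)
    have sum_i: "integrable lborel (\<lambda>z. \<Sum>b\<in>Basis. (v \<bullet> b) *\<^sub>R (std_gauss z *\<^sub>R partial_deriv b f (?p + r *\<^sub>R z)))"
      by (intro Bochner_Integration.integrable_sum integrable_scaleR_right i)
    have "(LINT z|lborel. (\<Sum>b\<in>Basis. (v \<bullet> b) *\<^sub>R (std_gauss z *\<^sub>R partial_deriv b f (?p + r *\<^sub>R z))))
        = (\<Sum>b\<in>Basis. (LINT z|lborel. (v \<bullet> b) *\<^sub>R (std_gauss z *\<^sub>R partial_deriv b f (?p + r *\<^sub>R z))))"
      by (intro Bochner_Integration.integral_sum integrable_scaleR_right i)
    also have "\<dots> = (\<Sum>b\<in>Basis. (h \<bullet> b) *\<^sub>R (a *\<^sub>R gauss_mean (partial_deriv b f) r ?p))"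
      unfolding integral_scaleR_right gauss_mean_def[symmetric] by (simp add: v_def mult.commute)
    finally have "gauss_mean f r (a *\<^sub>R (x + h)) - gauss_mean f r ?p - (\<Sum>b\<in>Basis. (h \<bullet> b) *\<^sub>R (a *\<^sub>R gauss_mean (partial_deriv b f) r ?p))
        = (LINT z|lborel. std_gauss z *\<^sub>R f (?p + r *\<^sub>R z + v)) - (LINT z|lborel. std_gauss z *\<^sub>R f (?p + r *\<^sub>R z))
          - (LINT z|lborel. (\<Sum>b\<in>Basis. (v \<bullet> b) *\<^sub>R (std_gauss z *\<^sub>R partial_deriv b f (?p + r *\<^sub>R z))))"
      by (simp add: gauss_mean_def v_def scaleR_add_right add_ac)
    also have "\<dots> = (LINT z|lborel. std_gauss z *\<^sub>R ?R z)"
      unfolding e Bochner_Integration.integral_diff[OF Bochner_Integration.integrable_diff[OF i(2,1)] sum_i]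
        Bochner_Integration.integral_diff[OF i(2,1)] ..
    also have "norm \<dots> \<le> (LINT z|lborel. ((real DIM('a) * norm v)\<^sup>2 * B) * std_gauss (z::'a))"
    proof (rule Bochner_Integration.integral_norm_bound_integral[OF ii])
      show "norm (std_gauss z *\<^sub>R ?R z) \<le> ((real DIM('a) * norm v)\<^sup>2 * B) * std_gauss z" for z
        using mult_left_mono[OF smooth_taylor2[OF schwartz_smooth[OF f] B, of "?p + r *\<^sub>R z" v], of "std_gauss z"]
        by (simp add: mult.commute)
    qed auto
    also have "\<dots> = ((real DIM('a) * \<bar>a\<bar>)\<^sup>2 * B) * (norm h)\<^sup>2"
      by (simp add: v_def power_mult_distrib mult_ac)
    finally show "norm (gauss_mean f r (a *\<^sub>R (x + h)) - gauss_mean f r ?p - (\<Sum>b\<in>Basis. (h \<bullet> b) *\<^sub>R (a *\<^sub>R gauss_mean (partial_deriv b f) r ?p)))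
        \<le> ((real DIM('a) * \<bar>a\<bar>)\<^sup>2 * B) * (norm h)\<^sup>2" .
  qed
qed

lemma partial_deriv_gauss_mean:
  assumes "f \<in> schwartz" "b \<in> Basis"
  shows "partial_deriv b (\<lambda>x. gauss_mean f r (a *\<^sub>R x)) = (\<lambda>x. a *\<^sub>R gauss_mean (partial_deriv b f) r (a *\<^sub>R x))"
proof
  fix x
  have "(\<Sum>b'\<in>Basis. (b \<bullet> b') *\<^sub>R (a *\<^sub>R gauss_mean (partial_deriv b' f) r (a *\<^sub>R x)))
      = (\<Sum>b'\<in>Basis. if b' = b then a *\<^sub>R gauss_mean (partial_deriv b' f) r (a *\<^sub>R x) else 0)"
    using assms(2) by (intro sum.cong) (auto simp: inner_Basis)
  then show "partial_deriv b (\<lambda>x. gauss_mean f r (a *\<^sub>R x)) x = a *\<^sub>R gauss_mean (partial_deriv b f) r (a *\<^sub>R x)"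
    using partial_derivI[OF gauss_mean_has_derivative[OF assms(1)], of b r a x] assms(2) by simp
qed

text \<open>The average is a product of a constant, a Gaussian in \<open>x\<close> and a rescaled
  Gaussian mean of \<open>f\<close>; these lie in an algebra closed under differentiation.\<close>

lemma mehler_mean_smooth:
  fixes f :: "'a::euclidean_space \<Rightarrow> complex"
  assumes f: "f \<in> schwartz"
  shows "smooth (mehler_mean \<tau> f)"
proof -
  define a r t where "a = 1 / cosh (2 * \<tau>)" and "r = sqrt (tanh (2 * \<tau>))" and "t = tanh (2 * \<tau>) / 2"
  define C where "C = (1 / sqrt (cosh (2 * \<tau>))) ^ DIM('a)"
  define e where "e = (\<lambda>x::'a. complex_of_real (gaussian 0 0 t x))"
  define P where "P = (\<lambda>g::'a \<Rightarrow> complex. \<lambda>x. gauss_mean g r (a *\<^sub>R x))"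
  define G where "G = insert e (coordinates \<union> P ` schwartz)"
  have "mehler_mean \<tau> f = (\<lambda>x. complex_of_real C * (e x * P f x))"
    by (simp add: mehler_mean_def fun_eq_iff C_def e_def P_def a_def r_def t_def gaussian_def scaleR_conv_of_real)
  also have "\<dots> \<in> function_algebra G"
    by (intro function_algebra.mult function_algebra.const function_algebra.generator) (auto simp: G_def f)
  finally show ?thesis
  proof (rule function_algebra_smooth)
    fix g x assume "g \<in> G"
    then show "g differentiable (at x)"
      unfolding G_def e_def P_def
      by (auto intro: gaussian_differentiable coordinates_differentiable gauss_mean_has_derivative differentiableI)
  next
    fix g b assume g: "g \<in> G" and b: "b \<in> (Basis :: 'a set)"
    have coord: "(\<lambda>y. complex_of_real (y \<bullet> b)) \<in> function_algebra G"
      using b by (intro function_algebra.generator) (auto simp: G_def coordinates_def)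
    from g consider "g = e" | "g \<in> coordinates" | h where "h \<in> schwartz" "g = P h" by (auto simp: G_def)
    then show "partial_deriv b g \<in> function_algebra G"
    proof cases
      case 1
      have "(\<lambda>y. (complex_of_real (- 2 * t) * complex_of_real (y \<bullet> b)) * e y) \<in> function_algebra G"
        by (intro function_algebra.mult function_algebra.const coord function_algebra.generator) (simp add: G_def)
      then show ?thesis unfolding 1 by (simp add: e_def partial_deriv_gaussian)
    next
      case 2
      then show ?thesis by (rule coordinates_partial_deriv)
    next
      case 3
      have "(\<lambda>x. complex_of_real a * P (partial_deriv b h) x) \<in> function_algebra G"
        using 3 b by (intro function_algebra.mult function_algebra.const function_algebra.generator)
          (auto simp: G_def intro!: schwartz_partial_deriv)
      then show ?thesis using 3 b by (simp add: P_def partial_deriv_gauss_mean scaleR_conv_of_real)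
    qed
  qed
qed

text \<open>By continuity the set of disagreement is open, and an open null set is empty. This makes
  the description in \<open>smooth_rep\<close> unambiguous.\<close>

lemma smooth_AE_eq_imp_eq:
  assumes "smooth v" "smooth w" "AE x in lborel. v x = w x"
  shows "v = w"
proof -
  have "open {x. v x \<noteq> w x}"
    by (intro open_Collect_neq smooth_continuous_on assms)
  moreover have "{x. v x \<noteq> w x} \<in> null_sets lborel"
  proof -
    have "{x. v x \<noteq> w x} \<in> sets lborel" using \<open>open _\<close> by simp
    then show ?thesis using assms(3) by (simp add: AE_iff_null_sets)
  qed
  then have "negligible {x. v x \<noteq> w x}"
    by (simp add: negligible_iff_null_sets null_sets_completionI)
  ultimately have "{x. v x \<noteq> w x} = {}" using open_not_negligible by blast
  then show ?thesis by auto
qed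

lemma smooth_rep_eqI:
  assumes "smooth w" "AE x in lborel. u x = w x"
  shows "smooth_rep u = w"
  unfolding smooth_rep_def
proof (rule the_equality)
  show "smooth w \<and> (AE x in lborel. w x = u x)" using assms by (auto elim: eventually_mono)
  fix v assume "smooth v \<and> (AE x in lborel. v x = u x)"
  then have "smooth v" "AE x in lborel. v x = w x" using assms(2) by (auto elim: eventually_elim2)
  then show "v = w" using assms(1) by (intro smooth_AE_eq_imp_eq)
qed

section \<open>Mehler averages as functions of time\<close>

lemma mehler_mean_continuous:
  fixes f :: "'a::euclidean_space \<Rightarrow> complex"
  assumes f: "f \<in> schwartz"
  shows "continuous_on UNIV (\<lambda>\<tau>. mehler_mean \<tau> f x)"
proof -
  have fc: "continuous_on UNIV f" by (intro smooth_continuous_on schwartz_smooth f)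
  obtain K where K: "\<And>x. norm (f x) \<le> K" using schwartz_bounded[OF f] by blast
  have "isCont (\<lambda>\<tau>. mehler_mean \<tau> f x) \<tau>" for \<tau>
    unfolding continuous_at_sequentially o_def
    using fc by (auto intro!: mehler_mean_tendsto K borel_measurable_continuous_onI simp: continuous_on_eq_continuous_at)
  then show ?thesis by (simp add: continuous_on_eq_continuous_at)
qed

text \<open>The prefactor alone forces decay, since \<open>cosh (2 * \<tau>)\<close> grows without
  bound and the Gaussian mean stays bounded by \<open>K\<close>.\<close>

lemma mehler_mean_tendsto_0:
  fixes f :: "'a::euclidean_space \<Rightarrow> complex"
  assumes [measurable]: "f \<in> borel_measurable borel" and K: "\<And>x. norm (f x) \<le> K"
  shows "((\<lambda>\<tau>. mehler_mean \<tau> f x) \<longlongrightarrow> 0) at_top"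
proof (rule Lim_null_comparison)
  have K0: "K \<ge> 0" using order_trans[OF norm_ge_zero K] .
  show "eventually (\<lambda>\<tau>. norm (mehler_mean \<tau> f x) \<le> K / sqrt (cosh (2 * \<tau>))) at_top"
    using eventually_ge_at_top[of 0]
  proof eventually_elim
    case (elim \<tau>)
    have c: "cosh (2 * \<tau>) \<ge> 1" by (rule cosh_real_ge_1)
    \<comment> \<open>The dimension is at least 1 and the base at most 1, so a single factor already
      bounds the power.\<close>
    have "(1 / sqrt (cosh (2 * \<tau>))) ^ DIM('a) * exp (- (tanh (2 * \<tau>) / 2) * (norm x)\<^sup>2) \<le> (1 / sqrt (cosh (2 * \<tau>))) ^ 1 * 1"
      using c elim by (intro mult_mono power_decreasing) auto
    then have "norm (mehler_mean \<tau> f x) \<le> (1 / sqrt (cosh (2 * \<tau>))) * K"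
      unfolding mehler_mean_def norm_scaleR
      using c K0 by (intro mult_mono norm_gauss_mean_le K) (auto intro: order_trans)
    then show ?case by simp
  qed
  have "filterlim (\<lambda>\<tau>::real. 2 * \<tau>) at_top at_top"
    by (intro filterlim_tendsto_pos_mult_at_top[OF tendsto_const] filterlim_ident) auto
  from filterlim_compose[OF sqrt_at_top filterlim_compose[OF cosh_real_at_top this]]
  show "((\<lambda>\<tau>. K / sqrt (cosh (2 * \<tau>))) \<longlongrightarrow> 0) at_top"
    by (intro tendsto_divide_0[OF tendsto_const] filterlim_at_top_imp_at_infinity)
qed

text \<open>Three effects compete at first order in \<open>\<tau>\<close>: the prefactor contributes
  the potential term, the spreading of scale \<open>sqrt (t \<tau>)\<close> contributes the
  Laplacian, and the contraction of the centre towards 0 contributes nothing.\<close>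

lemma mehler_mean_difference_quotient:
  fixes f :: "'a::euclidean_space \<Rightarrow> complex"
  assumes f: "f \<in> schwartz"
  shows "((\<lambda>\<tau>. (1 / \<tau>) *\<^sub>R (mehler_mean \<tau> f x - f x)) \<longlongrightarrow> - harmonic_op f x) (at_right 0)"
proof -
  obtain K where K: "\<And>x. norm (f x) \<le> K" using schwartz_bounded[OF f] by blast
  obtain B where B: "B > 0" "\<And>b b' b'' x. b \<in> Basis \<Longrightarrow> b' \<in> Basis \<Longrightarrow> b'' \<in> Basis \<Longrightarrow>
      norm (partial_deriv b'' (partial_deriv b' (partial_deriv b f)) x) \<le> B"
    using schwartz_third_partials_bounded[OF f] by metis
  define M where "M = real DIM('a) ^ 3 * B * (\<integral>z. std_gauss (z::'a) * norm z ^ 3 \<partial>lborel)"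
  define p where "p = (\<lambda>\<tau>. (1 / sqrt (cosh (2 * \<tau>))) ^ DIM('a) * exp (- (tanh (2 * \<tau>) / 2) * (norm x)\<^sup>2))"
  define t where "t = (\<lambda>\<tau>::real. tanh (2 * \<tau>))"
  define \<xi> where "\<xi> = (\<lambda>\<tau>. (1 / cosh (2 * \<tau>)) *\<^sub>R x)"
  define g where "g = (\<lambda>\<tau>. gauss_mean f (sqrt (t \<tau>)) (\<xi> \<tau>))"
  have pos: "eventually (\<lambda>\<tau>::real. \<tau> > 0) (at_right 0)" by (rule eventually_at_right_less)
  have "(t has_vector_derivative 2) (at 0)"
    unfolding t_def has_real_derivative_iff_has_vector_derivative[symmetric]
    by (auto intro!: derivative_eq_intros)
  from has_vector_derivative_right_quotient[OF this]
  have t1: "((\<lambda>\<tau>. t \<tau> / \<tau>) \<longlongrightarrow> 2) (at_right 0)" by (simp add: t_def)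
  have "((\<lambda>\<tau>. tanh (2 * \<tau>)) \<longlongrightarrow> tanh (2 * 0 :: real)) (at_right 0)"
    by (intro tendsto_intros) auto
  then have t0: "(t \<longlongrightarrow> 0) (at_right 0)" by (simp add: t_def)
  have "((\<lambda>\<tau>. (1 / cosh (2 * \<tau>)) *\<^sub>R x) \<longlongrightarrow> (1 / cosh (2 * 0 :: real)) *\<^sub>R x) (at_right 0)"
    by (intro tendsto_intros) auto
  then have \<xi>0: "(\<xi> \<longlongrightarrow> x) (at_right 0)" by (simp add: \<xi>_def)
  \<comment> \<open>The power of \<open>cosh\<close> has slope 0 at 0, so only
    \<open>tanh (2 * \<tau>) / 2\<close>, of slope 1, contributes.\<close>
  have "(p has_real_derivative - (norm x)\<^sup>2) (at 0)"
    unfolding p_def by (auto intro!: derivative_eq_intros)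
  then have "(p has_vector_derivative - (norm x)\<^sup>2) (at 0)"
    by (simp add: has_real_derivative_iff_has_vector_derivative)
  from has_vector_derivative_right_quotient[OF this]
  have p1: "((\<lambda>\<tau>. (p \<tau> - 1) / \<tau>) \<longlongrightarrow> - (norm x)\<^sup>2) (at_right 0)" by (simp add: p_def)
  have lap: "((\<lambda>\<tau>. laplacian f (\<xi> \<tau>)) \<longlongrightarrow> laplacian f x) (at_right 0)"
  proof -
    have "continuous_on UNIV (laplacian f)"
      unfolding laplacian_def[abs_def]
      by (intro continuous_on_sum smooth_continuous_on smooth_partial_deriv schwartz_smooth f)
    then show ?thesis using \<xi>0 by (simp add: continuous_on_eq_continuous_at isCont_tendsto_compose)
  qed
  \<comment> \<open>The centre moves with zero initial velocity, because the derivative of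
    \<open>1 / cosh (2 * \<tau>)\<close> vanishes at 0.\<close>
  have f1: "((\<lambda>\<tau>. (1 / \<tau>) *\<^sub>R (f (\<xi> \<tau>) - f x)) \<longlongrightarrow> 0) (at_right 0)"
  proof -
    obtain D where D: "(f has_derivative D) (at x)"
      using smooth_differentiable[OF schwartz_smooth[OF f], of x] by (auto simp: differentiable_def)
    interpret D: bounded_linear D using D by (rule has_derivative_bounded_linear)
    have "((\<lambda>\<tau>::real. 1 / cosh (2 * \<tau>)) has_real_derivative 0) (at 0)"
      by (auto intro!: derivative_eq_intros)
    then have "((\<lambda>\<tau>::real. 1 / cosh (2 * \<tau>)) has_derivative (\<lambda>h. 0)) (at 0)"
      by (simp add: has_real_derivative_iff_has_vector_derivative has_vector_derivative_def)
    from has_derivative_scaleR_left[OF this, of x] have "(\<xi> has_derivative (\<lambda>h. 0)) (at 0)"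
      by (simp add: \<xi>_def)
    moreover have "(f has_derivative D) (at (\<xi> 0))" using D by (simp add: \<xi>_def)
    ultimately have "((\<lambda>\<tau>. f (\<xi> \<tau>)) has_derivative (\<lambda>h. D 0)) (at 0)" by (rule has_derivative_compose)
    then have "((\<lambda>\<tau>. f (\<xi> \<tau>)) has_vector_derivative 0) (at 0)" by (simp add: has_vector_derivative_def D.zero)
    from has_vector_derivative_right_quotient[OF this] show ?thesis by (simp add: \<xi>_def)
  qed
  have "((\<lambda>\<tau>. (1 / \<tau>) *\<^sub>R (g \<tau> - f (\<xi> \<tau>) - (t \<tau> / 2) *\<^sub>R laplacian f (\<xi> \<tau>))) \<longlongrightarrow> 0) (at_right 0)"
  proof (rule Lim_null_comparison)
    show "eventually (\<lambda>\<tau>. norm ((1 / \<tau>) *\<^sub>R (g \<tau> - f (\<xi> \<tau>) - (t \<tau> / 2) *\<^sub>R laplacian f (\<xi> \<tau>))) \<le> (t \<tau> / \<tau>) * sqrt (t \<tau>) * M) (at_right 0)"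
      using pos
    proof eventually_elim
      case (elim \<tau>)
      then have tp: "t \<tau> > 0" by (simp add: t_def)
      have "norm (g \<tau> - f (\<xi> \<tau>) - ((sqrt (t \<tau>))\<^sup>2 / 2) *\<^sub>R laplacian f (\<xi> \<tau>)) \<le> sqrt (t \<tau>) ^ 3 * M"
        unfolding g_def M_def using tp by (intro gauss_mean_expansion[OF schwartz_smooth[OF f] K B(2)]) auto
      then have "norm (g \<tau> - f (\<xi> \<tau>) - (t \<tau> / 2) *\<^sub>R laplacian f (\<xi> \<tau>)) \<le> t \<tau> * sqrt (t \<tau>) * M"
        using tp by (simp add: power3_eq_cube)
      from mult_left_mono[OF this, of "1 / \<tau>"] elim show ?case by (simp add: mult.assoc)
    qed
    have "((\<lambda>\<tau>. (t \<tau> / \<tau>) * sqrt (t \<tau>) * M) \<longlongrightarrow> 2 * sqrt 0 * M) (at_right 0)"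
      by (intro tendsto_intros t0 t1)
    then show "((\<lambda>\<tau>. (t \<tau> / \<tau>) * sqrt (t \<tau>) * M) \<longlongrightarrow> 0) (at_right 0)" by simp
  qed
  \<comment> \<open>The three summands add up to the quotient of \<open>g\<close>: expansion error,
    Laplacian at the moving centre, displacement of the centre. As \<open>t \<tau> / \<tau>\<close>
    tends to 2, the Laplacian gets the coefficient \<open>2 / 2\<close>.\<close>
  then have "((\<lambda>\<tau>. (1 / \<tau>) *\<^sub>R (g \<tau> - f (\<xi> \<tau>) - (t \<tau> / 2) *\<^sub>R laplacian f (\<xi> \<tau>)) + (t \<tau> / \<tau> / 2) *\<^sub>R laplacian f (\<xi> \<tau>)
      + (1 / \<tau>) *\<^sub>R (f (\<xi> \<tau>) - f x)) \<longlongrightarrow> 0 + (2 / 2) *\<^sub>R laplacian f x + 0) (at_right 0)"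
    by (intro tendsto_intros t1 lap f1) auto
  then have g1: "((\<lambda>\<tau>. (1 / \<tau>) *\<^sub>R (g \<tau> - f x)) \<longlongrightarrow> laplacian f x) (at_right 0)"
    by (simp add: scaleR_diff_right)
  have g0: "(g \<longlongrightarrow> f x) (at_right 0)"
  proof -
    have "((\<lambda>\<tau>. f x + \<tau> *\<^sub>R ((1 / \<tau>) *\<^sub>R (g \<tau> - f x))) \<longlongrightarrow> f x + 0 *\<^sub>R laplacian f x) (at_right 0)"
      by (intro tendsto_intros g1)
    then have "((\<lambda>\<tau>. f x + \<tau> *\<^sub>R ((1 / \<tau>) *\<^sub>R (g \<tau> - f x))) \<longlongrightarrow> f x) (at_right 0)" by simp
    then show ?thesis by (rule Lim_transform_eventually) (use pos in \<open>eventually_elim, simp\<close>)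
  qed
  have "((\<lambda>\<tau>. ((p \<tau> - 1) / \<tau>) *\<^sub>R g \<tau> + (1 / \<tau>) *\<^sub>R (g \<tau> - f x)) \<longlongrightarrow> (- (norm x)\<^sup>2) *\<^sub>R f x + laplacian f x) (at_right 0)"
    by (intro tendsto_add tendsto_scaleR p1 g0 g1)
  then have "((\<lambda>\<tau>. ((p \<tau> - 1) / \<tau>) *\<^sub>R g \<tau> + (1 / \<tau>) *\<^sub>R (g \<tau> - f x)) \<longlongrightarrow> - harmonic_op f x) (at_right 0)"
    by (simp add: harmonic_op_def)
  moreover have "((p \<tau> - 1) / \<tau>) *\<^sub>R g \<tau> + (1 / \<tau>) *\<^sub>R (g \<tau> - f x) = (1 / \<tau>) *\<^sub>R (mehler_mean \<tau> f x - f x)" for \<tau>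
  proof -
    have "mehler_mean \<tau> f x = p \<tau> *\<^sub>R g \<tau>" by (simp add: mehler_mean_def p_def g_def t_def \<xi>_def)
    then show ?thesis by (simp add: scaleR_diff_right diff_divide_distrib scaleR_diff_left)
  qed
  ultimately show ?thesis by simp
qed

text \<open>For positive times \<open>smooth_rep\<close> selects the Mehler average itself, so
  boundedness, behaviour at both ends and measurability in \<open>\<tau>\<close> are inherited from
  the explicit formula.\<close>

lemma harmonic_case:
  fixes f :: "'a::euclidean_space \<Rightarrow> complex"
  assumes H: "harmonic_oscillator H" and TH: "generated_by_minus T H" and f: "f \<in> schwartz"
  shows "((\<lambda>\<sigma>. frac_power (\<lambda>\<tau> g. smooth_rep (T \<tau> g)) \<sigma> f x) \<longlongrightarrow> harmonic_op f x) (at_left 1)"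
    and "((\<lambda>\<sigma>. frac_power (\<lambda>\<tau> g. smooth_rep (T \<tau> g)) \<sigma> f x) \<longlongrightarrow> f x) (at_right 0)"
proof -
  obtain K where K: "\<And>x. norm (f x) \<le> K" using schwartz_bounded[OF f] by blast
  have fm: "f \<in> borel_measurable borel"
    using smooth_continuous_on[OF schwartz_smooth[OF f]] by (rule borel_measurable_continuous_onI)
  have mm: "mehler_mean \<tau> f \<in> borel_measurable borel" for \<tau>
    using smooth_continuous_on[OF mehler_mean_smooth[OF f]] by (rule borel_measurable_continuous_onI)
  define S where "S = (\<lambda>\<tau> g. smooth_rep (T \<tau> g))"
  have S: "S \<tau> f = mehler_mean \<tau> f" if "\<tau> > 0" for \<tau>
    unfolding S_def using that
    by (intro smooth_rep_eqI mehler_mean_smooth f semigroup_eq_mehler_mean[OF H TH f _ mm]) simp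
  have m: "(\<lambda>\<tau>. indicator {0<..} \<tau> *\<^sub>R S \<tau> f x) \<in> borel_measurable borel"
  proof -
    have [measurable]: "(\<lambda>\<tau>. mehler_mean \<tau> f x) \<in> borel_measurable borel"
      using mehler_mean_continuous[OF f] by (rule borel_measurable_continuous_onI)
    have "(\<lambda>\<tau>. indicator {0<..} \<tau> *\<^sub>R mehler_mean \<tau> f x) \<in> borel_measurable borel" by measurable
    also have "(\<lambda>\<tau>. indicator {0<..} \<tau> *\<^sub>R mehler_mean \<tau> f x) = (\<lambda>\<tau>. indicator {0<..} \<tau> *\<^sub>R S \<tau> f x)"
      by (auto simp: fun_eq_iff indicator_def S)
    finally show ?thesis .
  qed
  have b: "norm (S \<tau> f x) \<le> K" if "\<tau> > 0" for \<tau>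
    unfolding S[OF that] using that
    by (intro order_trans[OF norm_mehler_mean_le norm_gauss_mean_le] fm K) simp
  have pos: "eventually (\<lambda>\<tau>::real. \<tau> > 0) (at_right 0)" by (rule eventually_at_right_less)
  have l0: "((\<lambda>\<tau>. (1 / \<tau>) *\<^sub>R (S \<tau> f x - f x)) \<longlongrightarrow> - harmonic_op f x) (at_right 0)"
    by (rule Lim_transform_eventually[OF mehler_mean_difference_quotient[OF f]])
       (use pos in \<open>eventually_elim, simp add: S\<close>)
  have li: "((\<lambda>\<tau>. S \<tau> f x) \<longlongrightarrow> 0) at_top"
    by (rule Lim_transform_eventually[OF mehler_mean_tendsto_0[OF fm K]])
       (use eventually_gt_at_top[of 0] in \<open>eventually_elim, simp add: S\<close>)
  from frac_power_limits[where S = S and f = f and p = x, OF m b l0 li]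
  show "((\<lambda>\<sigma>. frac_power (\<lambda>\<tau> g. smooth_rep (T \<tau> g)) \<sigma> f x) \<longlongrightarrow> harmonic_op f x) (at_left 1)"
    and "((\<lambda>\<sigma>. frac_power (\<lambda>\<tau> g. smooth_rep (T \<tau> g)) \<sigma> f x) \<longlongrightarrow> f x) (at_right 0)"
    unfolding S_def by auto
qed

theorem corollary1p4:
  shows "(\<forall>f \<in> (schwartz :: ('a::euclidean_space \<Rightarrow> complex) set). \<forall>x.
            ((\<lambda>\<sigma>. frac_power laplace_semigroup \<sigma> f x) \<longlongrightarrow> - laplacian f x) (at_left 1) \<and>
            ((\<lambda>\<sigma>. frac_power laplace_semigroup \<sigma> f x) \<longlongrightarrow> f x) (at_right 0))
       \<and> (\<forall>H T. harmonic_oscillator H \<longrightarrow> generated_by_minus T H \<longrightarrow>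
            (\<forall>f \<in> (schwartz :: ('a \<Rightarrow> complex) set). \<forall>x.
              ((\<lambda>\<sigma>. frac_power (\<lambda>\<tau> g. smooth_rep (T \<tau> g)) \<sigma> f x) \<longlongrightarrow> harmonic_op f x) (at_left 1) \<and>
              ((\<lambda>\<sigma>. frac_power (\<lambda>\<tau> g. smooth_rep (T \<tau> g)) \<sigma> f x) \<longlongrightarrow> f x) (at_right 0)))
       \<and> (\<forall>f \<in> (schwartz :: (real \<times> 'a \<Rightarrow> complex) set). \<forall>p.
            ((\<lambda>\<sigma>. frac_power heat_semigroup \<sigma> f p) \<longlongrightarrow> heat_op f p) (at_left 1) \<and>
            ((\<lambda>\<sigma>. frac_power heat_semigroup \<sigma> f p) \<longlongrightarrow> f p) (at_right 0))"
  by (intro conjI ballI allI impI laplace_case harmonic_case heat_case)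

end
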